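(* Let $\mathcal{E}$ be an exact category. (1) The Yoneda embedding $\Upsilon\colon \mathcal{E}\to \operatorname{mod}_{\mathsf{adm}}(\mathcal{E})$ is left exact. (2) If $\mathcal{C}$ is an exact category and $\Phi\colon \mathcal{E}\to \mathcal{C}$ is a left exact functor, then there exists a functor $\overline{\Phi}\colon \operatorname{mod}_{\mathsf{adm}}(\mathcal{E})\to \mathcal{C}$, unique up to isomorphism, which is exact and satisfies $\overline{\Phi}\circ \Upsilon=\Phi$.
   Context: All categories are essentially small and additive; subcategories are full and closed under isomorphisms. Exact categories are in the sense of Quillen, with conflations, inflations and deflations; no idempotent completeness is assumed. A functor is exact if it is additive and maps conflations to conflations. A morphism is admissible if it is a composite $m\circ p$ with $p$ a deflation and $m$ an inflation. An additive functor $F$ of exact categories is left exact if for each conflation $X\xrightarrow{f}Y\xrightarrow{g}Z$, $F(g)$ is admissible and $F(f)$ is an inflation which is a kernel of $F(g)$. $\operatorname{Mod}(\mathcal{E})$ is the category of additive contravariant functors $\mathcal{E}\to\mathsf{Ab}$, $\Upsilon(X)=\operatorname{Hom}_{\mathcal{E}}(-,X)$. $\operatorname{mod}_{\mathsf{adm}}(\mathcal{E})\subseteq\operatorname{Mod}(\mathcal{E})$ is the full subcategory of functors $F$ with an exact sequence $\Upsilon(X)\xrightarrow{\Upsilon(f)}\Upsilon(Y)\to F\to 0$ with $f$ admissible in $\mathcal{E}$. It is extension-closed in $\operatorname{Mod}(\mathcal{E})$ and carries the inherited exact structure. *)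

theory Defs
  imports "HOL-Algebra.Coset"
begin

section \<open>Additive categories\<close>

text \<open>
  A category consists of a set of objects and a set of arrows; each arrow knows its domain and
  codomain, so distinct hom-sets are disjoint. Composition is written in the usual order:
  \<open>g \<cdot> f\<close> means first \<open>f\<close>, then \<open>g\<close>. The fields \<open>plus_arr\<close> and \<open>zero_arr\<close> carry the
  enrichment in abelian groups. Values of the operations outside their intended domains
  are irrelevant.
\<close>

record ('o, 'm) addcat =
  Obj :: "'o set"
  Arr :: "'m set"
  Dom :: "'m \<Rightarrow> 'o"
  Cod :: "'m \<Rightarrow> 'o"
  Id :: "'o \<Rightarrow> 'm"
  Comp :: "'m \<Rightarrow> 'm \<Rightarrow> 'm"  (infixl "\<cdot>\<index>" 70)
  plus_arr :: "'m \<Rightarrow> 'm \<Rightarrow> 'm"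
  zero_arr :: "'o \<Rightarrow> 'o \<Rightarrow> 'm"

definition Hom :: "('o, 'm, 'x) addcat_scheme \<Rightarrow> 'o \<Rightarrow> 'o \<Rightarrow> 'm set" where
  "Hom C X Y = {f \<in> Arr C. Dom C f = X \<and> Cod C f = Y}"

text \<open>The group structure on a hom-set, as a (multiplicatively written) \<^typ>\<open>'m monoid\<close> record.\<close>

definition hom_group :: "('o, 'm, 'x) addcat_scheme \<Rightarrow> 'o \<Rightarrow> 'o \<Rightarrow> 'm monoid" where
  "hom_group C X Y = \<lparr>carrier = Hom C X Y, mult = plus_arr C, one = zero_arr C X Y\<rparr>"

locale is_category =
  fixes C :: "('o, 'm, 'x) addcat_scheme" (structure)
  assumes dom_closed: "f \<in> Arr C \<Longrightarrow> Dom C f \<in> Obj C"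
    and cod_closed: "f \<in> Arr C \<Longrightarrow> Cod C f \<in> Obj C"
    and id_closed: "X \<in> Obj C \<Longrightarrow> Id C X \<in> Hom C X X"
    and comp_closed: "\<lbrakk>f \<in> Hom C X Y; g \<in> Hom C Y Z\<rbrakk> \<Longrightarrow> g \<cdot> f \<in> Hom C X Z"
    and comp_id_right: "f \<in> Hom C X Y \<Longrightarrow> f \<cdot> Id C X = f"
    and comp_id_left: "f \<in> Hom C X Y \<Longrightarrow> Id C Y \<cdot> f = f"
    and comp_assoc:
      "\<lbrakk>f \<in> Hom C W X; g \<in> Hom C X Y; h \<in> Hom C Y Z\<rbrakk> \<Longrightarrow> (h \<cdot> g) \<cdot> f = h \<cdot> (g \<cdot> f)"

definition zero_object :: "('o, 'm, 'x) addcat_scheme \<Rightarrow> 'o \<Rightarrow> bool" where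
  "zero_object C Z \<longleftrightarrow>
     Z \<in> Obj C \<and> (\<forall>X\<in>Obj C. (\<exists>!f. f \<in> Hom C Z X) \<and> (\<exists>!f. f \<in> Hom C X Z))"

definition biproduct ::
  "('o, 'm, 'x) addcat_scheme \<Rightarrow> 'o \<Rightarrow> 'o \<Rightarrow> 'o \<Rightarrow> 'm \<Rightarrow> 'm \<Rightarrow> 'm \<Rightarrow> 'm \<Rightarrow> bool" where
  "biproduct C X Y P i j p q \<longleftrightarrow>
     i \<in> Hom C X P \<and> j \<in> Hom C Y P \<and> p \<in> Hom C P X \<and> q \<in> Hom C P Y \<and>
     p \<cdot>\<^bsub>C\<^esub> i = Id C X \<and> q \<cdot>\<^bsub>C\<^esub> j = Id C Y \<and>
     p \<cdot>\<^bsub>C\<^esub> j = zero_arr C Y X \<and> q \<cdot>\<^bsub>C\<^esub> i = zero_arr C X Y \<and>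
     plus_arr C (i \<cdot>\<^bsub>C\<^esub> p) (j \<cdot>\<^bsub>C\<^esub> q) = Id C P"

locale preadditive_category = is_category C
  for C :: "('o, 'm, 'x) addcat_scheme" (structure) +
  assumes hom_comm_group: "\<lbrakk>X \<in> Obj C; Y \<in> Obj C\<rbrakk> \<Longrightarrow> comm_group (hom_group C X Y)"
    and comp_plus_left:
      "\<lbrakk>f \<in> Hom C X Y; g \<in> Hom C Y Z; g' \<in> Hom C Y Z\<rbrakk>
        \<Longrightarrow> plus_arr C g g' \<cdot> f = plus_arr C (g \<cdot> f) (g' \<cdot> f)"
    and comp_plus_right:
      "\<lbrakk>f \<in> Hom C X Y; f' \<in> Hom C X Y; g \<in> Hom C Y Z\<rbrakk>
        \<Longrightarrow> g \<cdot> plus_arr C f f' = plus_arr C (g \<cdot> f) (g \<cdot> f')"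

locale additive_category = preadditive_category C
  for C :: "('o, 'm, 'x) addcat_scheme" (structure) +
  assumes has_zero_object: "\<exists>Z. zero_object C Z"
    and has_biproducts:
      "\<lbrakk>X \<in> Obj C; Y \<in> Obj C\<rbrakk> \<Longrightarrow> \<exists>P i j p q. biproduct C X Y P i j p q"

definition iso_arr :: "('o, 'm, 'x) addcat_scheme \<Rightarrow> 'm \<Rightarrow> bool" where
  "iso_arr C f \<longleftrightarrow> f \<in> Arr C \<and>
     (\<exists>g \<in> Hom C (Cod C f) (Dom C f).
        g \<cdot>\<^bsub>C\<^esub> f = Id C (Dom C f) \<and> f \<cdot>\<^bsub>C\<^esub> g = Id C (Cod C f))"

definition is_kernel :: "('o, 'm, 'x) addcat_scheme \<Rightarrow> 'm \<Rightarrow> 'm \<Rightarrow> bool" where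
  "is_kernel C k f \<longleftrightarrow>
     k \<in> Arr C \<and> f \<in> Arr C \<and> Cod C k = Dom C f \<and>
     f \<cdot>\<^bsub>C\<^esub> k = zero_arr C (Dom C k) (Cod C f) \<and>
     (\<forall>h\<in>Arr C. Cod C h = Dom C f \<and> f \<cdot>\<^bsub>C\<^esub> h = zero_arr C (Dom C h) (Cod C f) \<longrightarrow>
        (\<exists>!u. u \<in> Hom C (Dom C h) (Dom C k) \<and> k \<cdot>\<^bsub>C\<^esub> u = h))"

definition is_cokernel :: "('o, 'm, 'x) addcat_scheme \<Rightarrow> 'm \<Rightarrow> 'm \<Rightarrow> bool" where
  "is_cokernel C c f \<longleftrightarrow>
     c \<in> Arr C \<and> f \<in> Arr C \<and> Cod C f = Dom C c \<and>
     c \<cdot>\<^bsub>C\<^esub> f = zero_arr C (Dom C f) (Cod C c) \<and>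
     (\<forall>h\<in>Arr C. Dom C h = Cod C f \<and> h \<cdot>\<^bsub>C\<^esub> f = zero_arr C (Dom C f) (Cod C h) \<longrightarrow>
        (\<exists>!u. u \<in> Hom C (Cod C c) (Cod C h) \<and> u \<cdot>\<^bsub>C\<^esub> c = h))"

text \<open>\<open>is_pushout C i f f' i'\<close>: the square \<open>f' \<cdot> i = i' \<cdot> f\<close> is a pushout of \<open>i\<close> along \<open>f\<close>
  (so \<open>i'\<close> is the arrow opposite to \<open>i\<close>); dually for \<open>is_pullback\<close>, where the square is
  \<open>p \<cdot> f' = f \<cdot> p'\<close>.\<close>

definition is_pushout :: "('o, 'm, 'x) addcat_scheme \<Rightarrow> 'm \<Rightarrow> 'm \<Rightarrow> 'm \<Rightarrow> 'm \<Rightarrow> bool" where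
  "is_pushout C i f f' i' \<longleftrightarrow>
     i \<in> Arr C \<and> f \<in> Arr C \<and> f' \<in> Arr C \<and> i' \<in> Arr C \<and>
     Dom C i = Dom C f \<and> Dom C f' = Cod C i \<and> Dom C i' = Cod C f \<and> Cod C f' = Cod C i' \<and>
     f' \<cdot>\<^bsub>C\<^esub> i = i' \<cdot>\<^bsub>C\<^esub> f \<and>
     (\<forall>a\<in>Arr C. \<forall>b\<in>Arr C.
        Dom C a = Cod C i \<and> Dom C b = Cod C f \<and> Cod C a = Cod C b \<and>
        a \<cdot>\<^bsub>C\<^esub> i = b \<cdot>\<^bsub>C\<^esub> f \<longrightarrow>
        (\<exists>!u. u \<in> Hom C (Cod C i') (Cod C a) \<and> u \<cdot>\<^bsub>C\<^esub> f' = a \<and> u \<cdot>\<^bsub>C\<^esub> i' = b))"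

definition is_pullback :: "('o, 'm, 'x) addcat_scheme \<Rightarrow> 'm \<Rightarrow> 'm \<Rightarrow> 'm \<Rightarrow> 'm \<Rightarrow> bool" where
  "is_pullback C p f f' p' \<longleftrightarrow>
     p \<in> Arr C \<and> f \<in> Arr C \<and> f' \<in> Arr C \<and> p' \<in> Arr C \<and>
     Cod C p = Cod C f \<and> Cod C f' = Dom C p \<and> Cod C p' = Dom C f \<and> Dom C f' = Dom C p' \<and>
     p \<cdot>\<^bsub>C\<^esub> f' = f \<cdot>\<^bsub>C\<^esub> p' \<and>
     (\<forall>a\<in>Arr C. \<forall>b\<in>Arr C.
        Cod C a = Dom C p \<and> Cod C b = Dom C f \<and> Dom C a = Dom C b \<and>
        p \<cdot>\<^bsub>C\<^esub> a = f \<cdot>\<^bsub>C\<^esub> b \<longrightarrow>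
        (\<exists>!u. u \<in> Hom C (Dom C a) (Dom C p') \<and> f' \<cdot>\<^bsub>C\<^esub> u = a \<and> p' \<cdot>\<^bsub>C\<^esub> u = b))"


section \<open>Exact categories\<close>

record ('o, 'm) excat = "('o, 'm) addcat" +
  Confl :: "('m \<times> 'm) set"

definition inflation :: "('o, 'm, 'x) excat_scheme \<Rightarrow> 'm \<Rightarrow> bool" where
  "inflation E f \<longleftrightarrow> (\<exists>g. (f, g) \<in> Confl E)"

definition deflation :: "('o, 'm, 'x) excat_scheme \<Rightarrow> 'm \<Rightarrow> bool" where
  "deflation E g \<longleftrightarrow> (\<exists>f. (f, g) \<in> Confl E)"

definition admissible :: "('o, 'm, 'x) excat_scheme \<Rightarrow> 'm \<Rightarrow> bool" where
  "admissible E f \<longleftrightarrow>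
     (\<exists>p m. deflation E p \<and> inflation E m \<and> Cod E p = Dom E m \<and> f = m \<cdot>\<^bsub>E\<^esub> p)"

text \<open>Quillen's axioms, in the self-dual form of Keller and Buehler (without the redundant
  ``obscure axiom'').\<close>

locale exact_category = additive_category E
  for E :: "('o, 'm, 'x) excat_scheme" (structure) +
  assumes confl_kernel_cokernel:
      "(f, g) \<in> Confl E \<Longrightarrow> is_kernel E f g \<and> is_cokernel E g f"
    and confl_iso_closed:
      "\<lbrakk>(f, g) \<in> Confl E; f' \<in> Arr E; g' \<in> Arr E; Cod E f' = Dom E g';
        iso_arr E a; iso_arr E b; iso_arr E c;
        a \<in> Hom E (Dom E f) (Dom E f'); b \<in> Hom E (Cod E f) (Cod E f');
        c \<in> Hom E (Cod E g) (Cod E g');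
        b \<cdot> f = f' \<cdot> a; c \<cdot> g = g' \<cdot> b\<rbrakk> \<Longrightarrow> (f', g') \<in> Confl E"
    and id_inflation: "X \<in> Obj E \<Longrightarrow> inflation E (Id E X)"
    and id_deflation: "X \<in> Obj E \<Longrightarrow> deflation E (Id E X)"
    and inflation_comp:
      "\<lbrakk>inflation E f; inflation E g; Cod E f = Dom E g\<rbrakk> \<Longrightarrow> inflation E (g \<cdot> f)"
    and deflation_comp:
      "\<lbrakk>deflation E f; deflation E g; Cod E f = Dom E g\<rbrakk> \<Longrightarrow> deflation E (g \<cdot> f)"
    and inflation_pushout:
      "\<lbrakk>inflation E i; f \<in> Arr E; Dom E f = Dom E i\<rbrakk>
        \<Longrightarrow> \<exists>f' i'. is_pushout E i f f' i' \<and> inflation E i'"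
    and deflation_pullback:
      "\<lbrakk>deflation E p; f \<in> Arr E; Cod E f = Cod E p\<rbrakk>
        \<Longrightarrow> \<exists>f' p'. is_pullback E p f f' p' \<and> deflation E p'"


section \<open>Functors\<close>

text \<open>Functors are genuine set-theoretic maps on objects and arrows: they are normalized to be
  \<^const>\<open>undefined\<close> outside their domain, so that HOL equality of functors is equality on all
  objects and arrows of the source. The same convention is used for natural transformations.\<close>

record ('o, 'm, 'p, 'n) cfunctor =
  fobj :: "'o \<Rightarrow> 'p"
  fmap :: "'m \<Rightarrow> 'n"

locale additive_functor =
  fixes C :: "('o, 'm, 'x) addcat_scheme"
    and D :: "('p, 'n, 'y) addcat_scheme"
    and F :: "('o, 'm, 'p, 'n) cfunctor"
  assumes fobj_extensional: "fobj F \<in> extensional (Obj C)"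
    and fmap_extensional: "fmap F \<in> extensional (Arr C)"
    and fobj_closed: "X \<in> Obj C \<Longrightarrow> fobj F X \<in> Obj D"
    and fmap_closed: "f \<in> Hom C X Y \<Longrightarrow> fmap F f \<in> Hom D (fobj F X) (fobj F Y)"
    and fmap_id: "X \<in> Obj C \<Longrightarrow> fmap F (Id C X) = Id D (fobj F X)"
    and fmap_comp:
      "\<lbrakk>f \<in> Hom C X Y; g \<in> Hom C Y Z\<rbrakk> \<Longrightarrow> fmap F (g \<cdot>\<^bsub>C\<^esub> f) = fmap F g \<cdot>\<^bsub>D\<^esub> fmap F f"
    and fmap_plus:
      "\<lbrakk>f \<in> Hom C X Y; g \<in> Hom C X Y\<rbrakk>
        \<Longrightarrow> fmap F (plus_arr C f g) = plus_arr D (fmap F f) (fmap F g)"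

definition comp_functor ::
  "('o, 'm, 'x) addcat_scheme \<Rightarrow> ('p, 'n, 'q, 'r) cfunctor \<Rightarrow> ('o, 'm, 'p, 'n) cfunctor
    \<Rightarrow> ('o, 'm, 'q, 'r) cfunctor" where
  "comp_functor C G F =
     \<lparr>fobj = compose (Obj C) (fobj G) (fobj F), fmap = compose (Arr C) (fmap G) (fmap F)\<rparr>"

definition nat_trans ::
  "('o, 'm, 'x) addcat_scheme \<Rightarrow> ('p, 'n, 'y) addcat_scheme \<Rightarrow> ('o, 'm, 'p, 'n) cfunctor
    \<Rightarrow> ('o, 'm, 'p, 'n) cfunctor \<Rightarrow> ('o \<Rightarrow> 'n) \<Rightarrow> bool" where
  "nat_trans C D F G \<eta> \<longleftrightarrow>
     \<eta> \<in> extensional (Obj C) \<and>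
     (\<forall>X\<in>Obj C. \<eta> X \<in> Hom D (fobj F X) (fobj G X)) \<and>
     (\<forall>f\<in>Arr C. \<eta> (Cod C f) \<cdot>\<^bsub>D\<^esub> fmap F f = fmap G f \<cdot>\<^bsub>D\<^esub> \<eta> (Dom C f))"

definition isomorphic_functors ::
  "('o, 'm, 'x) addcat_scheme \<Rightarrow> ('p, 'n, 'y) addcat_scheme \<Rightarrow> ('o, 'm, 'p, 'n) cfunctor
    \<Rightarrow> ('o, 'm, 'p, 'n) cfunctor \<Rightarrow> bool" where
  "isomorphic_functors C D F G \<longleftrightarrow>
     (\<exists>\<eta>. nat_trans C D F G \<eta> \<and> (\<forall>X\<in>Obj C. iso_arr D (\<eta> X)))"

definition exact_functor ::
  "('o, 'm, 'x) excat_scheme \<Rightarrow> ('p, 'n, 'y) excat_scheme \<Rightarrow> ('o, 'm, 'p, 'n) cfunctor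
    \<Rightarrow> bool" where
  "exact_functor C D F \<longleftrightarrow>
     additive_functor C D F \<and> (\<forall>(f, g) \<in> Confl C. (fmap F f, fmap F g) \<in> Confl D)"

definition left_exact_functor ::
  "('o, 'm, 'x) excat_scheme \<Rightarrow> ('p, 'n, 'y) excat_scheme \<Rightarrow> ('o, 'm, 'p, 'n) cfunctor
    \<Rightarrow> bool" where
  "left_exact_functor C D F \<longleftrightarrow>
     additive_functor C D F \<and>
     (\<forall>(f, g) \<in> Confl C.
        admissible D (fmap F g) \<and> inflation D (fmap F f) \<and> is_kernel D (fmap F f) (fmap F g))"


section \<open>Abelian groups and modules over a category\<close>

definition op_cat :: "('o, 'm, 'x) addcat_scheme \<Rightarrow> ('o, 'm) addcat" where
  "op_cat C =
     \<lparr>Obj = Obj C, Arr = Arr C, Dom = Cod C, Cod = Dom C, Id = Id C,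
      Comp = (\<lambda>g f. f \<cdot>\<^bsub>C\<^esub> g), plus_arr = plus_arr C, zero_arr = (\<lambda>X Y. zero_arr C Y X)\<rparr>"

text \<open>Arrows carrying their source and target explicitly.\<close>

datatype ('o, 'd) arrow = Arrow (src: 'o) (tgt: 'o) (dat: 'd)

text \<open>
  The category of abelian groups whose underlying set is a subset of the type \<open>'u\<close>, which
  plays the role of the universe of sets. Two records differing only in the values
  of the multiplication outside the carrier are isomorphic copies of each other.
\<close>

definition Ab :: "('u monoid, ('u monoid, 'u \<Rightarrow> 'u) arrow) addcat" where
  "Ab =
     \<lparr>Obj = {G. comm_group G},
      Arr = {Arrow G H h | G H h.
               comm_group G \<and> comm_group H \<and> h \<in> hom G H \<and> h \<in> extensional (carrier G)},
      Dom = src, Cod = tgt,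
      Id = (\<lambda>G. Arrow G G (\<lambda>x\<in>carrier G. x)),
      Comp = (\<lambda>b a. Arrow (src a) (tgt b) (compose (carrier (src a)) (dat b) (dat a))),
      plus_arr = (\<lambda>a b. Arrow (src a) (tgt a)
                    (\<lambda>x\<in>carrier (src a). dat a x \<otimes>\<^bsub>tgt a\<^esub> dat b x)),
      zero_arr = (\<lambda>G H. Arrow G H (\<lambda>x\<in>carrier G. \<one>\<^bsub>H\<^esub>))\<rparr>"

text \<open>The category of additive functors from \<open>C\<close> to \<open>D\<close> and natural transformations.\<close>

definition additive_functor_cat ::
  "('o, 'm, 'x) addcat_scheme \<Rightarrow> ('p, 'n, 'y) addcat_scheme
    \<Rightarrow> (('o, 'm, 'p, 'n) cfunctor, (('o, 'm, 'p, 'n) cfunctor, 'o \<Rightarrow> 'n) arrow) addcat" where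
  "additive_functor_cat C D =
     \<lparr>Obj = {F. additive_functor C D F},
      Arr = {Arrow F G \<eta> | F G \<eta>.
               additive_functor C D F \<and> additive_functor C D G \<and> nat_trans C D F G \<eta>},
      Dom = src, Cod = tgt,
      Id = (\<lambda>F. Arrow F F (\<lambda>X\<in>Obj C. Id D (fobj F X))),
      Comp = (\<lambda>b a. Arrow (src a) (tgt b) (\<lambda>X\<in>Obj C. dat b X \<cdot>\<^bsub>D\<^esub> dat a X)),
      plus_arr = (\<lambda>a b. Arrow (src a) (tgt a) (\<lambda>X\<in>Obj C. plus_arr D (dat a X) (dat b X))),
      zero_arr = (\<lambda>F G. Arrow F G (\<lambda>X\<in>Obj C. zero_arr D (fobj F X) (fobj G X)))\<rparr>"

type_synonym ('o, 'u) module =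
  "('o, 'u, 'u monoid, ('u monoid, 'u \<Rightarrow> 'u) arrow) cfunctor"

type_synonym ('o, 'u) module_arrow =
  "(('o, 'u) module, 'o \<Rightarrow> ('u monoid, 'u \<Rightarrow> 'u) arrow) arrow"

text \<open>
  \<open>Mod(E)\<close>. The arrows of \<open>E\<close> are required to be elements of the universe \<open>'u\<close>, so that each
  hom-set of \<open>E\<close> is literally the underlying set of an object of \<^const>\<open>Ab\<close>. The set of arrows
  of \<open>E\<close> is an arbitrary subset of \<open>'u\<close>, so the universe may be taken arbitrarily large
  compared with \<open>E\<close>.
\<close>

definition Mod_cat :: "('o, 'u, 'x) addcat_scheme \<Rightarrow> (('o, 'u) module, ('o, 'u) module_arrow) addcat"
  where "Mod_cat E = additive_functor_cat (op_cat E) Ab"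

text \<open>The homomorphism of abelian groups underlying the component of \<open>\<alpha>\<close> at \<open>Z\<close>.\<close>

abbreviation component :: "('o, 'u) module_arrow \<Rightarrow> 'o \<Rightarrow> 'u \<Rightarrow> 'u" where
  "component \<alpha> Z \<equiv> dat (dat \<alpha> Z)"

text \<open>Exactness in \<open>Mod(E)\<close> is exactness of abelian groups at every object of \<open>E\<close>.\<close>

definition right_exact_seq ::
  "('o, 'u, 'x) addcat_scheme \<Rightarrow> ('o, 'u) module_arrow \<Rightarrow> ('o, 'u) module_arrow \<Rightarrow> bool" where
  "right_exact_seq E \<alpha> \<beta> \<longleftrightarrow>
     \<alpha> \<in> Arr (Mod_cat E) \<and> \<beta> \<in> Arr (Mod_cat E) \<and> tgt \<alpha> = src \<beta> \<and>
     (\<forall>Z\<in>Obj E.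
        component \<alpha> Z ` carrier (fobj (src \<alpha>) Z)
          = kernel (fobj (src \<beta>) Z) (fobj (tgt \<beta>) Z) (component \<beta> Z) \<and>
        component \<beta> Z ` carrier (fobj (src \<beta>) Z) = carrier (fobj (tgt \<beta>) Z))"

definition short_exact_seq ::
  "('o, 'u, 'x) addcat_scheme \<Rightarrow> ('o, 'u) module_arrow \<Rightarrow> ('o, 'u) module_arrow \<Rightarrow> bool" where
  "short_exact_seq E \<alpha> \<beta> \<longleftrightarrow>
     right_exact_seq E \<alpha> \<beta> \<and>
     (\<forall>Z\<in>Obj E. inj_on (component \<alpha> Z) (carrier (fobj (src \<alpha>) Z)))"


section \<open>The Yoneda embedding and admissibly presented modules\<close>

definition yoneda_obj :: "('o, 'u, 'x) addcat_scheme \<Rightarrow> 'o \<Rightarrow> ('o, 'u) module" where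
  "yoneda_obj E X =
     \<lparr>fobj = (\<lambda>Z\<in>Obj E. hom_group E Z X),
      fmap = (\<lambda>g\<in>Arr E. Arrow (hom_group E (Cod E g) X) (hom_group E (Dom E g) X)
                           (\<lambda>h\<in>Hom E (Cod E g) X. h \<cdot>\<^bsub>E\<^esub> g))\<rparr>"

definition yoneda_arr :: "('o, 'u, 'x) addcat_scheme \<Rightarrow> 'u \<Rightarrow> ('o, 'u) module_arrow" where
  "yoneda_arr E f =
     Arrow (yoneda_obj E (Dom E f)) (yoneda_obj E (Cod E f))
       (\<lambda>Z\<in>Obj E. Arrow (hom_group E Z (Dom E f)) (hom_group E Z (Cod E f))
                     (\<lambda>h\<in>Hom E Z (Dom E f). f \<cdot>\<^bsub>E\<^esub> h))"

definition yoneda ::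
  "('o, 'u, 'x) addcat_scheme \<Rightarrow> ('o, 'u, ('o, 'u) module, ('o, 'u) module_arrow) cfunctor" where
  "yoneda E = \<lparr>fobj = restrict (yoneda_obj E) (Obj E), fmap = restrict (yoneda_arr E) (Arr E)\<rparr>"

definition adm_presented :: "('o, 'u, 'x) excat_scheme \<Rightarrow> ('o, 'u) module \<Rightarrow> bool" where
  "adm_presented E F \<longleftrightarrow>
     F \<in> Obj (Mod_cat E) \<and>
     (\<exists>f \<pi>. admissible E f \<and> tgt \<pi> = F \<and> right_exact_seq E (yoneda_arr E f) \<pi>)"

text \<open>The full subcategory of \<open>Mod(E)\<close> on the admissibly presented modules; its conflations are
  the short exact sequences of \<open>Mod(E)\<close> with all three terms in the subcategory.\<close>

definition mod_adm ::
  "('o, 'u, 'x) excat_scheme \<Rightarrow> (('o, 'u) module, ('o, 'u) module_arrow) excat" where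
  "mod_adm E =
     \<lparr>Obj = {F. adm_presented E F},
      Arr = {\<alpha> \<in> Arr (Mod_cat E). adm_presented E (src \<alpha>) \<and> adm_presented E (tgt \<alpha>)},
      Dom = Dom (Mod_cat E), Cod = Cod (Mod_cat E), Id = Id (Mod_cat E), Comp = Comp (Mod_cat E),
      plus_arr = plus_arr (Mod_cat E), zero_arr = zero_arr (Mod_cat E),
      Confl = {(\<alpha>, \<beta>). short_exact_seq E \<alpha> \<beta> \<and> adm_presented E (src \<alpha>) \<and>
                 adm_presented E (tgt \<alpha>) \<and> adm_presented E (tgt \<beta>)}\<rparr>"

end

theory Submission
  imports Defs
begin

text \<open>
  The image of \<open>\<Upsilon>(f)\<close>, for \<open>f = m \<cdot> p\<close> admissible with \<open>k\<close> a kernel of the deflation \<open>p\<close>, is the cokernel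
  of \<open>\<Upsilon>(k)\<close>, hence admissibly presented; so \<open>\<Upsilon>(f)\<close> is resolved by two conflations. This gives left
  exactness of \<open>\<Upsilon>\<close>, and it forces an exact extension of \<open>\<Phi>\<close> to send \<open>Coker \<Upsilon>(f)\<close> to \<open>Coker \<Phi>(f)\<close>,
  which yields uniqueness because arrows of modules lift to generators. Conversely, left exactness makes
  \<open>\<Phi>(f)\<close> admissible, so that this cokernel exists and is functorial. For the exactness of the
  extension, a short exact sequence is presented by the horseshoe construction, and the value at its
  middle term is obtained as a single pushout of an inflation in \<open>\<C>\<close>; no diagram lemmas are needed.
\<close>

section \<open>Arithmetic of arrows\<close>

text \<open>The obstacle is independence of choices. The middle term of a conflation of modules has
  some admissible presentation, but the one that the horseshoe builds on
  \<open>Y1 \<oplus> Y2\<close> is not shown to come from an admissible arrow. Therefore a value is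
  pinned down by a generator together with the annihilator of that generator
  (\<open>presents\<close>), rather than by an arrow \<open>f\<close>. Any two such descriptions of
  one module give isomorphic values, compatibly with all induced arrows, and conflations are closed
  under isomorphism; so exactness may be checked on whichever descriptions are convenient. Only the
  quotient term enters the horseshoe through an admissible arrow. Left exactness supplies what
  additivity cannot: the deflation part of \<Phi>(f) has a kernel of the form \<Phi>(k) with
  \<open>k\<close> an arrow of \<open>E\<close>, so that a factorization through this deflation
  reduces to a relation between elements of modules.\<close>

lemma (in is_category) HomD:
  assumes "f \<in> Hom C X Y"
  shows "f \<in> Arr C" "Dom C f = X" "Cod C f = Y" "X \<in> Obj C" "Y \<in> Obj C"
  using assms dom_closed cod_closed by (auto simp: Hom_def)

lemma Arr_Hom: "f \<in> Arr C \<Longrightarrow> f \<in> Hom C (Dom C f) (Cod C f)"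
  by (simp add: Hom_def)

context preadditive_category
begin

lemma zero_closed: "\<lbrakk>X \<in> Obj C; Y \<in> Obj C\<rbrakk> \<Longrightarrow> zero_arr C X Y \<in> Hom C X Y"
  using comm_group.axioms(2)[OF hom_comm_group, THEN group.is_monoid, THEN monoid.one_closed]
  by (simp add: hom_group_def)

lemma plus_closed: "\<lbrakk>f \<in> Hom C X Y; g \<in> Hom C X Y\<rbrakk> \<Longrightarrow> plus_arr C f g \<in> Hom C X Y"
  using comm_group.axioms(2)[OF hom_comm_group, of X Y, THEN group.is_monoid, THEN monoid.m_closed, of f g] HomD
  by (simp add: hom_group_def)

lemma plus_comm:
  assumes "f \<in> Hom C X Y" "g \<in> Hom C X Y"
  shows "plus_arr C f g = plus_arr C g f"
proof -
  interpret G: comm_group "hom_group C X Y"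
    by (rule hom_comm_group[OF HomD(4,5)[OF assms(1)]])
  show ?thesis using G.m_comm[of f g] assms by (simp add: hom_group_def)
qed

lemma plus_zero_left:
  assumes "f \<in> Hom C X Y" shows "plus_arr C (zero_arr C X Y) f = f"
proof -
  interpret G: comm_group "hom_group C X Y"
    by (rule hom_comm_group[OF HomD(4,5)[OF assms]])
  show ?thesis using G.l_one[of f] assms by (simp add: hom_group_def)
qed

lemma plus_zero_right:
  assumes "f \<in> Hom C X Y" shows "plus_arr C f (zero_arr C X Y) = f"
  using plus_zero_left[OF assms] plus_comm[OF assms zero_closed] HomD(4,5)[OF assms] by simp

lemma neg_exists:
  assumes "f \<in> Hom C X Y"
  obtains n where "n \<in> Hom C X Y" "plus_arr C f n = zero_arr C X Y"
proof -
  interpret G: comm_group "hom_group C X Y"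
    by (rule hom_comm_group[OF HomD(4,5)[OF assms]])
  show ?thesis using G.r_inv[of f] G.inv_closed[of f] assms that by (simp add: hom_group_def)
qed

lemma plus_right_cancel:
  assumes "f \<in> Hom C X Y" "g \<in> Hom C X Y" "h \<in> Hom C X Y" "plus_arr C f h = plus_arr C g h"
  shows "f = g"
proof -
  interpret G: comm_group "hom_group C X Y"
    by (rule hom_comm_group[OF HomD(4,5)[OF assms(1)]])
  show ?thesis using G.right_cancel[of h f g] assms by (simp add: hom_group_def)
qed

text \<open>Neither the axioms of a preadditive category nor those of an additive functor mention
  the preservation of zero arrows. Both composition and functors preserve the equation
  \<open>z + z = z\<close>, whose only solution in a group is zero; this is how zeros are
  transported below.\<close>

lemma idempotent_plus_zero:
  assumes "f \<in> Hom C X Y" "plus_arr C f f = f"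
  shows "f = zero_arr C X Y"
  using plus_right_cancel[OF assms(1) zero_closed assms(1)] assms(2) plus_zero_left[OF assms(1)]
    HomD(4,5)[OF assms(1)] by simp

lemma comp_zero_right:
  assumes "g \<in> Hom C Y Z" "X \<in> Obj C"
  shows "g \<cdot> zero_arr C X Y = zero_arr C X Z"
proof (rule idempotent_plus_zero)
  have z: "zero_arr C X Y \<in> Hom C X Y" by (rule zero_closed[OF assms(2) HomD(4)[OF assms(1)]])
  then show "g \<cdot> zero_arr C X Y \<in> Hom C X Z" using assms comp_closed by blast
  show "plus_arr C (g \<cdot> zero_arr C X Y) (g \<cdot> zero_arr C X Y) = g \<cdot> zero_arr C X Y"
    using comp_plus_right[OF z z assms(1)] plus_zero_left[OF z] by simp
qed

lemma comp_zero_left: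
  assumes "f \<in> Hom C X Y" "Z \<in> Obj C"
  shows "zero_arr C Y Z \<cdot> f = zero_arr C X Z"
proof (rule idempotent_plus_zero)
  have z: "zero_arr C Y Z \<in> Hom C Y Z" by (rule zero_closed[OF HomD(5)[OF assms(1)] assms(2)])
  then show "zero_arr C Y Z \<cdot> f \<in> Hom C X Z" using assms comp_closed by blast
  show "plus_arr C (zero_arr C Y Z \<cdot> f) (zero_arr C Y Z \<cdot> f) = zero_arr C Y Z \<cdot> f"
    using comp_plus_left[OF assms(1) z z] plus_zero_left[OF z] by simp
qed

lemma additive_functor_zero:
  assumes "additive_functor A C F" "z \<in> Hom A X Y" "plus_arr A z z = z"
  shows "fmap F z = zero_arr C (fobj F X) (fobj F Y)"
  using idempotent_plus_zero[OF additive_functor.fmap_closed[OF assms(1,2)]]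
    additive_functor.fmap_plus[OF assms(1,2,2)] assms(3) by simp

end

section \<open>Modules\<close>

abbreviation is_module :: "('o, 'u, 'x) addcat_scheme \<Rightarrow> ('o, 'u) module \<Rightarrow> bool" where
  "is_module E M \<equiv> additive_functor (op_cat E) Ab M"

abbreviation el :: "('o, 'u) module \<Rightarrow> 'o \<Rightarrow> 'u set" where
  "el M Z \<equiv> carrier (fobj M Z)"

text \<open>By contravariance, \<open>u \<in> Hom E Z W\<close> maps \<open>el M W\<close> to
  \<open>el M Z\<close>: a right action of the arrows of \<open>E\<close>. Modules are handled
  through this action on elements.\<close>

definition act :: "('o, 'u) module \<Rightarrow> 'u \<Rightarrow> 'u \<Rightarrow> 'u" where
  "act M u x = dat (fmap M u) x"

lemma op_cat_simps [simp]:
  "Obj (op_cat E) = Obj E" "Arr (op_cat E) = Arr E" "Dom (op_cat E) = Cod E" "Cod (op_cat E) = Dom E"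
  "Id (op_cat E) = Id E" "Comp (op_cat E) g f = Comp E f g" "plus_arr (op_cat E) = plus_arr E"
  "Hom (op_cat E) X Y = Hom E Y X"
  by (auto simp: op_cat_def Hom_def)

lemma Ab_simps [simp]:
  "Obj Ab = {G. comm_group G}" "Dom Ab = src" "Cod Ab = tgt"
  "Id Ab G = Arrow G G (\<lambda>x\<in>carrier G. x)"
  "Comp Ab b a = Arrow (src a) (tgt b) (compose (carrier (src a)) (dat b) (dat a))"
  "plus_arr Ab a b = Arrow (src a) (tgt a) (\<lambda>x\<in>carrier (src a). dat a x \<otimes>\<^bsub>tgt a\<^esub> dat b x)"
  "zero_arr Ab G H = Arrow G H (\<lambda>x\<in>carrier G. \<one>\<^bsub>H\<^esub>)"
  by (simp_all add: Ab_def)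

lemma Hom_Ab:
  "a \<in> Hom Ab G H \<longleftrightarrow> src a = G \<and> tgt a = H \<and> comm_group G \<and> comm_group H \<and> dat a \<in> hom G H \<and>
     dat a \<in> extensional (carrier G)"
  by (cases a) (auto simp: Hom_def Ab_def)

lemma Mod_cat_simps [simp]:
  "Obj (Mod_cat E) = {F. is_module E F}" "Dom (Mod_cat E) = src" "Cod (Mod_cat E) = tgt"
  "Id (Mod_cat E) F = Arrow F F (\<lambda>X\<in>Obj E. Id Ab (fobj F X))"
  "Comp (Mod_cat E) b a = Arrow (src a) (tgt b) (\<lambda>X\<in>Obj E. Comp Ab (dat b X) (dat a X))"
  "plus_arr (Mod_cat E) a b = Arrow (src a) (tgt a) (\<lambda>X\<in>Obj E. plus_arr Ab (dat a X) (dat b X))"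
  "zero_arr (Mod_cat E) F G = Arrow F G (\<lambda>X\<in>Obj E. zero_arr Ab (fobj F X) (fobj G X))"
  by (simp_all add: Mod_cat_def additive_functor_cat_def)

lemma Arr_Mod_cat:
  "\<alpha> \<in> Arr (Mod_cat E) \<longleftrightarrow> is_module E (src \<alpha>) \<and> is_module E (tgt \<alpha>) \<and>
     nat_trans (op_cat E) Ab (src \<alpha>) (tgt \<alpha>) (dat \<alpha>)"
  by (cases \<alpha>) (auto simp: Mod_cat_def additive_functor_cat_def)

lemma module_group: "\<lbrakk>is_module E M; Z \<in> Obj E\<rbrakk> \<Longrightarrow> comm_group (fobj M Z)"
  using additive_functor.fobj_closed[of "op_cat E" Ab M Z] by simp

lemma module_group': "\<lbrakk>is_module E M; Z \<in> Obj E\<rbrakk> \<Longrightarrow> group (fobj M Z)"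
  by (rule comm_group.axioms(2)[OF module_group])

lemma fmap_Hom_Ab:
  "\<lbrakk>is_module E M; u \<in> Hom E Z W\<rbrakk> \<Longrightarrow> fmap M u \<in> Hom Ab (fobj M W) (fobj M Z)"
  using additive_functor.fmap_closed[of "op_cat E" Ab M u W Z] by simp

lemma act_hom: "\<lbrakk>is_module E M; u \<in> Hom E Z W\<rbrakk> \<Longrightarrow> act M u \<in> hom (fobj M W) (fobj M Z)"
  using fmap_Hom_Ab[of E M u Z W] by (auto simp: Hom_Ab act_def[abs_def])

lemma act_closed: "\<lbrakk>is_module E M; u \<in> Hom E Z W; x \<in> el M W\<rbrakk> \<Longrightarrow> act M u x \<in> el M Z"
  by (rule hom_in_carrier[OF act_hom])

lemma act_mult:
  "\<lbrakk>is_module E M; u \<in> Hom E Z W; x \<in> el M W; y \<in> el M W\<rbrakk>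
    \<Longrightarrow> act M u (x \<otimes>\<^bsub>fobj M W\<^esub> y) = act M u x \<otimes>\<^bsub>fobj M Z\<^esub> act M u y"
  by (rule hom_mult[OF act_hom])

lemma act_id: "\<lbrakk>is_module E M; Z \<in> Obj E; x \<in> el M Z\<rbrakk> \<Longrightarrow> act M (Id E Z) x = x"
  using additive_functor.fmap_id[of "op_cat E" Ab M Z] by (simp add: act_def)

lemma act_comp:
  assumes "is_module E M" "f \<in> Hom E X Y" "g \<in> Hom E Y Z" "x \<in> el M Z"
  shows "act M (g \<cdot>\<^bsub>E\<^esub> f) x = act M f (act M g x)"
proof -
  have "fmap M (g \<cdot>\<^bsub>E\<^esub> f) = Comp Ab (fmap M f) (fmap M g)"
    using additive_functor.fmap_comp[of "op_cat E" Ab M g Z Y f X] assms by simp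
  then show ?thesis
    using fmap_Hom_Ab[OF assms(1,3)] assms(4) by (simp add: act_def Hom_Ab compose_def)
qed

lemma act_plus:
  assumes "is_module E M" "f \<in> Hom E X Y" "g \<in> Hom E X Y" "x \<in> el M Y"
  shows "act M (plus_arr E f g) x = act M f x \<otimes>\<^bsub>fobj M X\<^esub> act M g x"
proof -
  have "fmap M (plus_arr E f g) = plus_arr Ab (fmap M f) (fmap M g)"
    using additive_functor.fmap_plus[of "op_cat E" Ab M f Y X g] assms by simp
  then show ?thesis
    using fmap_Hom_Ab[OF assms(1,2)] assms(4) by (simp add: act_def Hom_Ab)
qed

lemma act_one:
  assumes "is_module E M" "is_category E" "u \<in> Hom E Z W"
  shows "act M u \<one>\<^bsub>fobj M W\<^esub> = \<one>\<^bsub>fobj M Z\<^esub>"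
  using act_hom[OF assms(1,3)] module_group'[OF assms(1)] is_category.HomD[OF assms(2,3)]
  by (meson hom_one)

lemma (in preadditive_category) act_zero:
  assumes "is_module C M" "X \<in> Obj C" "Y \<in> Obj C" "x \<in> el M Y"
  shows "act M (zero_arr C X Y) x = \<one>\<^bsub>fobj M X\<^esub>"
proof -
  have z: "zero_arr C X Y \<in> Hom C X Y" using assms zero_closed by blast
  interpret G: comm_group "fobj M X" by (rule module_group[OF assms(1,2)])
  show ?thesis
    using act_plus[OF assms(1) z z assms(4)] plus_zero_left[OF z] act_closed[OF assms(1) z assms(4)]
    by simp
qed

subsection \<open>Arrows of modules\<close>

lemma component_hom:
  "\<lbrakk>\<alpha> \<in> Arr (Mod_cat E); Z \<in> Obj E\<rbrakk> \<Longrightarrow> component \<alpha> Z \<in> hom (fobj (src \<alpha>) Z) (fobj (tgt \<alpha>) Z)"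
  by (auto simp: Arr_Mod_cat nat_trans_def Hom_Ab)

lemma component_closed:
  "\<lbrakk>\<alpha> \<in> Arr (Mod_cat E); Z \<in> Obj E; x \<in> el (src \<alpha>) Z\<rbrakk> \<Longrightarrow> component \<alpha> Z x \<in> el (tgt \<alpha>) Z"
  by (rule hom_in_carrier[OF component_hom])

lemma component_mult:
  "\<lbrakk>\<alpha> \<in> Arr (Mod_cat E); Z \<in> Obj E; x \<in> el (src \<alpha>) Z; y \<in> el (src \<alpha>) Z\<rbrakk>
    \<Longrightarrow> component \<alpha> Z (x \<otimes>\<^bsub>fobj (src \<alpha>) Z\<^esub> y) = component \<alpha> Z x \<otimes>\<^bsub>fobj (tgt \<alpha>) Z\<^esub> component \<alpha> Z y"
  by (rule hom_mult[OF component_hom])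

lemma component_one:
  assumes "\<alpha> \<in> Arr (Mod_cat E)" "Z \<in> Obj E"
  shows "component \<alpha> Z \<one>\<^bsub>fobj (src \<alpha>) Z\<^esub> = \<one>\<^bsub>fobj (tgt \<alpha>) Z\<^esub>"
proof -
  have "is_module E (src \<alpha>)" "is_module E (tgt \<alpha>)" using assms by (auto simp: Arr_Mod_cat)
  then show ?thesis
    using component_hom[OF assms] module_group' assms(2) by (meson hom_one)
qed

lemma component_act:
  assumes "\<alpha> \<in> Arr (Mod_cat E)" "is_category E" "u \<in> Hom E Z W" "x \<in> el (src \<alpha>) W"
  shows "component \<alpha> Z (act (src \<alpha>) u x) = act (tgt \<alpha>) u (component \<alpha> W x)"
proof -
  have m: "is_module E (src \<alpha>)" "is_module E (tgt \<alpha>)" and n: "nat_trans (op_cat E) Ab (src \<alpha>) (tgt \<alpha>) (dat \<alpha>)"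
    using assms(1) by (auto simp: Arr_Mod_cat)
  note u = is_category.HomD[OF assms(2,3)]
  have "Comp Ab (dat \<alpha> Z) (fmap (src \<alpha>) u) = Comp Ab (fmap (tgt \<alpha>) u) (dat \<alpha> W)"
    using n u by (auto simp: nat_trans_def)
  moreover have "src (fmap (src \<alpha>) u) = fobj (src \<alpha>) W" "src (dat \<alpha> W) = fobj (src \<alpha>) W"
    using fmap_Hom_Ab[OF m(1) assms(3)] n u by (auto simp: Hom_Ab nat_trans_def)
  ultimately show ?thesis
    using assms(4) by (auto simp: act_def compose_def fun_eq_iff) metis
qed

lemma module_arrow_eqI:
  assumes "\<alpha> \<in> Arr (Mod_cat E)" "\<beta> \<in> Arr (Mod_cat E)" "src \<alpha> = src \<beta>" "tgt \<alpha> = tgt \<beta>"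
    and "\<And>Z x. \<lbrakk>Z \<in> Obj E; x \<in> el (src \<alpha>) Z\<rbrakk> \<Longrightarrow> component \<alpha> Z x = component \<beta> Z x"
  shows "\<alpha> = \<beta>"
proof -
  have "dat \<alpha> = dat \<beta>"
  proof (rule extensionalityI)
    show "dat \<alpha> \<in> extensional (Obj E)" "dat \<beta> \<in> extensional (Obj E)"
      using assms(1,2) by (auto simp: Arr_Mod_cat nat_trans_def)
    fix Z assume Z: "Z \<in> Obj E"
    have *: "dat \<alpha> Z \<in> Hom Ab (fobj (src \<alpha>) Z) (fobj (tgt \<alpha>) Z)"
      "dat \<beta> Z \<in> Hom Ab (fobj (src \<alpha>) Z) (fobj (tgt \<alpha>) Z)"
      using assms(1-4) Z by (auto simp: Arr_Mod_cat nat_trans_def)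
    moreover have "component \<alpha> Z = component \<beta> Z"
      by (rule extensionalityI[of _ "el (src \<alpha>) Z"]) (use * assms(5) Z in \<open>auto simp: Hom_Ab\<close>)
    ultimately show "dat \<alpha> Z = dat \<beta> Z" by (auto simp: Hom_Ab intro: arrow.expand)
  qed
  then show ?thesis using assms by (auto intro: arrow.expand)
qed

text \<open>Both restrictions enforce the convention that functions are undefined off their domain,
  so that a natural family of homomorphisms determines one arrow and equality of arrows can be
  tested on elements.\<close>

definition mk_arrow ::
  "('o, 'u, 'x) addcat_scheme \<Rightarrow> ('o, 'u) module \<Rightarrow> ('o, 'u) module \<Rightarrow> ('o \<Rightarrow> 'u \<Rightarrow> 'u) \<Rightarrow> ('o, 'u) module_arrow"
  where "mk_arrow E M N t =
    Arrow M N (\<lambda>Z\<in>Obj E. Arrow (fobj M Z) (fobj N Z) (\<lambda>x\<in>el M Z. t Z x))"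

lemma mk_arrow_simps [simp]:
  "src (mk_arrow E M N t) = M" "tgt (mk_arrow E M N t) = N"
  "\<lbrakk>Z \<in> Obj E; x \<in> el M Z\<rbrakk> \<Longrightarrow> component (mk_arrow E M N t) Z x = t Z x"
  by (auto simp: mk_arrow_def)

lemma mk_arrow_closed:
  assumes "is_category E" "is_module E M" "is_module E N"
    and t: "\<And>Z. Z \<in> Obj E \<Longrightarrow> t Z \<in> hom (fobj M Z) (fobj N Z)"
    and nat: "\<And>Z W u x. \<lbrakk>u \<in> Hom E Z W; x \<in> el M W\<rbrakk> \<Longrightarrow> t Z (act M u x) = act N u (t W x)"
  shows "mk_arrow E M N t \<in> Arr (Mod_cat E)"
proof -
  have "compose (el M (Cod E u)) (\<lambda>x\<in>el M (Dom E u). t (Dom E u) x) (dat (fmap M u))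
      = compose (el M (Cod E u)) (dat (fmap N u)) (\<lambda>x\<in>el M (Cod E u). t (Cod E u) x)"
    if u: "u \<in> Arr E" for u
    using nat[OF Arr_Hom[OF u]] act_closed[OF assms(2) Arr_Hom[OF u]]
    by (auto simp: compose_def act_def)
  moreover have "src (fmap M u) = fobj M (Cod E u)" "tgt (fmap N u) = fobj N (Dom E u)" if "u \<in> Arr E" for u
    using fmap_Hom_Ab[OF assms(2) Arr_Hom[OF that]] fmap_Hom_Ab[OF assms(3) Arr_Hom[OF that]]
    by (auto simp: Hom_Ab)
  moreover have "(\<lambda>x\<in>el M Z. t Z x) \<in> hom (fobj M Z) (fobj N Z)" if Z: "Z \<in> Obj E" for Z
    using t[OF Z] module_group'[OF assms(2) Z, THEN group.is_monoid, THEN monoid.m_closed]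
    by (auto simp: hom_def)
  ultimately show ?thesis
    using assms(1-3) module_group[OF assms(2)] module_group[OF assms(3)]
      is_category.dom_closed[OF assms(1)] is_category.cod_closed[OF assms(1)]
    by (simp add: mk_arrow_def Arr_Mod_cat nat_trans_def Hom_Ab)
qed

text \<open>The composite is recognised as an \<open>mk_arrow\<close>; closure and the formula on
  elements both follow from that. Identities, zeros and sums are treated in the same way.\<close>

lemma Comp_Mod_cat_closed:
  assumes "is_category E" "\<alpha> \<in> Arr (Mod_cat E)" "\<beta> \<in> Arr (Mod_cat E)" "tgt \<alpha> = src \<beta>"
  shows "Comp (Mod_cat E) \<beta> \<alpha> \<in> Arr (Mod_cat E)"
    and "\<lbrakk>Z \<in> Obj E; x \<in> el (src \<alpha>) Z\<rbrakk>
      \<Longrightarrow> component (Comp (Mod_cat E) \<beta> \<alpha>) Z x = component \<beta> Z (component \<alpha> Z x)"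
proof -
  let ?c = "mk_arrow E (src \<alpha>) (tgt \<beta>) (\<lambda>Z. component \<beta> Z \<circ> component \<alpha> Z)"
  have m: "is_module E (src \<alpha>)" "is_module E (tgt \<beta>)" using assms by (auto simp: Arr_Mod_cat)
  have arr: "?c \<in> Arr (Mod_cat E)"
  proof (rule mk_arrow_closed[OF assms(1) m])
    show "component \<beta> Z \<circ> component \<alpha> Z \<in> hom (fobj (src \<alpha>) Z) (fobj (tgt \<beta>) Z)" if "Z \<in> Obj E" for Z
      using component_hom[OF assms(2) that] component_hom[OF assms(3) that] assms(4)
      by (auto intro: hom_compose)
    show "(component \<beta> Z \<circ> component \<alpha> Z) (act (src \<alpha>) u x) = act (tgt \<beta>) u ((component \<beta> W \<circ> component \<alpha> W) x)"
      if "u \<in> Hom E Z W" "x \<in> el (src \<alpha>) W" for Z W u x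
      using component_act[OF assms(2,1) that] component_act[OF assms(3,1) that(1)]
        component_closed[OF assms(2) _ that(2)] is_category.HomD[OF assms(1) that(1)] assms(4)
      by simp
  qed
  have eq: "?c = Comp (Mod_cat E) \<beta> \<alpha>"
  proof -
    have *: "src (dat \<alpha> Z) = fobj (src \<alpha>) Z" "tgt (dat \<beta> Z) = fobj (tgt \<beta>) Z" if "Z \<in> Obj E" for Z
      using that assms(2,3) by (auto simp: Arr_Mod_cat nat_trans_def Hom_Ab)
    show ?thesis
      by (auto simp: mk_arrow_def * compose_def restrict_def fun_eq_iff)
  qed
  show "Comp (Mod_cat E) \<beta> \<alpha> \<in> Arr (Mod_cat E)" using arr unfolding eq .
  show "\<lbrakk>Z \<in> Obj E; x \<in> el (src \<alpha>) Z\<rbrakk>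
      \<Longrightarrow> component (Comp (Mod_cat E) \<beta> \<alpha>) Z x = component \<beta> Z (component \<alpha> Z x)"
    unfolding eq[symmetric] by simp
qed

lemma Id_Mod_cat_closed:
  assumes "is_category E" "is_module E M"
  shows "Id (Mod_cat E) M \<in> Arr (Mod_cat E)"
    and "\<lbrakk>Z \<in> Obj E; x \<in> el M Z\<rbrakk> \<Longrightarrow> component (Id (Mod_cat E) M) Z x = x"
proof -
  have "Id (Mod_cat E) M = mk_arrow E M M (\<lambda>Z x. x)" by (auto simp: mk_arrow_def)
  moreover have "mk_arrow E M M (\<lambda>Z x. x) \<in> Arr (Mod_cat E)"
    by (rule mk_arrow_closed) (use assms in \<open>auto simp: hom_def\<close>)
  ultimately show "Id (Mod_cat E) M \<in> Arr (Mod_cat E)" by simp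
qed simp

lemma Comp_Id_Mod_cat:
  assumes "is_category E" and \<alpha>: "\<alpha> \<in> Arr (Mod_cat E)"
  shows "Comp (Mod_cat E) \<alpha> (Id (Mod_cat E) (src \<alpha>)) = \<alpha>" "Comp (Mod_cat E) (Id (Mod_cat E) (tgt \<alpha>)) \<alpha> = \<alpha>"
proof -
  have m: "is_module E (src \<alpha>)" "is_module E (tgt \<alpha>)" using \<alpha> by (auto simp: Arr_Mod_cat)
  note s = Id_Mod_cat_closed[OF assms(1) m(1)] and t = Id_Mod_cat_closed[OF assms(1) m(2)]
  have st: "tgt (Id (Mod_cat E) (src \<alpha>)) = src \<alpha>" "src (Id (Mod_cat E) (src \<alpha>)) = src \<alpha>"
    "src (Id (Mod_cat E) (tgt \<alpha>)) = tgt \<alpha>" by simp_all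
  note cs = Comp_Mod_cat_closed[OF assms(1) s(1) \<alpha> st(1)]
    and ct = Comp_Mod_cat_closed[OF assms(1) \<alpha> t(1) st(3)[symmetric]]
  show "Comp (Mod_cat E) \<alpha> (Id (Mod_cat E) (src \<alpha>)) = \<alpha>"
  proof (rule module_arrow_eqI[OF cs(1) \<alpha>])
    fix Z x assume Z: "Z \<in> Obj E" and "x \<in> el (src (Comp (Mod_cat E) \<alpha> (Id (Mod_cat E) (src \<alpha>)))) Z"
    then have x: "x \<in> el (src \<alpha>) Z" by simp
    then show "component (Comp (Mod_cat E) \<alpha> (Id (Mod_cat E) (src \<alpha>))) Z x = component \<alpha> Z x"
      using cs(2)[OF Z, unfolded st] s(2)[OF Z x] by metis
  qed simp_all
  show "Comp (Mod_cat E) (Id (Mod_cat E) (tgt \<alpha>)) \<alpha> = \<alpha>"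
  proof (rule module_arrow_eqI[OF ct(1) \<alpha>])
    fix Z x assume Z: "Z \<in> Obj E" and "x \<in> el (src (Comp (Mod_cat E) (Id (Mod_cat E) (tgt \<alpha>)) \<alpha>)) Z"
    then have x: "x \<in> el (src \<alpha>) Z" by simp
    then show "component (Comp (Mod_cat E) (Id (Mod_cat E) (tgt \<alpha>)) \<alpha>) Z x = component \<alpha> Z x"
      using ct(2)[OF Z x] t(2)[OF Z component_closed[OF \<alpha> Z x]] by metis
  qed simp_all
qed

lemma zero_Mod_cat_closed:
  assumes "is_category E" "is_module E M" "is_module E N"
  shows "zero_arr (Mod_cat E) M N \<in> Arr (Mod_cat E)"
    and "\<lbrakk>Z \<in> Obj E; x \<in> el M Z\<rbrakk> \<Longrightarrow> component (zero_arr (Mod_cat E) M N) Z x = \<one>\<^bsub>fobj N Z\<^esub>"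
proof -
  have "zero_arr (Mod_cat E) M N = mk_arrow E M N (\<lambda>Z x. \<one>\<^bsub>fobj N Z\<^esub>)" by (auto simp: mk_arrow_def)
  moreover have "mk_arrow E M N (\<lambda>Z x. \<one>\<^bsub>fobj N Z\<^esub>) \<in> Arr (Mod_cat E)"
  proof (rule mk_arrow_closed[OF assms])
    fix Z assume Z: "Z \<in> Obj E"
    interpret G: comm_group "fobj N Z" by (rule module_group[OF assms(3) Z])
    show "(\<lambda>x. \<one>\<^bsub>fobj N Z\<^esub>) \<in> hom (fobj M Z) (fobj N Z)" by (auto simp: hom_def)
  qed (simp add: act_one[OF assms(3,1)])
  ultimately show "zero_arr (Mod_cat E) M N \<in> Arr (Mod_cat E)" by simp
qed simp

lemma plus_Mod_cat_closed:
  assumes "is_category E" "\<alpha> \<in> Arr (Mod_cat E)" "\<beta> \<in> Arr (Mod_cat E)" "src \<alpha> = src \<beta>" "tgt \<alpha> = tgt \<beta>"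
  shows "plus_arr (Mod_cat E) \<alpha> \<beta> \<in> Arr (Mod_cat E)"
    and "\<lbrakk>Z \<in> Obj E; x \<in> el (src \<alpha>) Z\<rbrakk> \<Longrightarrow> component (plus_arr (Mod_cat E) \<alpha> \<beta>) Z x
      = component \<alpha> Z x \<otimes>\<^bsub>fobj (tgt \<alpha>) Z\<^esub> component \<beta> Z x"
proof -
  let ?c = "mk_arrow E (src \<alpha>) (tgt \<alpha>) (\<lambda>Z x. component \<alpha> Z x \<otimes>\<^bsub>fobj (tgt \<alpha>) Z\<^esub> component \<beta> Z x)"
  have m: "is_module E (src \<alpha>)" "is_module E (tgt \<alpha>)" using assms by (auto simp: Arr_Mod_cat)
  have arr: "?c \<in> Arr (Mod_cat E)"
  proof (rule mk_arrow_closed[OF assms(1) m])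
    show "(\<lambda>x. component \<alpha> Z x \<otimes>\<^bsub>fobj (tgt \<alpha>) Z\<^esub> component \<beta> Z x) \<in> hom (fobj (src \<alpha>) Z) (fobj (tgt \<alpha>) Z)"
      if "Z \<in> Obj E" for Z
    proof -
      interpret G: comm_group "fobj (tgt \<alpha>) Z" by (rule module_group[OF m(2) that])
      show ?thesis
        using component_hom[OF assms(2) that] component_hom[OF assms(3) that, folded assms(4,5)]
        by (simp add: hom_def Pi_iff G.m_ac)
    qed
    show "component \<alpha> Z (act (src \<alpha>) u x) \<otimes>\<^bsub>fobj (tgt \<alpha>) Z\<^esub> component \<beta> Z (act (src \<alpha>) u x)
        = act (tgt \<alpha>) u (component \<alpha> W x \<otimes>\<^bsub>fobj (tgt \<alpha>) W\<^esub> component \<beta> W x)"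
      if "u \<in> Hom E Z W" "x \<in> el (src \<alpha>) W" for Z W u x
      using component_act[OF assms(2,1) that] component_act[OF assms(3,1) that(1), of x] that(2)
        component_closed[OF assms(2) _ that(2)] component_closed[OF assms(3), of W x]
        is_category.HomD[OF assms(1) that(1)] assms(4,5) act_mult[OF m(2) that(1)]
      by simp
  qed
  have eq: "?c = plus_arr (Mod_cat E) \<alpha> \<beta>"
  proof -
    have *: "src (dat \<alpha> Z) = fobj (src \<alpha>) Z" "tgt (dat \<alpha> Z) = fobj (tgt \<alpha>) Z" if "Z \<in> Obj E" for Z
      using that assms(2,3) by (auto simp: Arr_Mod_cat nat_trans_def Hom_Ab)
    show ?thesis
      by (auto simp: mk_arrow_def * restrict_def fun_eq_iff)
  qed
  show "plus_arr (Mod_cat E) \<alpha> \<beta> \<in> Arr (Mod_cat E)" using arr unfolding eq .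
  show "\<lbrakk>Z \<in> Obj E; x \<in> el (src \<alpha>) Z\<rbrakk> \<Longrightarrow> component (plus_arr (Mod_cat E) \<alpha> \<beta>) Z x
      = component \<alpha> Z x \<otimes>\<^bsub>fobj (tgt \<alpha>) Z\<^esub> component \<beta> Z x"
    unfolding eq[symmetric] by simp
qed

declare Mod_cat_simps(4-7) [simp del]

subsection \<open>Images and cokernels of arrows of modules\<close>

definition mk_module ::
  "('o, 'u, 'x) addcat_scheme \<Rightarrow> ('o \<Rightarrow> 'u monoid) \<Rightarrow> ('u \<Rightarrow> 'u \<Rightarrow> 'u) \<Rightarrow> ('o, 'u) module" where
  "mk_module E G a = \<lparr>fobj = (\<lambda>Z\<in>Obj E. G Z),
     fmap = (\<lambda>u\<in>Arr E. Arrow (G (Cod E u)) (G (Dom E u)) (\<lambda>x\<in>carrier (G (Cod E u)). a u x))\<rparr>"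

lemma fobj_mk_module [simp]: "Z \<in> Obj E \<Longrightarrow> fobj (mk_module E G a) Z = G Z"
  by (simp add: mk_module_def)

lemma act_mk_module [simp]:
  "\<lbrakk>u \<in> Hom E Z W; x \<in> carrier (G W)\<rbrakk> \<Longrightarrow> act (mk_module E G a) u x = a u x"
  by (simp add: mk_module_def act_def Hom_def)

lemma (in preadditive_category) is_module_mk_module:
  assumes grp: "\<And>Z. Z \<in> Obj C \<Longrightarrow> comm_group (G Z)"
    and a_hom: "\<And>u Z W. u \<in> Hom C Z W \<Longrightarrow> a u \<in> hom (G W) (G Z)"
    and a_id: "\<And>Z x. \<lbrakk>Z \<in> Obj C; x \<in> carrier (G Z)\<rbrakk> \<Longrightarrow> a (Id C Z) x = x"
    and a_comp: "\<And>f g X Y Z x. \<lbrakk>f \<in> Hom C X Y; g \<in> Hom C Y Z; x \<in> carrier (G Z)\<rbrakk>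
        \<Longrightarrow> a (g \<cdot> f) x = a f (a g x)"
    and a_plus: "\<And>f g X Y x. \<lbrakk>f \<in> Hom C X Y; g \<in> Hom C X Y; x \<in> carrier (G Y)\<rbrakk>
        \<Longrightarrow> a (plus_arr C f g) x = a f x \<otimes>\<^bsub>G X\<^esub> a g x"
  shows "is_module C (mk_module C G a)"
proof
  let ?M = "mk_module C G a"
  have fm: "fmap ?M u = Arrow (G W) (G Z) (\<lambda>x\<in>carrier (G W). a u x)" if "u \<in> Hom C Z W" for u Z W
    using that by (simp add: mk_module_def Hom_def)
  show "fobj ?M \<in> extensional (Obj (op_cat C))" "fmap ?M \<in> extensional (Arr (op_cat C))"
    by (simp_all add: mk_module_def)
  show "fobj ?M X \<in> Obj Ab" if "X \<in> Obj (op_cat C)" for X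
    using that grp by simp
  show "fmap ?M f \<in> Hom Ab (fobj ?M X) (fobj ?M Y)" if "f \<in> Hom (op_cat C) X Y" for f X Y
  proof -
    have f: "f \<in> Hom C Y X" using that by simp
    interpret comm_group "G X" using grp HomD[OF f] by simp
    have "(\<lambda>x\<in>carrier (G X). a f x) \<in> hom (G X) (G Y)"
      using a_hom[OF f] by (auto simp: hom_def)
    then show ?thesis using f grp HomD[OF f] by (simp add: fm[OF f] Hom_Ab)
  qed
  show "fmap ?M (Id (op_cat C) X) = Id Ab (fobj ?M X)" if "X \<in> Obj (op_cat C)" for X
    using that a_id fm[OF id_closed, of X] by auto
  show "fmap ?M (g \<cdot>\<^bsub>op_cat C\<^esub> f) = fmap ?M g \<cdot>\<^bsub>Ab\<^esub> fmap ?M f"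
    if f': "f \<in> Hom (op_cat C) X Y" and g': "g \<in> Hom (op_cat C) Y Z" for f g X Y Z
  proof -
    have f: "f \<in> Hom C Y X" and g: "g \<in> Hom C Z Y" using f' g' by auto
    show ?thesis
      using a_comp[OF g f] hom_in_carrier[OF a_hom[OF f]]
      by (auto simp: fm[OF f] fm[OF g] fm[OF comp_closed[OF g f]] compose_def)
  qed
  show "fmap ?M (plus_arr (op_cat C) f g) = plus_arr Ab (fmap ?M f) (fmap ?M g)"
    if f': "f \<in> Hom (op_cat C) X Y" and g': "g \<in> Hom (op_cat C) X Y" for f g X Y
  proof -
    have f: "f \<in> Hom C Y X" and g: "g \<in> Hom C Y X" using f' g' by auto
    show ?thesis
      using a_plus[OF f g]
      by (auto simp: fm[OF f] fm[OF g] fm[OF plus_closed[OF f g]])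
  qed
qed

text \<open>The image is the submodule with the operations of the target, so that \<iota> is the
  identity on elements. The equality of neutral elements is recorded because it allows the kernel of
  \<epsilon> to be computed in the target of \<alpha>.\<close>

lemma (in preadditive_category) image_factorization:
  assumes \<alpha>: "\<alpha> \<in> Arr (Mod_cat C)"
  obtains \<epsilon> \<iota> where "\<epsilon> \<in> Arr (Mod_cat C)" "\<iota> \<in> Arr (Mod_cat C)"
    "src \<epsilon> = src \<alpha>" "tgt \<epsilon> = src \<iota>" "tgt \<iota> = tgt \<alpha>"
    "\<And>Z x. \<lbrakk>Z \<in> Obj C; x \<in> el (src \<alpha>) Z\<rbrakk> \<Longrightarrow> component \<epsilon> Z x = component \<alpha> Z x"
    "\<And>Z x. \<lbrakk>Z \<in> Obj C; x \<in> el (src \<iota>) Z\<rbrakk> \<Longrightarrow> component \<iota> Z x = x"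
    "\<And>Z. Z \<in> Obj C \<Longrightarrow> el (src \<iota>) Z = component \<alpha> Z ` el (src \<alpha>) Z"
    "\<And>Z. Z \<in> Obj C \<Longrightarrow> \<one>\<^bsub>fobj (src \<iota>) Z\<^esub> = \<one>\<^bsub>fobj (tgt \<iota>) Z\<^esub>"
proof -
  define G where "G Z = (fobj (tgt \<alpha>) Z)\<lparr>carrier := component \<alpha> Z ` el (src \<alpha>) Z\<rparr>" for Z
  define I where "I = mk_module C G (act (tgt \<alpha>))"
  have m: "is_module C (src \<alpha>)" "is_module C (tgt \<alpha>)" using \<alpha> by (auto simp: Arr_Mod_cat)
  have cat: "is_category C" by unfold_locales
  have elG: "\<exists>y\<in>el (src \<alpha>) Z. x = component \<alpha> Z y" if "x \<in> carrier (G Z)" for x Z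
    using that by (auto simp: G_def)
  have sub: "x \<in> el (tgt \<alpha>) Z" if "Z \<in> Obj C" "x \<in> carrier (G Z)" for x Z
    using that component_closed[OF \<alpha>] elG by blast
  have stable: "act (tgt \<alpha>) u x \<in> carrier (G Z)" if u: "u \<in> Hom C Z W" and x: "x \<in> carrier (G W)" for u Z W x
  proof -
    obtain y where "y \<in> el (src \<alpha>) W" "x = component \<alpha> W y" using elG[OF x] by blast
    then show ?thesis
      using component_act[OF \<alpha> cat u] act_closed[OF m(1) u] by (auto simp: G_def simp flip: component_act[OF \<alpha> cat u])
  qed
  have GI: "fobj I Z = G Z" if "Z \<in> Obj C" for Z using that by (simp add: I_def)
  have actI: "act I u x = act (tgt \<alpha>) u x" if "u \<in> Hom C Z W" "x \<in> carrier (G W)" for u Z W x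
    using that unfolding I_def by simp
  have I: "is_module C I" unfolding I_def
  proof (rule is_module_mk_module)
    show "comm_group (G Z)" if Z: "Z \<in> Obj C" for Z
    proof -
      interpret S: comm_group "fobj (src \<alpha>) Z" by (rule module_group[OF m(1) Z])
      interpret T: comm_group "fobj (tgt \<alpha>) Z" by (rule module_group[OF m(2) Z])
      show ?thesis
        using S.hom_imp_img_comm_group[OF component_hom[OF \<alpha> Z]] component_one[OF \<alpha> Z]
        by (simp add: G_def)
    qed
    show "act (tgt \<alpha>) u \<in> hom (G W) (G Z)" if u: "u \<in> Hom C Z W" for u Z W
      using stable[OF u] act_mult[OF m(2) u] sub HomD[OF u] by (auto simp: hom_def G_def)
  qed (use sub act_id[OF m(2)] act_comp[OF m(2)] act_plus[OF m(2)] HomD plus_closed in \<open>auto simp: G_def\<close>)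
  let ?\<epsilon> = "mk_arrow C (src \<alpha>) I (component \<alpha>)" and ?\<iota> = "mk_arrow C I (tgt \<alpha>) (\<lambda>Z x. x)"
  show ?thesis
  proof (rule that[of ?\<epsilon> ?\<iota>])
    show "?\<epsilon> \<in> Arr (Mod_cat C)"
    proof (rule mk_arrow_closed[OF cat m(1) I])
      show "component \<alpha> Z \<in> hom (fobj (src \<alpha>) Z) (fobj I Z)" if Z: "Z \<in> Obj C" for Z
        using component_hom[OF \<alpha> Z] by (auto simp: GI[OF Z] G_def hom_def)
      show "component \<alpha> Z (act (src \<alpha>) u x) = act I u (component \<alpha> W x)"
        if u: "u \<in> Hom C Z W" and x: "x \<in> el (src \<alpha>) W" for Z W u x
        using component_act[OF \<alpha> cat u x] actI[OF u, of "component \<alpha> W x"] x by (simp add: G_def)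
    qed
    show "?\<iota> \<in> Arr (Mod_cat C)"
    proof (rule mk_arrow_closed[OF cat I m(2)])
      show "(\<lambda>x. x) \<in> hom (fobj I Z) (fobj (tgt \<alpha>) Z)" if Z: "Z \<in> Obj C" for Z
        using sub[OF Z] by (auto simp: GI[OF Z] G_def hom_def)
      show "act I u x = act (tgt \<alpha>) u x" if u: "u \<in> Hom C Z W" and x: "x \<in> el I W" for Z W u x
        using actI[OF u] x GI HomD[OF u] by simp
    qed
  qed (simp_all add: GI, simp_all add: G_def)
qed

text \<open>The chosen element depends only on the coset as a set, so all elements of one coset
  receive the same representative.\<close>

definition coset_rep :: "('a, 'b) monoid_scheme \<Rightarrow> 'a set \<Rightarrow> 'a \<Rightarrow> 'a" where
  "coset_rep G N x = (SOME y. y \<in> N #>\<^bsub>G\<^esub> x)"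

text \<open>The quotient group is carried by a transversal of the cosets, so that its elements lie in the
  same type as those of the group.\<close>

definition rep_quotient :: "('a, 'b) monoid_scheme \<Rightarrow> 'a set \<Rightarrow> 'a monoid" where
  "rep_quotient G N = \<lparr>carrier = coset_rep G N ` carrier G,
     mult = (\<lambda>x y. coset_rep G N (x \<otimes>\<^bsub>G\<^esub> y)), one = coset_rep G N \<one>\<^bsub>G\<^esub>\<rparr>"

context comm_group
begin

context
  fixes N assumes N: "subgroup N G"
begin

lemma coset_rep_mem: "x \<in> carrier G \<Longrightarrow> coset_rep G N x \<in> N #> x"
  unfolding coset_rep_def using rcos_self[OF _ N] by (rule someI)

lemma coset_rep_closed: "x \<in> carrier G \<Longrightarrow> coset_rep G N x \<in> carrier G"
  using coset_rep_mem r_coset_subset_G[OF subgroup.subset[OF N]] by blast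

lemma coset_coset_rep: "x \<in> carrier G \<Longrightarrow> N #> coset_rep G N x = N #> x"
  using repr_independence[OF coset_rep_mem _ N] by simp

lemma coset_rep_eq_iff:
  assumes "x \<in> carrier G" "y \<in> carrier G"
  shows "coset_rep G N x = coset_rep G N y \<longleftrightarrow> x \<otimes> inv y \<in> N"
proof -
  have "coset_rep G N x = coset_rep G N y \<longleftrightarrow> N #> x = N #> y"
    using coset_coset_rep assms by (metis coset_rep_def)
  also have "\<dots> \<longleftrightarrow> x \<in> N #> y"
    using repr_independence[OF _ assms(2) N, of x] rcos_self[OF assms(1) N] by auto
  also have "\<dots> \<longleftrightarrow> x \<otimes> inv y \<in> N"
    by (rule subgroup.rcos_module[OF N is_group assms(2,1)])
  finally show ?thesis .
qed

lemma coset_rep_hom: "coset_rep G N \<in> hom G (rep_quotient G N)"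
proof (rule homI)
  show "coset_rep G N x \<in> carrier (rep_quotient G N)" if "x \<in> carrier G" for x
    using that by (simp add: rep_quotient_def)
  fix x y assume x: "x \<in> carrier G" and y: "y \<in> carrier G"
  interpret N: normal N G using subgroup_imp_normal[OF N] .
  have "N #> (coset_rep G N x \<otimes> coset_rep G N y) = N #> (x \<otimes> y)"
    using N.rcos_sum[of "coset_rep G N x" "coset_rep G N y"] N.rcos_sum[of x y] x y
    by (simp add: coset_rep_closed coset_coset_rep)
  then show "coset_rep G N (x \<otimes> y) = coset_rep G N x \<otimes>\<^bsub>rep_quotient G N\<^esub> coset_rep G N y"
    by (simp add: rep_quotient_def coset_rep_def)
qed

lemma comm_group_rep_quotient: "comm_group (rep_quotient G N)"
  using hom_imp_img_comm_group[OF coset_rep_hom] by (simp add: rep_quotient_def)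

end

end

lemma (in preadditive_category) quotient_module:
  assumes N: "is_module C N"
    and Q: "\<And>Z. Z \<in> Obj C \<Longrightarrow> comm_group (Q Z)"
    and r_hom: "\<And>Z. Z \<in> Obj C \<Longrightarrow> r Z \<in> hom (fobj N Z) (Q Z)"
    and r_surj: "\<And>Z. Z \<in> Obj C \<Longrightarrow> r Z ` el N Z = carrier (Q Z)"
    and r_stable: "\<And>Z W u x x'. \<lbrakk>u \<in> Hom C Z W; x \<in> el N W; x' \<in> el N W; r W x = r W x'\<rbrakk>
        \<Longrightarrow> r Z (act N u x) = r Z (act N u x')"
  obtains \<pi> where "\<pi> \<in> Arr (Mod_cat C)" "src \<pi> = N"
    "\<And>Z. Z \<in> Obj C \<Longrightarrow> fobj (tgt \<pi>) Z = Q Z"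
    "\<And>Z x. \<lbrakk>Z \<in> Obj C; x \<in> el N Z\<rbrakk> \<Longrightarrow> component \<pi> Z x = r Z x"
proof -
  have cat: "is_category C" by unfold_locales
  \<comment> \<open>An arrow acts on a class through an arbitrary preimage; \<open>r_stable\<close>
    makes the result independent of the preimage.\<close>
  define a where "a u q = r (Dom C u) (act N u (inv_into (el N (Cod C u)) (r (Cod C u)) q))" for u q
  define M where "M = mk_module C Q a"
  have a: "a u (r W x) = r Z (act N u x)" if u: "u \<in> Hom C Z W" and x: "x \<in> el N W" for u Z W x
  proof -
    let ?y = "inv_into (el N W) (r W) (r W x)"
    have "?y \<in> el N W" "r W ?y = r W x" using x by (auto intro: inv_into_into f_inv_into_f)
    then show ?thesis using r_stable[OF u _ x] HomD[OF u] by (simp add: a_def)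
  qed
  have ex: "\<exists>x\<in>el N Z. q = r Z x" if "Z \<in> Obj C" "q \<in> carrier (Q Z)" for q Z
    using r_surj[OF that(1)] that(2) by blast
  have r_in: "r Z x \<in> carrier (Q Z)" if "Z \<in> Obj C" "x \<in> el N Z" for x Z
    using r_surj[OF that(1)] that(2) by blast
  have M: "is_module C M" unfolding M_def
  proof (rule is_module_mk_module)
    show "a u \<in> hom (Q W) (Q Z)" if u: "u \<in> Hom C Z W" for u Z W
    proof (rule homI)
      note o = HomD(4,5)[OF u]
      show "a u q \<in> carrier (Q Z)" if q: "q \<in> carrier (Q W)" for q
        using ex[OF o(2) q] a[OF u] act_closed[OF N u] r_in[OF o(1)] by auto
      fix q q' assume "q \<in> carrier (Q W)" "q' \<in> carrier (Q W)"
      then obtain x x' where x: "x \<in> el N W" "q = r W x" and x': "x' \<in> el N W" "q' = r W x'"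
        using ex[OF o(2)] by blast
      interpret W: comm_group "fobj N W" by (rule module_group[OF N o(2)])
      have "q \<otimes>\<^bsub>Q W\<^esub> q' = r W (x \<otimes>\<^bsub>fobj N W\<^esub> x')"
        using hom_mult[OF r_hom[OF o(2)] x(1) x'(1)] x x' by simp
      then show "a u (q \<otimes>\<^bsub>Q W\<^esub> q') = a u q \<otimes>\<^bsub>Q Z\<^esub> a u q'"
        using a[OF u] x x' act_mult[OF N u x(1) x'(1)] hom_mult[OF r_hom[OF o(1)]] act_closed[OF N u]
        by simp
    qed
    show "a (Id C Z) x = x" if Z: "Z \<in> Obj C" and x: "x \<in> carrier (Q Z)" for Z x
      using ex[OF Z x] a[OF id_closed[OF Z]] act_id[OF N Z] by auto
    show "a (g \<cdot> f) x = a f (a g x)"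
      if f: "f \<in> Hom C X Y" and g: "g \<in> Hom C Y Z" and x: "x \<in> carrier (Q Z)" for f g X Y Z x
      using ex[OF HomD(5)[OF g] x] a[OF f] a[OF g] a[OF comp_closed[OF f g]] act_comp[OF N f g]
        act_closed[OF N g] by auto
    show "a (plus_arr C f g) x = a f x \<otimes>\<^bsub>Q X\<^esub> a g x"
      if f: "f \<in> Hom C X Y" and g: "g \<in> Hom C X Y" and x: "x \<in> carrier (Q Y)" for f g X Y x
      using ex[OF HomD(5)[OF g] x] a[OF f] a[OF g] a[OF plus_closed[OF f g]] act_plus[OF N f g]
        act_closed[OF N f] act_closed[OF N g] hom_mult[OF r_hom[OF HomD(4)[OF f]]] by auto
  qed (use Q plus_closed in auto)
  have MQ: "fobj M Z = Q Z" if "Z \<in> Obj C" for Z using that by (simp add: M_def)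
  have actM: "act M u q = a u q" if "u \<in> Hom C Z W" "q \<in> carrier (Q W)" for u q Z W
    using that unfolding M_def by simp
  show ?thesis
  proof (rule that[of "mk_arrow C N M r"])
    show "mk_arrow C N M r \<in> Arr (Mod_cat C)"
    proof (rule mk_arrow_closed[OF cat N M])
      show "r Z \<in> hom (fobj N Z) (fobj M Z)" if "Z \<in> Obj C" for Z using that r_hom MQ by simp
      show "r Z (act N u x) = act M u (r W x)" if u: "u \<in> Hom C Z W" and x: "x \<in> el N W" for Z W u x
        using a[OF u x] actM[OF u r_in[OF HomD(5)[OF u] x]] by simp
    qed
  qed (simp_all add: MQ)
qed

text \<open>The cokernel is the pointwise quotient by the image, which stays inside the universe
  \<open>'u\<close> because its elements are coset representatives. It continues \<Upsilon>(g) to a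
  right exact sequence in the proof that \<Upsilon> is left exact.\<close>

lemma (in preadditive_category) cokernel_exists:
  assumes \<alpha>: "\<alpha> \<in> Arr (Mod_cat C)"
  obtains \<pi> where "right_exact_seq C \<alpha> \<pi>"
proof -
  have cat: "is_category C" by unfold_locales
  let ?M = "src \<alpha>" and ?N = "tgt \<alpha>"
  have M: "is_module C ?M" and N: "is_module C ?N" using \<alpha> by (auto simp: Arr_Mod_cat)
  define K where "K Z = component \<alpha> Z ` el ?M Z" for Z
  define r where "r Z = coset_rep (fobj ?N Z) (K Z)" for Z
  have grp: "comm_group (fobj ?N Z)" if "Z \<in> Obj C" for Z by (rule module_group[OF N that])
  have K: "subgroup (K Z) (fobj ?N Z)" if Z: "Z \<in> Obj C" for Z
    unfolding K_def
    by (intro group_hom.img_is_subgroup group_hom.intro group_hom_axioms.intro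
        module_group'[OF M Z] module_group'[OF N Z] component_hom[OF \<alpha> Z])
  note r_iff = comm_group.coset_rep_eq_iff[OF grp K, folded r_def]
  have Kact: "act ?N u x \<in> K Z" if u: "u \<in> Hom C Z W" and x: "x \<in> K W" for u x Z W
    using x act_closed[OF M u] by (auto simp: K_def simp flip: component_act[OF \<alpha> cat u])
  obtain \<pi> where \<pi>: "\<pi> \<in> Arr (Mod_cat C)" "src \<pi> = ?N"
    and Q: "\<And>Z. Z \<in> Obj C \<Longrightarrow> fobj (tgt \<pi>) Z = rep_quotient (fobj ?N Z) (K Z)"
    and \<pi>r: "\<And>Z x. \<lbrakk>Z \<in> Obj C; x \<in> el ?N Z\<rbrakk> \<Longrightarrow> component \<pi> Z x = r Z x"
  proof (rule quotient_module[OF N])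
    show "comm_group (rep_quotient (fobj ?N Z) (K Z))" if "Z \<in> Obj C" for Z
      by (rule comm_group.comm_group_rep_quotient[OF grp[OF that] K[OF that]])
    show "r Z \<in> hom (fobj ?N Z) (rep_quotient (fobj ?N Z) (K Z))" if "Z \<in> Obj C" for Z
      unfolding r_def by (rule comm_group.coset_rep_hom[OF grp[OF that] K[OF that]])
    show "r Z ` el ?N Z = carrier (rep_quotient (fobj ?N Z) (K Z))" for Z
      by (simp add: rep_quotient_def r_def)
    show "r Z (act ?N u x) = r Z (act ?N u x')"
      if u: "u \<in> Hom C Z W" and x: "x \<in> el ?N W" "x' \<in> el ?N W" and eq: "r W x = r W x'" for Z W u x x'
    proof -
      note o = HomD(4,5)[OF u]
      interpret W: comm_group "fobj ?N W" by (rule grp[OF o(2)])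
      interpret Z: comm_group "fobj ?N Z" by (rule grp[OF o(1)])
      interpret h: group_hom "fobj ?N W" "fobj ?N Z" "act ?N u"
        by unfold_locales (rule act_hom[OF N u])
      have "x \<otimes>\<^bsub>fobj ?N W\<^esub> inv\<^bsub>fobj ?N W\<^esub> x' \<in> K W" using eq r_iff[OF o(2) o(2)] x by simp
      then have "act ?N u (x \<otimes>\<^bsub>fobj ?N W\<^esub> inv\<^bsub>fobj ?N W\<^esub> x') \<in> K Z" by (rule Kact[OF u])
      then show ?thesis using r_iff[OF o(1) o(1)] x h.hom_closed by simp
    qed
  qed blast
  have "K Z = kernel (fobj ?N Z) (fobj (tgt \<pi>) Z) (component \<pi> Z)" if Z: "Z \<in> Obj C" for Z
  proof -
    interpret comm_group "fobj ?N Z" by (rule grp[OF Z])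
    have "component \<pi> Z x = \<one>\<^bsub>fobj (tgt \<pi>) Z\<^esub> \<longleftrightarrow> x \<in> K Z" if x: "x \<in> el ?N Z" for x
      using r_iff[OF Z Z x one_closed] \<pi>r[OF Z x] x by (simp add: Q[OF Z] rep_quotient_def r_def)
    then show ?thesis using subgroup.subset[OF K[OF Z]] by (auto simp: kernel_def)
  qed
  moreover have "component \<pi> Z ` el ?N Z = el (tgt \<pi>) Z" if Z: "Z \<in> Obj C" for Z
    using \<pi>r[OF Z] by (simp add: Q[OF Z] rep_quotient_def r_def)
  ultimately show ?thesis using that[of \<pi>] \<alpha> \<pi> by (simp add: right_exact_seq_def K_def)
qed

section \<open>Exact categories\<close>

context preadditive_category
begin

lemma kernelD:
  assumes "is_kernel C k f"
  shows "k \<in> Hom C (Dom C k) (Dom C f)" "f \<in> Hom C (Dom C f) (Cod C f)"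
    "f \<cdot> k = zero_arr C (Dom C k) (Cod C f)"
    "\<lbrakk>h \<in> Hom C W (Dom C f); f \<cdot> h = zero_arr C W (Cod C f)\<rbrakk>
      \<Longrightarrow> \<exists>!u. u \<in> Hom C W (Dom C k) \<and> k \<cdot> u = h"
proof -
  show "k \<in> Hom C (Dom C k) (Dom C f)" "f \<in> Hom C (Dom C f) (Cod C f)"
    "f \<cdot> k = zero_arr C (Dom C k) (Cod C f)"
    using assms by (simp_all add: is_kernel_def Hom_def)
  assume h: "h \<in> Hom C W (Dom C f)" "f \<cdot> h = zero_arr C W (Cod C f)"
  have "\<forall>h\<in>Arr C. Cod C h = Dom C f \<and> f \<cdot> h = zero_arr C (Dom C h) (Cod C f) \<longrightarrow>
      (\<exists>!u. u \<in> Hom C (Dom C h) (Dom C k) \<and> k \<cdot> u = h)"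
    using assms unfolding is_kernel_def by (elim conjE)
  from bspec[OF this HomD(1)[OF h(1)]] show "\<exists>!u. u \<in> Hom C W (Dom C k) \<and> k \<cdot> u = h"
    using HomD(2,3)[OF h(1)] h(2) by simp
qed

lemma cokernelD:
  assumes "is_cokernel C c f"
  shows "c \<in> Hom C (Cod C f) (Cod C c)" "f \<in> Hom C (Dom C f) (Cod C f)"
    "c \<cdot> f = zero_arr C (Dom C f) (Cod C c)"
    "\<lbrakk>h \<in> Hom C (Cod C f) W; h \<cdot> f = zero_arr C (Dom C f) W\<rbrakk>
      \<Longrightarrow> \<exists>!u. u \<in> Hom C (Cod C c) W \<and> u \<cdot> c = h"
proof -
  show "c \<in> Hom C (Cod C f) (Cod C c)" "f \<in> Hom C (Dom C f) (Cod C f)"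
    "c \<cdot> f = zero_arr C (Dom C f) (Cod C c)"
    using assms by (simp_all add: is_cokernel_def Hom_def)
  assume h: "h \<in> Hom C (Cod C f) W" "h \<cdot> f = zero_arr C (Dom C f) W"
  have "\<forall>h\<in>Arr C. Dom C h = Cod C f \<and> h \<cdot> f = zero_arr C (Dom C f) (Cod C h) \<longrightarrow>
      (\<exists>!u. u \<in> Hom C (Cod C c) (Cod C h) \<and> u \<cdot> c = h)"
    using assms unfolding is_cokernel_def by (elim conjE)
  from bspec[OF this HomD(1)[OF h(1)]] show "\<exists>!u. u \<in> Hom C (Cod C c) W \<and> u \<cdot> c = h"
    using HomD(2,3)[OF h(1)] h(2) by simp
qed

lemma kernel_factor:
  "\<lbrakk>is_kernel C k f; h \<in> Hom C W (Dom C f); f \<cdot> h = zero_arr C W (Cod C f)\<rbrakk>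
    \<Longrightarrow> \<exists>u\<in>Hom C W (Dom C k). k \<cdot> u = h"
  using ex1_implies_ex[OF kernelD(4)] by (simp add: Bex_def)

lemma cokernel_factor:
  "\<lbrakk>is_cokernel C c f; h \<in> Hom C (Cod C f) W; h \<cdot> f = zero_arr C (Dom C f) W\<rbrakk>
    \<Longrightarrow> \<exists>u\<in>Hom C (Cod C c) W. u \<cdot> c = h"
  using ex1_implies_ex[OF cokernelD(4)] by (simp add: Bex_def)

lemma kernel_mono:
  assumes "is_kernel C k f" "u \<in> Hom C W (Dom C k)" "v \<in> Hom C W (Dom C k)" "k \<cdot> u = k \<cdot> v"
  shows "u = v"
proof -
  note k = kernelD[OF assms(1)]
  have "f \<cdot> (k \<cdot> v) = zero_arr C W (Cod C f)"
    using comp_assoc[OF assms(3) k(1,2)] k(3) comp_zero_left[OF assms(3) HomD(5)[OF k(2)]] by simp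
  from k(4)[OF comp_closed[OF assms(3) k(1)] this] show ?thesis using assms(2-4) by auto
qed

lemma cokernel_epi:
  assumes "is_cokernel C c f" "u \<in> Hom C (Cod C c) W" "v \<in> Hom C (Cod C c) W" "u \<cdot> c = v \<cdot> c"
  shows "u = v"
proof -
  note c = cokernelD[OF assms(1)]
  have "(v \<cdot> c) \<cdot> f = zero_arr C (Dom C f) W"
    using comp_assoc[OF c(2,1) assms(3)] c(3) comp_zero_right[OF assms(3) HomD(4)[OF c(2)]] by simp
  from c(4)[OF comp_closed[OF c(1) assms(3)] this] show ?thesis using assms(2-4) by auto
qed

end

context exact_category
begin

lemma conflD:
  assumes "(f, g) \<in> Confl E"
  shows "is_kernel E f g" "is_cokernel E g f" "f \<in> Hom E (Dom E f) (Cod E f)" "g \<in> Hom E (Dom E g) (Cod E g)"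
    "Dom E g = Cod E f"
  using confl_kernel_cokernel[OF assms] by (auto simp: is_kernel_def Hom_def)

lemma inflation_closed: "inflation E m \<Longrightarrow> m \<in> Hom E (Dom E m) (Cod E m)"
  and inflation_mono:
    "\<lbrakk>inflation E m; u \<in> Hom E W (Dom E m); v \<in> Hom E W (Dom E m); m \<cdot> u = m \<cdot> v\<rbrakk> \<Longrightarrow> u = v"
proof -
  assume "inflation E m"
  then obtain g where g: "(m, g) \<in> Confl E" by (auto simp: inflation_def)
  show "m \<in> Hom E (Dom E m) (Cod E m)" by (rule conflD(3)[OF g])
  show "\<lbrakk>u \<in> Hom E W (Dom E m); v \<in> Hom E W (Dom E m); m \<cdot> u = m \<cdot> v\<rbrakk> \<Longrightarrow> u = v"
    by (rule kernel_mono[OF conflD(1)[OF g]])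
qed

lemma deflation_closed: "deflation E p \<Longrightarrow> p \<in> Hom E (Dom E p) (Cod E p)"
  and deflation_epi:
    "\<lbrakk>deflation E p; u \<in> Hom E (Cod E p) W; v \<in> Hom E (Cod E p) W; u \<cdot> p = v \<cdot> p\<rbrakk> \<Longrightarrow> u = v"
proof -
  assume "deflation E p"
  then obtain f where f: "(f, p) \<in> Confl E" by (auto simp: deflation_def)
  show "p \<in> Hom E (Dom E p) (Cod E p)" by (rule conflD(4)[OF f])
  show "\<lbrakk>u \<in> Hom E (Cod E p) W; v \<in> Hom E (Cod E p) W; u \<cdot> p = v \<cdot> p\<rbrakk> \<Longrightarrow> u = v"
    by (rule cokernel_epi[OF conflD(2)[OF f]])
qed

lemma inflation_admissible: "inflation E m \<Longrightarrow> admissible E m"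
  unfolding admissible_def
proof (intro exI conjI)
  assume "inflation E m"
  note m = inflation_closed[OF this]
  show "deflation E (Id E (Dom E m))" by (rule id_deflation[OF HomD(4)[OF m]])
  show "Cod E (Id E (Dom E m)) = Dom E m" by (rule HomD(3)[OF id_closed[OF HomD(4)[OF m]]])
  show "m = m \<cdot> Id E (Dom E m)" using comp_id_right[OF m] by simp
qed

text \<open>The inflation \<open>k\<close> is the kernel of the identity of \<open>Y\<close>. Then
  \<open>k = Id \<cdot> k = 0\<close>, and since \<open>k\<close> is also monic, every arrow into
  its domain vanishes. This is the zero object in the form in which it presents
  \<Upsilon>(Y).\<close>

lemma initial_inflation:
  assumes "Y \<in> Obj E"
  obtains k where "inflation E k" "Cod E k = Y" "\<And>Z u. u \<in> Hom E Z (Dom E k) \<Longrightarrow> u = zero_arr E Z (Dom E k)"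
proof -
  obtain k where k: "(k, Id E Y) \<in> Confl E" using id_deflation[OF assms] by (auto simp: deflation_def)
  note d = conflD[OF k] and i = HomD[OF id_closed[OF assms]]
  have kY: "k \<in> Hom E (Dom E k) Y" using d(3,5) i by simp
  have "k = zero_arr E (Dom E k) Y"
    using kernelD(3)[OF d(1)] comp_id_left[OF kY] i by simp
  show ?thesis
  proof (rule that[of k])
    show "inflation E k" using k by (auto simp: inflation_def)
    show "Cod E k = Y" using HomD[OF kY] by simp
    fix Z u assume u: "u \<in> Hom E Z (Dom E k)"
    show "u = zero_arr E Z (Dom E k)"
    proof (rule kernel_mono[OF d(1) u zero_closed])
      have "k \<cdot> u = zero_arr E Z Y"
        using \<open>k = _\<close> comp_zero_left[OF u assms] by simp
      then show "k \<cdot> u = k \<cdot> zero_arr E Z (Dom E k)"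
        using comp_zero_right[OF kY HomD(4)[OF u]] by simp
    qed (use HomD[OF u] in auto)
  qed
qed

end

section \<open>Admissibly presented modules and the Yoneda embedding\<close>

lemma mod_adm_simps [simp]:
  "Obj (mod_adm E) = {F. adm_presented E F}" "Dom (mod_adm E) = src" "Cod (mod_adm E) = tgt"
  "Id (mod_adm E) = Id (Mod_cat E)" "Comp (mod_adm E) = Comp (Mod_cat E)"
  "plus_arr (mod_adm E) = plus_arr (Mod_cat E)" "zero_arr (mod_adm E) = zero_arr (Mod_cat E)"
  by (simp_all add: mod_adm_def Mod_cat_def additive_functor_cat_def)

lemma Arr_mod_adm:
  "\<alpha> \<in> Arr (mod_adm E) \<longleftrightarrow> \<alpha> \<in> Arr (Mod_cat E) \<and> adm_presented E (src \<alpha>) \<and> adm_presented E (tgt \<alpha>)"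
  by (simp add: mod_adm_def)

lemma Hom_mod_adm:
  "\<alpha> \<in> Hom (mod_adm E) F G \<longleftrightarrow> \<alpha> \<in> Arr (Mod_cat E) \<and> src \<alpha> = F \<and> tgt \<alpha> = G \<and>
     adm_presented E F \<and> adm_presented E G"
  by (auto simp: Hom_def Arr_mod_adm)

lemma Confl_mod_adm:
  "(\<alpha>, \<beta>) \<in> Confl (mod_adm E) \<longleftrightarrow> short_exact_seq E \<alpha> \<beta> \<and> adm_presented E (src \<alpha>) \<and>
     adm_presented E (tgt \<alpha>) \<and> adm_presented E (tgt \<beta>)"
  by (simp add: mod_adm_def)

lemma adm_presented_module: "adm_presented E F \<Longrightarrow> is_module E F"
  by (simp add: adm_presented_def)

lemma hom_group_simps [simp]:
  "carrier (hom_group C X Y) = Hom C X Y" "mult (hom_group C X Y) = plus_arr C"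
  "one (hom_group C X Y) = zero_arr C X Y"
  by (simp_all add: hom_group_def)

lemma yoneda_obj_mk_module: "yoneda_obj E X = mk_module E (\<lambda>Z. hom_group E Z X) (\<lambda>g h. h \<cdot>\<^bsub>E\<^esub> g)"
  by (simp add: yoneda_obj_def mk_module_def)

lemma fobj_yoneda_obj [simp]: "Z \<in> Obj E \<Longrightarrow> fobj (yoneda_obj E X) Z = hom_group E Z X"
  by (simp add: yoneda_obj_mk_module)

lemma yoneda_arr_mk_arrow:
  "yoneda_arr E f = mk_arrow E (yoneda_obj E (Dom E f)) (yoneda_obj E (Cod E f)) (\<lambda>Z h. f \<cdot>\<^bsub>E\<^esub> h)"
  by (auto simp: yoneda_arr_def mk_arrow_def)

lemma yoneda_arr_simps [simp]:
  "src (yoneda_arr E f) = yoneda_obj E (Dom E f)" "tgt (yoneda_arr E f) = yoneda_obj E (Cod E f)"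
  by (simp_all add: yoneda_arr_mk_arrow)

section \<open>Representable modules and the Yoneda lemma\<close>

context preadditive_category
begin

lemma el_yoneda_obj: "u \<in> Hom C Z X \<Longrightarrow> u \<in> el (yoneda_obj C X) Z"
  using HomD by simp

lemma component_yoneda_arr:
  "h \<in> Hom C Z (Dom C f) \<Longrightarrow> component (yoneda_arr C f) Z h = f \<cdot> h"
  using HomD by (simp add: yoneda_arr_mk_arrow)

lemma act_yoneda_obj:
  "\<lbrakk>u \<in> Hom C Z W; h \<in> Hom C W X\<rbrakk> \<Longrightarrow> act (yoneda_obj C X) u h = h \<cdot> u"
  by (simp add: yoneda_obj_mk_module)

lemma is_module_yoneda_obj:
  assumes X: "X \<in> Obj C"
  shows "is_module C (yoneda_obj C X)"
  unfolding yoneda_obj_mk_module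
proof (rule is_module_mk_module)
  show "(\<lambda>h. h \<cdot> u) \<in> hom (hom_group C W X) (hom_group C Z X)" if "u \<in> Hom C Z W" for u Z W
    using comp_closed[OF that] comp_plus_left[OF that] by (auto simp: hom_def)
qed (use hom_comm_group X comp_id_right comp_assoc comp_plus_right plus_closed in auto)

lemma yoneda_arr_closed:
  assumes "f \<in> Hom C X Y"
  shows "yoneda_arr C f \<in> Arr (Mod_cat C)"
  unfolding yoneda_arr_mk_arrow
proof (rule mk_arrow_closed)
  note f = HomD[OF assms]
  show "is_category C" by unfold_locales
  show "is_module C (yoneda_obj C (Dom C f))" "is_module C (yoneda_obj C (Cod C f))"
    using f by (simp_all add: is_module_yoneda_obj)
  show "(\<lambda>h. f \<cdot> h) \<in> hom (fobj (yoneda_obj C (Dom C f)) Z) (fobj (yoneda_obj C (Cod C f)) Z)"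
    if "Z \<in> Obj C" for Z
    using that comp_closed[OF _ assms] comp_plus_right[OF _ _ assms] f by (auto simp: hom_def)
  show "f \<cdot> act (yoneda_obj C (Dom C f)) u x = act (yoneda_obj C (Cod C f)) u (f \<cdot> x)"
    if u: "u \<in> Hom C Z W" and x: "x \<in> el (yoneda_obj C (Dom C f)) W" for Z W u x
  proof -
    have x: "x \<in> Hom C W X" using x HomD[OF u] f by simp
    then show ?thesis
      using act_yoneda_obj[OF u x] act_yoneda_obj[OF u comp_closed[OF x assms]]
        comp_assoc[OF u x assms] f by simp
  qed
qed

text \<open>Hom-sets with different codomains are disjoint, so the identity of \<open>X\<close>
  reveals \<open>X\<close>. An object can thus be recovered from its representable module, which is
  needed to extend \<Phi> strictly and not just up to isomorphism.\<close>

lemma yoneda_obj_inj: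
  assumes "X \<in> Obj C" "yoneda_obj C X = yoneda_obj C Y"
  shows "X = Y"
proof -
  have "el (yoneda_obj C X) X = el (yoneda_obj C Y) X" using assms(2) by simp
  then have "Id C X \<in> Hom C X Y" using id_closed[OF assms(1)] assms(1) by simp
  then show ?thesis using HomD(3)[OF id_closed[OF assms(1)]] HomD(3) by metis
qed

lemma yoneda_lemma:
  assumes "\<alpha> \<in> Arr (Mod_cat C)" "src \<alpha> = yoneda_obj C X" "u \<in> Hom C Z X"
  shows "component \<alpha> Z u = act (tgt \<alpha>) u (component \<alpha> X (Id C X))"
proof -
  have X: "X \<in> Obj C" and cat: "is_category C" using HomD[OF assms(3)] by (auto intro: is_category_axioms)
  have "component \<alpha> Z (act (src \<alpha>) u (Id C X)) = act (tgt \<alpha>) u (component \<alpha> X (Id C X))"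
    by (rule component_act[OF assms(1) cat assms(3)]) (use X id_closed in \<open>simp add: assms(2)\<close>)
  then show ?thesis
    using act_yoneda_obj[OF assms(3) id_closed[OF X]] comp_id_left[OF assms(3)] assms(2) by simp
qed

lemma yoneda_arr_comp:
  assumes f: "f \<in> Hom C X Y" and g: "g \<in> Hom C Y Z"
  shows "yoneda_arr C (g \<cdot> f) = Comp (Mod_cat C) (yoneda_arr C g) (yoneda_arr C f)"
proof -
  note [simp] = HomD(2,3)[OF f] HomD(2,3)[OF g] HomD(2,3)[OF comp_closed[OF f g]]
  note c = Comp_Mod_cat_closed[OF is_category_axioms yoneda_arr_closed[OF f] yoneda_arr_closed[OF g]]
  show ?thesis
  proof (rule module_arrow_eqI[OF yoneda_arr_closed[OF comp_closed[OF f g]] c(1)])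
    fix W x assume W: "W \<in> Obj C" and "x \<in> el (src (yoneda_arr C (g \<cdot> f))) W"
    then have x: "x \<in> Hom C W X" by simp
    then show "component (yoneda_arr C (g \<cdot> f)) W x = component (Comp (Mod_cat C) (yoneda_arr C g) (yoneda_arr C f)) W x"
      using c(2)[of W x] W comp_assoc[OF x f g] comp_closed[OF x f]
      by (simp add: component_yoneda_arr)
  qed (simp_all add: Mod_cat_simps(5))
qed

lemma yoneda_arr_id:
  assumes X: "X \<in> Obj C"
  shows "yoneda_arr C (Id C X) = Id (Mod_cat C) (yoneda_obj C X)"
proof -
  note [simp] = HomD(2,3)[OF id_closed[OF X]]
  note c = Id_Mod_cat_closed[OF is_category_axioms is_module_yoneda_obj[OF X]]
  show ?thesis
  proof (rule module_arrow_eqI[OF yoneda_arr_closed[OF id_closed[OF X]] c(1)])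
    fix W x assume W: "W \<in> Obj C" and "x \<in> el (src (yoneda_arr C (Id C X))) W"
    then have x: "x \<in> Hom C W X" by simp
    then show "component (yoneda_arr C (Id C X)) W x = component (Id (Mod_cat C) (yoneda_obj C X)) W x"
      using c(2)[of W x] W comp_id_left[OF x] by (simp add: component_yoneda_arr)
  qed (simp_all add: Mod_cat_simps(4))
qed

lemma yoneda_arr_plus:
  assumes f: "f \<in> Hom C X Y" and g: "g \<in> Hom C X Y"
  shows "yoneda_arr C (plus_arr C f g) = plus_arr (Mod_cat C) (yoneda_arr C f) (yoneda_arr C g)"
proof -
  note [simp] = HomD(2,3)[OF f] HomD(2,3)[OF g] HomD(2,3)[OF plus_closed[OF f g]]
  note c = plus_Mod_cat_closed[OF is_category_axioms yoneda_arr_closed[OF f] yoneda_arr_closed[OF g]]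
  show ?thesis
  proof (rule module_arrow_eqI[OF yoneda_arr_closed[OF plus_closed[OF f g]] c(1)])
    fix W x assume W: "W \<in> Obj C" and "x \<in> el (src (yoneda_arr C (plus_arr C f g))) W"
    then have x: "x \<in> Hom C W X" by simp
    then show "component (yoneda_arr C (plus_arr C f g)) W x = component (plus_arr (Mod_cat C) (yoneda_arr C f) (yoneda_arr C g)) W x"
      using c(2)[of W x] W comp_plus_left[OF x f g] by (simp add: component_yoneda_arr)
  qed (simp_all add: Mod_cat_simps(6))
qed

end

section \<open>Admissible presentations of representables and images, and left exactness of
  \<Upsilon>\<close>

context exact_category
begin

text \<open>The presentation is \<Upsilon>(k) followed by the identity of \<Upsilon>(Y), where the
  inflation \<open>k\<close> starts at an object that receives only zero arrows.\<close>

lemma adm_presented_yoneda_obj: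
  assumes Y: "Y \<in> Obj E"
  shows "adm_presented E (yoneda_obj E Y)"
proof -
  obtain k where k: "inflation E k" "Cod E k = Y"
    and K: "\<And>Z u. u \<in> Hom E Z (Dom E k) \<Longrightarrow> u = zero_arr E Z (Dom E k)"
    using initial_inflation[OF Y] by metis
  note kh = inflation_closed[OF k(1)]
  note i = Id_Mod_cat_closed[OF is_category_axioms is_module_yoneda_obj[OF Y]]
  have "component (yoneda_arr E k) Z ` Hom E Z (Dom E k) = {zero_arr E Z Y}" if Z: "Z \<in> Obj E" for Z
  proof -
    have "Hom E Z (Dom E k) = {zero_arr E Z (Dom E k)}"
      using K zero_closed[OF Z HomD(4)[OF kh]] by blast
    then show ?thesis
      using component_yoneda_arr[of "zero_arr E Z (Dom E k)"] comp_zero_right[OF kh Z] k(2) by simp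
  qed
  moreover have "{zero_arr E Z Y} = kernel (hom_group E Z Y) (hom_group E Z Y) (component (Id (Mod_cat E) (yoneda_obj E Y)) Z)"
    if Z: "Z \<in> Obj E" for Z
    using i(2)[OF Z] Z zero_closed[OF Z Y] by (auto simp: kernel_def)
  moreover have "component (Id (Mod_cat E) (yoneda_obj E Y)) Z ` Hom E Z Y = Hom E Z Y" if Z: "Z \<in> Obj E" for Z
    using i(2)[OF Z] Z by simp
  ultimately have "right_exact_seq E (yoneda_arr E k) (Id (Mod_cat E) (yoneda_obj E Y))"
    using yoneda_arr_closed[OF kh] i(1) k(2) by (simp add: right_exact_seq_def Mod_cat_simps(4))
  then show ?thesis
    unfolding adm_presented_def using inflation_admissible[OF k(1)] is_module_yoneda_obj[OF Y]
    by (auto simp: Mod_cat_simps(4) intro!: exI[of _ k] exI[of _ "Id (Mod_cat E) (yoneda_obj E Y)"])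
qed

lemma yoneda_arr_mod_adm: "f \<in> Hom E X Y \<Longrightarrow> yoneda_arr E f \<in> Hom (mod_adm E) (yoneda_obj E X) (yoneda_obj E Y)"
  using HomD[of f X Y] yoneda_arr_closed adm_presented_yoneda_obj by (auto simp: Hom_mod_adm)

text \<open>Since \<open>m\<close> is monic, \<open>m \<cdot> p \<cdot> h = 0\<close> holds exactly
  when \<open>p \<cdot> h = 0\<close>, that is, when \<open>h\<close> factors through
  \<open>k\<close>. So the surjection of the representable module onto the image of \<Upsilon>(m
  \<cdot> p) has the image of \<Upsilon>(k) as its kernel, and \<Upsilon>(k) is injective because
  \<open>k\<close> is monic. As an inflation, \<open>k\<close> is admissible and hence presents the
  image.\<close>

lemma admissible_image_conflations:
  assumes kp: "(k, p) \<in> Confl E" and m: "inflation E m" and pm: "Cod E p = Dom E m"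
    and \<pi>: "right_exact_seq E (yoneda_arr E (m \<cdot> p)) \<pi>"
  obtains \<epsilon> \<iota> where "(yoneda_arr E k, \<epsilon>) \<in> Confl (mod_adm E)" "(\<iota>, \<pi>) \<in> Confl (mod_adm E)"
    "Comp (Mod_cat E) \<iota> \<epsilon> = yoneda_arr E (m \<cdot> p)" "src \<epsilon> = yoneda_obj E (Dom E p)" "tgt \<epsilon> = src \<iota>"
    "\<epsilon> \<in> Arr (Mod_cat E)" "\<iota> \<in> Arr (Mod_cat E)"
proof -
  note d = conflD[OF kp]
  let ?K = "Dom E k" and ?X = "Dom E p" and ?W = "Dom E m" and ?Y = "Cod E m"
  have k: "k \<in> Hom E ?K ?X" and p: "p \<in> Hom E ?X ?W" and mh: "m \<in> Hom E ?W ?Y"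
    using d pm inflation_closed[OF m] by simp_all
  have f: "m \<cdot> p \<in> Hom E ?X ?Y" by (rule comp_closed[OF p mh])
  note [simp] = HomD(2,3)[OF f] HomD(3)[OF k]
  note o = HomD(4,5)[OF k] HomD(5)[OF p] HomD(5)[OF mh]
  have ker: "m \<cdot> p \<cdot> h = zero_arr E Z ?Y \<longleftrightarrow> (\<exists>u\<in>Hom E Z ?K. h = k \<cdot> u)" if h: "h \<in> Hom E Z ?X" for h Z
  proof
    note Z = HomD(4)[OF h]
    assume "m \<cdot> p \<cdot> h = zero_arr E Z ?Y"
    then have "m \<cdot> (p \<cdot> h) = m \<cdot> zero_arr E Z ?W"
      using comp_assoc[OF h p mh] comp_zero_right[OF mh Z] by simp
    then have "p \<cdot> h = zero_arr E Z ?W"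
      by (rule inflation_mono[OF m comp_closed[OF h p] zero_closed[OF Z o(3)]])
    then have "p \<cdot> h = zero_arr E Z (Cod E p)" using pm by simp
    from kernel_factor[OF d(1) h this] show "\<exists>u\<in>Hom E Z ?K. h = k \<cdot> u" by auto
  next
    assume "\<exists>u\<in>Hom E Z ?K. h = k \<cdot> u"
    then obtain u where u: "u \<in> Hom E Z ?K" "h = k \<cdot> u" by blast
    have "m \<cdot> p \<cdot> h = m \<cdot> (p \<cdot> k \<cdot> u)" using comp_assoc[OF u(1) k p] comp_assoc[OF h p mh] u(2) by simp
    also have "\<dots> = zero_arr E Z ?Y"
      using kernelD(3)[OF d(1)] pm comp_zero_left[OF u(1) o(3)] comp_zero_right[OF mh HomD(4)[OF u(1)]] by simp
    finally show "m \<cdot> p \<cdot> h = zero_arr E Z ?Y" .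
  qed
  obtain \<epsilon> \<iota> where \<epsilon>: "\<epsilon> \<in> Arr (Mod_cat E)" and \<iota>: "\<iota> \<in> Arr (Mod_cat E)"
    and st: "src \<epsilon> = yoneda_obj E ?X" "tgt \<epsilon> = src \<iota>" "tgt \<iota> = yoneda_obj E ?Y"
    and c\<epsilon>': "\<And>Z x. \<lbrakk>Z \<in> Obj E; x \<in> el (yoneda_obj E ?X) Z\<rbrakk> \<Longrightarrow> component \<epsilon> Z x = component (yoneda_arr E (m \<cdot> p)) Z x"
    and c\<iota>: "\<And>Z x. \<lbrakk>Z \<in> Obj E; x \<in> el (src \<iota>) Z\<rbrakk> \<Longrightarrow> component \<iota> Z x = x"
    and img: "\<And>Z. Z \<in> Obj E \<Longrightarrow> el (src \<iota>) Z = component (yoneda_arr E (m \<cdot> p)) Z ` el (yoneda_obj E ?X) Z"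
    and one: "\<And>Z. Z \<in> Obj E \<Longrightarrow> \<one>\<^bsub>fobj (src \<iota>) Z\<^esub> = \<one>\<^bsub>fobj (tgt \<iota>) Z\<^esub>"
    using image_factorization[OF yoneda_arr_closed[OF f]] by (auto simp del: fobj_yoneda_obj)
  have c\<epsilon>: "component \<epsilon> Z x = m \<cdot> p \<cdot> x" if "x \<in> Hom E Z ?X" for Z x
    using c\<epsilon>'[of Z x] that HomD[OF that] by (simp add: component_yoneda_arr)
  have r\<epsilon>: "right_exact_seq E (yoneda_arr E k) \<epsilon>"
    unfolding right_exact_seq_def
  proof (intro conjI ballI)
    fix Z assume Z: "Z \<in> Obj E"
    show "component (yoneda_arr E k) Z ` el (src (yoneda_arr E k)) Z = kernel (fobj (src \<epsilon>) Z) (fobj (tgt \<epsilon>) Z) (component \<epsilon> Z)"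
    proof (intro equalityI subsetI)
      fix h assume "h \<in> component (yoneda_arr E k) Z ` el (src (yoneda_arr E k)) Z"
      then obtain u where u: "u \<in> Hom E Z ?K" "h = k \<cdot> u" using Z by (auto simp: component_yoneda_arr)
      then have h: "h \<in> Hom E Z ?X" using comp_closed k by blast
      then show "h \<in> kernel (fobj (src \<epsilon>) Z) (fobj (tgt \<epsilon>) Z) (component \<epsilon> Z)"
        using c\<epsilon>[OF h] ker[OF h] u one[OF Z] Z by (auto simp: kernel_def st)
    next
      fix h assume *: "h \<in> kernel (fobj (src \<epsilon>) Z) (fobj (tgt \<epsilon>) Z) (component \<epsilon> Z)"
      then have h: "h \<in> Hom E Z ?X" using Z by (simp add: kernel_def st)
      then have "m \<cdot> p \<cdot> h = zero_arr E Z ?Y" using * c\<epsilon>[OF h] one[OF Z] Z by (auto simp: kernel_def st)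
      then obtain u where "u \<in> Hom E Z ?K" "h = k \<cdot> u" using ker[OF h] by blast
      then show "h \<in> component (yoneda_arr E k) Z ` el (src (yoneda_arr E k)) Z"
        using Z by (auto simp: component_yoneda_arr intro!: image_eqI[of _ _ u])
    qed
    show "component \<epsilon> Z ` el (src \<epsilon>) Z = el (tgt \<epsilon>) Z"
      using c\<epsilon>'[OF Z] img[OF Z] by (simp add: st)
  qed (use yoneda_arr_closed[OF k] \<epsilon> st in auto)
  have kinj: "inj_on (component (yoneda_arr E k) Z) (el (src (yoneda_arr E k)) Z)" if Z: "Z \<in> Obj E" for Z
    using kernel_mono[OF d(1)] Z by (auto simp: inj_on_def component_yoneda_arr)
  have kinf: "inflation E k" using kp by (auto simp: inflation_def)
  have I: "adm_presented E (src \<iota>)"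
    unfolding adm_presented_def using r\<epsilon> inflation_admissible[OF kinf] st(2) \<iota>
    by (auto simp: Arr_Mod_cat intro!: exI[of _ k] exI[of _ \<epsilon>])
  have \<pi>a: "\<pi> \<in> Arr (Mod_cat E)" "src \<pi> = yoneda_obj E ?Y" using \<pi> by (auto simp: right_exact_seq_def)
  have \<iota>im: "component \<iota> Z ` el (src \<iota>) Z = component (yoneda_arr E (m \<cdot> p)) Z ` el (yoneda_obj E ?X) Z" if "Z \<in> Obj E" for Z
    using c\<iota>[OF that] img[OF that] by simp
  have "right_exact_seq E \<iota> \<pi>"
    using \<pi> \<iota>im \<iota> st(3) \<pi>a by (simp add: right_exact_seq_def)
  moreover have "inj_on (component \<iota> Z) (el (src \<iota>) Z)" if "Z \<in> Obj E" for Z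
    using c\<iota>[OF that] by (auto simp: inj_on_def)
  ultimately have s\<iota>: "short_exact_seq E \<iota> \<pi>" by (simp add: short_exact_seq_def)
  have adm: "admissible E (m \<cdot> p)"
    using kp m pm by (auto simp: admissible_def deflation_def)
  have H: "adm_presented E (tgt \<pi>)"
    unfolding adm_presented_def using adm \<pi> \<pi>a by (auto simp: Arr_Mod_cat)
  have comp: "Comp (Mod_cat E) \<iota> \<epsilon> = yoneda_arr E (m \<cdot> p)"
  proof -
    note c = Comp_Mod_cat_closed[OF is_category_axioms \<epsilon> \<iota> st(2)]
    show ?thesis
    proof (rule module_arrow_eqI[OF c(1) yoneda_arr_closed[OF f]])
      fix Z x assume Z: "Z \<in> Obj E" and "x \<in> el (src (Comp (Mod_cat E) \<iota> \<epsilon>)) Z"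
      then have x: "x \<in> el (yoneda_obj E ?X) Z" by (simp add: Mod_cat_simps(5) st)
      have "component \<epsilon> Z x \<in> el (src \<iota>) Z" using c\<epsilon>'[OF Z x] img[OF Z] x by auto
      then show "component (Comp (Mod_cat E) \<iota> \<epsilon>) Z x = component (yoneda_arr E (m \<cdot> p)) Z x"
        using c(2)[OF Z] x c\<iota>[OF Z] c\<epsilon>'[OF Z x] st by simp
    qed (simp_all add: Mod_cat_simps(5) st)
  qed
  show ?thesis
  proof (rule that[OF _ _ comp st(1,2) \<epsilon> \<iota>])
    show "(yoneda_arr E k, \<epsilon>) \<in> Confl (mod_adm E)"
      using r\<epsilon> kinj I o st by (simp add: Confl_mod_adm short_exact_seq_def adm_presented_yoneda_obj)
    show "(\<iota>, \<pi>) \<in> Confl (mod_adm E)"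
      using s\<iota> I H o st by (simp add: Confl_mod_adm adm_presented_yoneda_obj)
  qed
qed

text \<open>For an arrow \<open>h\<close> of modules annihilated by \<Upsilon>(g), each value of
  \<open>h\<close> is an arrow of \<open>E\<close> annihilated by \<open>g\<close>, so it lifts
  along \<open>f\<close>. The lifts are chosen element by element; cancelling the monic
  \<open>f\<close> shows that they are additive, natural and unique.\<close>

lemma yoneda_kernel:
  assumes fg: "(f, g) \<in> Confl E"
  shows "is_kernel (mod_adm E) (yoneda_arr E f) (yoneda_arr E g)"
proof -
  note d = conflD[OF fg]
  let ?X = "Dom E f" and ?Y = "Cod E f" and ?Z = "Cod E g"
  have f: "f \<in> Hom E ?X ?Y" and g: "g \<in> Hom E ?Y ?Z" using d by simp_all
  note k = kernelD[OF d(1), unfolded d(5)]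
  note o = HomD(4,5)[OF f] HomD(5)[OF g]
  have yf: "yoneda_arr E f \<in> Arr (Mod_cat E)" and yg: "yoneda_arr E g \<in> Arr (Mod_cat E)"
    using yoneda_arr_closed f g by blast+
  have z: "yoneda_arr E (g \<cdot> f) = zero_arr (Mod_cat E) (yoneda_obj E ?X) (yoneda_obj E ?Z)"
  proof -
    note c = zero_Mod_cat_closed[OF is_category_axioms is_module_yoneda_obj[OF o(1)] is_module_yoneda_obj[OF o(3)]]
    note gf = comp_closed[OF f g]
    note [simp] = HomD(2,3)[OF gf]
    show ?thesis
    proof (rule module_arrow_eqI[OF yoneda_arr_closed[OF gf] c(1)])
      fix W x assume W: "W \<in> Obj E" and "x \<in> el (src (yoneda_arr E (g \<cdot> f))) W"
      then have x: "x \<in> Hom E W ?X" by simp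
      then show "component (yoneda_arr E (g \<cdot> f)) W x
          = component (zero_arr (Mod_cat E) (yoneda_obj E ?X) (yoneda_obj E ?Z)) W x"
      proof -
        have "component (yoneda_arr E (g \<cdot> f)) W x = g \<cdot> f \<cdot> x"
          by (rule component_yoneda_arr) (simp add: x)
        also have "\<dots> = zero_arr E W ?Z" by (simp only: k(3) comp_zero_left[OF x o(3)])
        finally show ?thesis using c(2)[OF W, of x] W x by simp
      qed
    qed (simp_all add: Mod_cat_simps(7))
  qed
  show ?thesis unfolding is_kernel_def
  proof (intro conjI ballI impI)
    show "Comp (mod_adm E) (yoneda_arr E g) (yoneda_arr E f)
        = zero_arr (mod_adm E) (Dom (mod_adm E) (yoneda_arr E f)) (Cod (mod_adm E) (yoneda_arr E g))"
      using z yoneda_arr_comp[OF f g] by simp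
    fix h assume "h \<in> Arr (mod_adm E)" and "Cod (mod_adm E) h = Dom (mod_adm E) (yoneda_arr E g) \<and>
      Comp (mod_adm E) (yoneda_arr E g) h = zero_arr (mod_adm E) (Dom (mod_adm E) h) (Cod (mod_adm E) (yoneda_arr E g))"
    then have h: "h \<in> Arr (Mod_cat E)" and adm: "adm_presented E (src h)" and th: "tgt h = yoneda_obj E ?Y"
      and zh: "Comp (Mod_cat E) (yoneda_arr E g) h = zero_arr (Mod_cat E) (src h) (yoneda_obj E ?Z)"
      by (auto simp: Arr_mod_adm d(5))
    have m: "is_module E (src h)" using h by (simp add: Arr_Mod_cat)
    have hx: "component h W x \<in> Hom E W ?Y" if "W \<in> Obj E" "x \<in> el (src h) W" for W x
      using component_closed[OF h that] that th by simp
    have "\<exists>u. u \<in> Hom E W ?X \<and> f \<cdot> u = component h W x" if W: "W \<in> Obj E" and x: "x \<in> el (src h) W" for W x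
    proof -
      have "component (Comp (Mod_cat E) (yoneda_arr E g) h) W x = zero_arr E W ?Z"
        using zero_Mod_cat_closed(2)[OF is_category_axioms m is_module_yoneda_obj[OF o(3)] W x] W zh by simp
      then have "g \<cdot> component h W x = zero_arr E W ?Z"
        using Comp_Mod_cat_closed(2)[OF is_category_axioms h yg _ W x] th d(5)
          component_yoneda_arr[of "component h W x" W g] hx[OF W x] by simp
      then show ?thesis using kernel_factor[OF d(1)] hx[OF W x] d(5) by (simp add: Bex_def)
    qed
    then obtain t where t: "\<And>W x. \<lbrakk>W \<in> Obj E; x \<in> el (src h) W\<rbrakk> \<Longrightarrow> t W x \<in> Hom E W ?X \<and> f \<cdot> t W x = component h W x"
      by metis
    note t1 = t[THEN conjunct1] and t2 = t[THEN conjunct2]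
    let ?u = "mk_arrow E (src h) (yoneda_obj E ?X) t"
    have u: "?u \<in> Arr (Mod_cat E)"
    proof (rule mk_arrow_closed[OF is_category_axioms m is_module_yoneda_obj[OF o(1)]])
      show "t W \<in> hom (fobj (src h) W) (fobj (yoneda_obj E ?X) W)" if W: "W \<in> Obj E" for W
      proof (rule homI)
        show "t W x \<in> el (yoneda_obj E ?X) W" if "x \<in> el (src h) W" for x using t1[OF W that] W by simp
        fix x y assume x: "x \<in> el (src h) W" and y: "y \<in> el (src h) W"
        interpret G: comm_group "fobj (src h) W" by (rule module_group[OF m W])
        have xy: "x \<otimes>\<^bsub>fobj (src h) W\<^esub> y \<in> el (src h) W" using x y by simp
        have "t W (x \<otimes>\<^bsub>fobj (src h) W\<^esub> y) = plus_arr E (t W x) (t W y)"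
        proof (rule kernel_mono[OF d(1) t1[OF W xy] plus_closed[OF t1[OF W x] t1[OF W y]]])
          show "f \<cdot> t W (x \<otimes>\<^bsub>fobj (src h) W\<^esub> y) = f \<cdot> plus_arr E (t W x) (t W y)"
            using t2[OF W xy] component_mult[OF h W x y] comp_plus_right[OF t1[OF W x] t1[OF W y] f]
              t2[OF W x] t2[OF W y] th W by simp
        qed
        then show "t W (x \<otimes>\<^bsub>fobj (src h) W\<^esub> y) = t W x \<otimes>\<^bsub>fobj (yoneda_obj E ?X) W\<^esub> t W y"
          using W by simp
      qed
      fix V W u x assume u: "u \<in> Hom E V W" and x: "x \<in> el (src h) W"
      note uo = HomD(4,5)[OF u]
      note ux = act_closed[OF m u x] and tx = t1[OF uo(2) x]
      have "t V (act (src h) u x) = t W x \<cdot> u"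
      proof (rule kernel_mono[OF d(1) t1[OF uo(1) ux] comp_closed[OF u tx]])
        show "f \<cdot> t V (act (src h) u x) = f \<cdot> (t W x \<cdot> u)"
          using t2[OF uo(1) ux] component_act[OF h is_category_axioms u x] th
            act_yoneda_obj[OF u hx[OF uo(2) x]] t2[OF uo(2) x] comp_assoc[OF u tx f] by simp
      qed
      then show "t V (act (src h) u x) = act (yoneda_obj E ?X) u (t W x)"
        using act_yoneda_obj[OF u tx] by simp
    qed
    have eq: "component (Comp (Mod_cat E) (yoneda_arr E f) v) W x = f \<cdot> component v W x"
      if v: "v \<in> Arr (Mod_cat E)" "src v = src h" "tgt v = yoneda_obj E ?X" and W: "W \<in> Obj E" and x: "x \<in> el (src h) W" for v W x
      using Comp_Mod_cat_closed(2)[OF is_category_axioms v(1) yf] v W x component_yoneda_arr[of "component v W x" W f]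
        component_closed[OF v(1) W] by simp
    show "\<exists>!u. u \<in> Hom (mod_adm E) (Dom (mod_adm E) h) (Dom (mod_adm E) (yoneda_arr E f)) \<and>
      Comp (mod_adm E) (yoneda_arr E f) u = h"
    proof (rule ex1I[of _ ?u], intro conjI)
      show "?u \<in> Hom (mod_adm E) (Dom (mod_adm E) h) (Dom (mod_adm E) (yoneda_arr E f))"
        using u adm adm_presented_yoneda_obj[OF o(1)] by (simp add: Hom_mod_adm)
      have "Comp (Mod_cat E) (yoneda_arr E f) ?u \<in> Arr (Mod_cat E)"
        by (rule Comp_Mod_cat_closed(1)[OF is_category_axioms u yf]) simp
      then show "Comp (mod_adm E) (yoneda_arr E f) ?u = h"
        unfolding mod_adm_simps
      proof (rule module_arrow_eqI[OF _ h])
        fix W x assume W: "W \<in> Obj E" and "x \<in> el (src (Comp (Mod_cat E) (yoneda_arr E f) ?u)) W"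
        then have x: "x \<in> el (src h) W" by (simp add: Mod_cat_simps(5))
        show "component (Comp (Mod_cat E) (yoneda_arr E f) ?u) W x = component h W x"
          using eq[OF u _ _ W x] t2[OF W x] W x by simp
      qed (simp_all add: Mod_cat_simps(5) th)
      fix v assume "v \<in> Hom (mod_adm E) (Dom (mod_adm E) h) (Dom (mod_adm E) (yoneda_arr E f)) \<and>
        Comp (mod_adm E) (yoneda_arr E f) v = h"
      then have v: "v \<in> Arr (Mod_cat E)" "src v = src h" "tgt v = yoneda_obj E ?X"
        and vh: "Comp (Mod_cat E) (yoneda_arr E f) v = h" by (auto simp: Hom_mod_adm)
      show "v = ?u"
      proof (rule module_arrow_eqI[OF v(1) u])
        fix W x assume W: "W \<in> Obj E" and "x \<in> el (src v) W"
        then have x: "x \<in> el (src h) W" using v by simp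
        have "component v W x = t W x"
        proof (rule kernel_mono[OF d(1)  _ t1[OF W x]])
          show "component v W x \<in> Hom E W ?X" using component_closed[OF v(1) W] x v W by simp
          show "f \<cdot> component v W x = f \<cdot> t W x" using eq[OF v W x] vh t2[OF W x] by simp
        qed
        then show "component v W x = component ?u W x" using W x by simp
      qed (simp_all add: v)
    qed
  qed (use yf yg o d(5) adm_presented_yoneda_obj in \<open>simp_all add: Arr_mod_adm\<close>)
qed

lemma yoneda_simps:
  "X \<in> Obj E \<Longrightarrow> fobj (yoneda E) X = yoneda_obj E X" "f \<in> Hom E X Y \<Longrightarrow> fmap (yoneda E) f = yoneda_arr E f"
  by (simp_all add: yoneda_def HomD)

lemma additive_functor_yoneda: "additive_functor E (mod_adm E) (yoneda E)"
proof
  show "fobj (yoneda E) \<in> extensional (Obj E)" "fmap (yoneda E) \<in> extensional (Arr E)"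
    by (simp_all add: yoneda_def)
  show "fobj (yoneda E) X \<in> Obj (mod_adm E)" if "X \<in> Obj E" for X
    using that adm_presented_yoneda_obj by (simp add: yoneda_simps)
  show "fmap (yoneda E) f \<in> Hom (mod_adm E) (fobj (yoneda E) X) (fobj (yoneda E) Y)" if "f \<in> Hom E X Y" for f X Y
    using that yoneda_arr_mod_adm HomD[OF that] by (simp add: yoneda_simps(1) yoneda_simps(2)[OF that])
  show "fmap (yoneda E) (Id E X) = Id (mod_adm E) (fobj (yoneda E) X)" if "X \<in> Obj E" for X
    using that yoneda_arr_id by (simp add: yoneda_simps(2)[OF id_closed] yoneda_simps(1))
  show "fmap (yoneda E) (g \<cdot> f) = Comp (mod_adm E) (fmap (yoneda E) g) (fmap (yoneda E) f)"
    if f: "f \<in> Hom E X Y" and g: "g \<in> Hom E Y Z" for f g X Y Z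
    using yoneda_arr_comp[OF f g] by (simp add: yoneda_simps(2)[OF comp_closed[OF f g]] yoneda_simps(2)[OF f] yoneda_simps(2)[OF g])
  show "fmap (yoneda E) (plus_arr E f g) = plus_arr (mod_adm E) (fmap (yoneda E) f) (fmap (yoneda E) g)"
    if f: "f \<in> Hom E X Y" and g: "g \<in> Hom E X Y" for f g X Y
    using yoneda_arr_plus[OF f g] by (simp add: yoneda_simps(2)[OF plus_closed[OF f g]] yoneda_simps(2)[OF f] yoneda_simps(2)[OF g])
qed

theorem left_exact_yoneda: "left_exact_functor E (mod_adm E) (yoneda E)"
  unfolding left_exact_functor_def
proof (intro conjI additive_functor_yoneda ballI, clarify)
  fix f g assume fg: "(f, g) \<in> Confl E"
  note d = conflD[OF fg]
  note yf = yoneda_simps(2)[OF d(3)] and yg = yoneda_simps(2)[OF d(4)]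
  obtain \<pi> where "right_exact_seq E (yoneda_arr E g) \<pi>"
    using cokernel_exists[OF yoneda_arr_closed[OF d(4)]] .
  \<comment> \<open>Writing the deflation \<open>g\<close> as \<open>Id \<cdot> g\<close> makes it
    an admissible arrow with trivial inflation part, so both conflations through the image of
    \<Upsilon>(g) are available.\<close>
  moreover have "Id E (Cod E g) \<cdot> g = g" by (rule comp_id_left[OF d(4)])
  moreover have "inflation E (Id E (Cod E g))" "Cod E g = Dom E (Id E (Cod E g))"
    using HomD[OF d(4)] HomD[OF id_closed, of "Cod E g"] id_inflation by auto
  ultimately obtain \<epsilon> \<iota> where "(yoneda_arr E f, \<epsilon>) \<in> Confl (mod_adm E)" "(\<iota>, \<pi>) \<in> Confl (mod_adm E)"
    "Comp (Mod_cat E) \<iota> \<epsilon> = yoneda_arr E g" "tgt \<epsilon> = src \<iota>"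
    using admissible_image_conflations[OF fg, of "Id E (Cod E g)" \<pi>] by metis
  then have "admissible (mod_adm E) (yoneda_arr E g)" "inflation (mod_adm E) (yoneda_arr E f)"
    unfolding admissible_def inflation_def deflation_def by (metis mod_adm_simps)+
  then show "admissible (mod_adm E) (fmap (yoneda E) g) \<and> inflation (mod_adm E) (fmap (yoneda E) f) \<and>
      is_kernel (mod_adm E) (fmap (yoneda E) f) (fmap (yoneda E) g)"
    using yoneda_kernel[OF fg] by (simp add: yf yg)
qed

end

section \<open>Conflations up to isomorphism and pushouts of inflations\<close>

lemma (in is_category) iso_arrI:
  assumes "f \<in> Hom C X Y" "g \<in> Hom C Y X" "g \<cdot> f = Id C X" "f \<cdot> g = Id C Y"
  shows "iso_arr C f"
  using assms HomD[OF assms(1)] by (auto simp: iso_arr_def)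

lemma (in is_category) iso_arr_Id: "X \<in> Obj C \<Longrightarrow> iso_arr C (Id C X)"
  using iso_arrI[OF id_closed id_closed] comp_id_left[OF id_closed] by simp

context preadditive_category
begin

lemma kernels_iso:
  assumes k: "is_kernel C k f" and k': "is_kernel C k' f"
  obtains a where "a \<in> Hom C (Dom C k) (Dom C k')" "k' \<cdot> a = k" "iso_arr C a"
proof -
  note d = kernelD[OF k] and d' = kernelD[OF k']
  note o = HomD(4)[OF d(1)] and o' = HomD(4)[OF d'(1)]
  obtain a where a: "a \<in> Hom C (Dom C k) (Dom C k')" "k' \<cdot> a = k"
    using kernel_factor[OF k' d(1,3)] by blast
  obtain b where b: "b \<in> Hom C (Dom C k') (Dom C k)" "k \<cdot> b = k'"
    using kernel_factor[OF k d'(1,3)] by blast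
  have "b \<cdot> a = Id C (Dom C k)"
    by (rule kernel_mono[OF k comp_closed[OF a(1) b(1)] id_closed[OF o]])
      (simp add: comp_assoc[OF a(1) b(1) d(1), symmetric] a b comp_id_right[OF d(1)])
  moreover have "a \<cdot> b = Id C (Dom C k')"
    by (rule kernel_mono[OF k' comp_closed[OF b(1) a(1)] id_closed[OF o']])
      (simp add: comp_assoc[OF b(1) a(1) d'(1), symmetric] a b comp_id_right[OF d'(1)])
  ultimately show ?thesis using that[OF a] iso_arrI[OF a(1) b(1)] by blast
qed

lemma cokernels_iso:
  assumes c: "is_cokernel C c f" and c': "is_cokernel C c' f"
  obtains a where "a \<in> Hom C (Cod C c) (Cod C c')" "a \<cdot> c = c'" "iso_arr C a"
proof -
  note d = cokernelD[OF c] and d' = cokernelD[OF c']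
  note o = HomD(5)[OF d(1)] and o' = HomD(5)[OF d'(1)]
  obtain a where a: "a \<in> Hom C (Cod C c) (Cod C c')" "a \<cdot> c = c'"
    using cokernel_factor[OF c d'(1,3)] by blast
  obtain b where b: "b \<in> Hom C (Cod C c') (Cod C c)" "b \<cdot> c' = c"
    using cokernel_factor[OF c' d(1,3)] by blast
  have "b \<cdot> a = Id C (Cod C c)"
    by (rule cokernel_epi[OF c comp_closed[OF a(1) b(1)] id_closed[OF o]])
      (simp add: comp_assoc[OF d(1) a(1) b(1)] a b comp_id_left[OF d(1)])
  moreover have "a \<cdot> b = Id C (Cod C c')"
    by (rule cokernel_epi[OF c' comp_closed[OF b(1) a(1)] id_closed[OF o']])
      (simp add: comp_assoc[OF d'(1) b(1) a(1)] a b comp_id_left[OF d'(1)])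
  ultimately show ?thesis using that[OF a] iso_arrI[OF a(1) b(1)] by blast
qed

end

context exact_category
begin

text \<open>Kernels of one arrow differ by an isomorphism, under which conflations are closed. This
  permits \<Phi>(k) to replace whichever kernel the exact structure provides.\<close>

lemma confl_of_kernel:
  assumes kp: "(k, p) \<in> Confl E" and k': "is_kernel E k' p"
  shows "(k', p) \<in> Confl E"
proof -
  note d = conflD[OF kp] and d' = kernelD[OF k']
  obtain a where a: "a \<in> Hom E (Dom E k) (Dom E k')" "k' \<cdot> a = k" "iso_arr E a"
    using kernels_iso[OF d(1) k'] .
  note o = HomD(4,5)[OF d(4)]
  note [simp] = HomD(3)[OF d'(1)]
  show ?thesis
  proof (rule confl_iso_closed[OF kp _ _ _ a(3) iso_arr_Id[OF o(1)] iso_arr_Id[OF o(2)]])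
    show "Id E (Dom E p) \<cdot> k = k' \<cdot> a" using comp_id_left[OF d(3)] d(5) a(2) by simp
    show "Id E (Cod E p) \<cdot> p = p \<cdot> Id E (Dom E p)" using comp_id_left[OF d(4)] comp_id_right[OF d(4)] by simp
  qed (use a d d' HomD(1)[OF d(4)] HomD(1)[OF d'(1)] id_closed o in auto)
qed

lemma confl_of_cokernel:
  assumes ic: "(i, c) \<in> Confl E" and c': "is_cokernel E c' i"
  shows "(i, c') \<in> Confl E"
proof -
  note d = conflD[OF ic] and d' = cokernelD[OF c']
  obtain a where a: "a \<in> Hom E (Cod E c) (Cod E c')" "a \<cdot> c = c'" "iso_arr E a"
    using cokernels_iso[OF d(2) c'] .
  note o = HomD(4,5)[OF d(3)]
  note [simp] = HomD(2)[OF d'(1)]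
  show ?thesis
  proof (rule confl_iso_closed[OF ic _ _ _ iso_arr_Id[OF o(1)] iso_arr_Id[OF o(2)] a(3)])
    show "Id E (Cod E i) \<cdot> i = i \<cdot> Id E (Dom E i)" using comp_id_left[OF d(3)] comp_id_right[OF d(3)] by simp
    show "a \<cdot> c = c' \<cdot> Id E (Cod E i)" using comp_id_right[OF d'(1)] a(2) by simp
  qed (use a d d' HomD(1)[OF d(3)] HomD(1)[OF d'(1)] id_closed o in auto)
qed

text \<open>A deflation \<open>q\<close> is epic, so an arrow annihilates \<open>n \<cdot> q\<close>
  exactly when it annihilates \<open>n\<close>. Admissible arrows thereby acquire cokernels, namely
  those of their inflation parts.\<close>

lemma cokernel_comp_deflation:
  assumes nc: "(n, c) \<in> Confl E" and q: "deflation E q" "Cod E q = Dom E n"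
  shows "is_cokernel E c (n \<cdot> q)"
proof -
  note d = conflD[OF nc] 
  have n: "n \<in> Hom E (Dom E n) (Dom E c)" using d by simp
  have qh: "q \<in> Hom E (Dom E q) (Dom E n)" using deflation_closed[OF q(1)] q(2) by simp
  note c = d(4) and nq = comp_closed[OF qh n]
  note o = HomD(4)[OF qh]
  have cn: "c \<cdot> n = zero_arr E (Dom E n) (Cod E c)" using cokernelD(3)[OF d(2)] .
  show ?thesis unfolding is_cokernel_def
  proof (intro conjI ballI impI)
    show "c \<in> Arr E" "n \<cdot> q \<in> Arr E" "Cod E (n \<cdot> q) = Dom E c"
      using HomD[OF c] HomD[OF nq] by auto
    show "c \<cdot> (n \<cdot> q) = zero_arr E (Dom E (n \<cdot> q)) (Cod E c)"
      using comp_assoc[OF qh n c] cn comp_zero_left[OF qh HomD(5)[OF c]] HomD(2)[OF nq] by simp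
    fix h assume "h \<in> Arr E" and *: "Dom E h = Cod E (n \<cdot> q) \<and> h \<cdot> (n \<cdot> q) = zero_arr E (Dom E (n \<cdot> q)) (Cod E h)"
    then have h: "h \<in> Hom E (Dom E c) (Cod E h)" using HomD(3)[OF nq] by (simp add: Hom_def)
    have "h \<cdot> n \<cdot> q = zero_arr E (Dom E n) (Cod E h) \<cdot> q"
      using comp_assoc[OF qh n h] * HomD(2)[OF nq] comp_zero_left[OF qh HomD(5)[OF h]] by simp
    then have "h \<cdot> n = zero_arr E (Dom E n) (Cod E h)"
      using deflation_epi[OF q(1), of "h \<cdot> n" "Cod E h"] comp_closed[OF n h]
        zero_closed[OF HomD(4)[OF n] HomD(5)[OF h]] q(2) by simp
    then show "\<exists>!u. u \<in> Hom E (Cod E c) (Cod E h) \<and> u \<cdot> c = h"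
      using cokernelD(4)[OF d(2), of h "Cod E h"] h d(5) by simp
  qed
qed

text \<open>The arrow \<open>c'\<close> is induced by \<open>c\<close> and zero. It is a cokernel of
  \<open>i'\<close>: if \<open>g \<cdot> i' = 0\<close>, then
  \<open>g \<cdot> n' \<cdot> n = g \<cdot> i' \<cdot> t = 0\<close>, so \<open>g \<cdot> n'\<close>
  factors through \<open>c\<close>, and the factor works for \<open>g\<close> by the uniqueness part
  of the pushout. Being a cokernel of an inflation, \<open>c'\<close> completes \<open>i'\<close> to
  a conflation. The last two conclusions are the universal property of the pushout, split into
  existence and uniqueness.\<close>

lemma pushout_confl:
  assumes nc: "(n, c) \<in> Confl E" and t: "t \<in> Hom E (Dom E n) T"
  obtains i' c' n' where "(i', c') \<in> Confl E" "i' \<in> Hom E T (Cod E i')" "n' \<in> Hom E (Cod E n) (Cod E i')"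
    "c' \<in> Hom E (Cod E i') (Cod E c)" "n' \<cdot> n = i' \<cdot> t" "c' \<cdot> n' = c" "c' \<cdot> i' = zero_arr E T (Cod E c)"
    "\<forall>S. \<forall>a\<in>Hom E (Cod E n) S. \<forall>b\<in>Hom E T S. a \<cdot> n = b \<cdot> t \<longrightarrow>
      (\<exists>w\<in>Hom E (Cod E i') S. w \<cdot> n' = a \<and> w \<cdot> i' = b)"
    "\<forall>S. \<forall>w\<in>Hom E (Cod E i') S. \<forall>w'\<in>Hom E (Cod E i') S. w \<cdot> n' = w' \<cdot> n' \<longrightarrow> w \<cdot> i' = w' \<cdot> i' \<longrightarrow> w = w'"
proof -
  note d = conflD[OF nc]
  let ?Y = "Cod E n"
  have n: "n \<in> Hom E (Dom E n) ?Y" and c: "c \<in> Hom E ?Y (Cod E c)" using d by simp_all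
  have "inflation E n" using nc by (auto simp: inflation_def)
  then obtain n' i' where po: "is_pushout E n t n' i'" and i': "inflation E i'"
    using inflation_pushout[of n t] HomD[OF t] by auto
  let ?D = "Cod E i'"
  have i'h: "i' \<in> Hom E T ?D" and n'h: "n' \<in> Hom E ?Y ?D" and sq: "n' \<cdot> n = i' \<cdot> t"
    using po HomD[OF t] by (auto simp: is_pushout_def Hom_def)
  have uni: "\<exists>!w. w \<in> Hom E ?D S \<and> w \<cdot> n' = a \<and> w \<cdot> i' = b"
    if a: "a \<in> Hom E ?Y S" and b: "b \<in> Hom E T S" and ab: "a \<cdot> n = b \<cdot> t" for a b S
  proof -
    have "\<forall>a\<in>Arr E. \<forall>b\<in>Arr E. Dom E a = Cod E n \<and> Dom E b = Cod E t \<and> Cod E a = Cod E b \<and> a \<cdot> n = b \<cdot> t \<longrightarrow>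
        (\<exists>!u. u \<in> Hom E (Cod E i') (Cod E a) \<and> u \<cdot> n' = a \<and> u \<cdot> i' = b)"
      using po unfolding is_pushout_def by (elim conjE)
    from bspec[OF bspec[OF this HomD(1)[OF a]] HomD(1)[OF b]] show ?thesis
      using HomD[OF a] HomD[OF b] HomD[OF t] ab by simp
  qed
  have ex: "\<exists>w\<in>Hom E ?D S. w \<cdot> n' = a \<and> w \<cdot> i' = b"
    if a: "a \<in> Hom E ?Y S" and b: "b \<in> Hom E T S" and ab: "a \<cdot> n = b \<cdot> t" for a b S
    using ex1_implies_ex[OF uni[OF a b ab]] by (simp add: Bex_def)
  have eq: "w = w'" if w: "w \<in> Hom E ?D S" "w' \<in> Hom E ?D S" "w \<cdot> n' = w' \<cdot> n'" "w \<cdot> i' = w' \<cdot> i'" for w w' S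
  proof -
    have "w' \<cdot> n' \<cdot> n = w' \<cdot> i' \<cdot> t"
      using comp_assoc[OF n n'h w(2)] comp_assoc[OF t i'h w(2)] sq by simp
    from uni[OF comp_closed[OF n'h w(2)] comp_closed[OF i'h w(2)] this] show ?thesis using w by auto
  qed
  have zT: "zero_arr E T (Cod E c) \<in> Hom E T (Cod E c)" using zero_closed HomD[OF t] HomD[OF c] by simp
  have cn: "c \<cdot> n = zero_arr E (Dom E n) (Cod E c)" using cokernelD(3)[OF d(2)] .
  obtain c' where c': "c' \<in> Hom E ?D (Cod E c)" "c' \<cdot> n' = c" "c' \<cdot> i' = zero_arr E T (Cod E c)"
    using ex[OF c zT] cn comp_zero_left[OF t HomD(5)[OF c]] by auto
  have "is_cokernel E c' i'" unfolding is_cokernel_def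
  proof (intro conjI ballI impI)
    note [simp] = HomD(2)[OF i'h] HomD(2,3)[OF c'(1)]
    show "c' \<in> Arr E" "i' \<in> Arr E" "Cod E i' = Dom E c'" "c' \<cdot> i' = zero_arr E (Dom E i') (Cod E c')"
      using c' HomD[OF c'(1)] HomD[OF i'h] by auto
    fix g assume "g \<in> Arr E" and *: "Dom E g = Cod E i' \<and> g \<cdot> i' = zero_arr E (Dom E i') (Cod E g)"
    then have g: "g \<in> Hom E ?D (Cod E g)" by (simp add: Hom_def)
    note gn = comp_closed[OF n'h g]
    have "(g \<cdot> n') \<cdot> n = zero_arr E (Dom E n) (Cod E g)"
      using comp_assoc[OF n n'h g] comp_assoc[OF t i'h g] sq * comp_zero_left[OF t HomD(5)[OF g]] by simp
    then obtain w where w: "w \<in> Hom E (Cod E c) (Cod E g)" "w \<cdot> c = g \<cdot> n'"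
      using cokernel_factor[OF d(2) gn] by blast
    have wg: "w \<cdot> c' = g"
    proof (rule eq[OF comp_closed[OF c'(1) w(1)] g])
      show "w \<cdot> c' \<cdot> n' = g \<cdot> n'" using comp_assoc[OF n'h c'(1) w(1)] c'(2) w(2) by simp
      show "w \<cdot> c' \<cdot> i' = g \<cdot> i'"
        using comp_assoc[OF i'h c'(1) w(1)] c'(3) comp_zero_right[OF w(1) HomD(5)[OF t]] * by simp
    qed
    show "\<exists>!w. w \<in> Hom E (Cod E c') (Cod E g) \<and> w \<cdot> c' = g"
    proof (rule ex1I[of _ w])
      show "w \<in> Hom E (Cod E c') (Cod E g) \<and> w \<cdot> c' = g" using w wg by simp
      fix v assume "v \<in> Hom E (Cod E c') (Cod E g) \<and> v \<cdot> c' = g"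
      then have v: "v \<in> Hom E (Cod E c) (Cod E g)" "v \<cdot> c' = g" by simp_all
      have "v \<cdot> c = w \<cdot> c" using comp_assoc[OF n'h c'(1) v(1)] v(2) c'(2) w(2) by simp
      then show "v = w" by (rule cokernel_epi[OF d(2) v(1) w(1)])
    qed
  qed
  then have "(i', c') \<in> Confl E" using i' confl_of_cokernel by (auto simp: inflation_def)
  then show ?thesis
  proof (rule that[OF _ i'h n'h c'(1) sq c'(2,3)])
    show "\<forall>S. \<forall>a\<in>Hom E ?Y S. \<forall>b\<in>Hom E T S. a \<cdot> n = b \<cdot> t \<longrightarrow>
        (\<exists>w\<in>Hom E ?D S. w \<cdot> n' = a \<and> w \<cdot> i' = b)"
      by (intro allI ballI impI, rule ex)
    show "\<forall>S. \<forall>w\<in>Hom E ?D S. \<forall>w'\<in>Hom E ?D S. w \<cdot> n' = w' \<cdot> n' \<longrightarrow> w \<cdot> i' = w' \<cdot> i' \<longrightarrow> w = w'"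
      by (intro allI ballI impI, rule eq)
  qed
qed

end

section \<open>Values of the extension along the Yoneda embedding\<close>

text \<open>Left exactness is assumed lemma by lemma in the existence half. In the uniqueness half
  the required cokernels come from the exactness of the given extension.\<close>

locale functor_of_exact_categories = E: exact_category E + C: exact_category C
  for E :: "('o, 'u, 'x) excat_scheme" and C :: "('p, 'n, 'y) excat_scheme" +
  fixes \<Phi> :: "('o, 'u, 'p, 'n) cfunctor"
  assumes additive: "additive_functor E C \<Phi>"
begin

lemma \<Phi>_Hom: "f \<in> Hom E X Y \<Longrightarrow> fmap \<Phi> f \<in> Hom C (fobj \<Phi> X) (fobj \<Phi> Y)"
  by (rule additive_functor.fmap_closed[OF additive])

lemma \<Phi>_Obj: "X \<in> Obj E \<Longrightarrow> fobj \<Phi> X \<in> Obj C"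
  by (rule additive_functor.fobj_closed[OF additive])

lemma \<Phi>_comp: "\<lbrakk>f \<in> Hom E X Y; g \<in> Hom E Y Z\<rbrakk> \<Longrightarrow> fmap \<Phi> (g \<cdot>\<^bsub>E\<^esub> f) = fmap \<Phi> g \<cdot>\<^bsub>C\<^esub> fmap \<Phi> f"
  by (rule additive_functor.fmap_comp[OF additive])

lemma \<Phi>_plus: "\<lbrakk>f \<in> Hom E X Y; g \<in> Hom E X Y\<rbrakk>
    \<Longrightarrow> fmap \<Phi> (plus_arr E f g) = plus_arr C (fmap \<Phi> f) (fmap \<Phi> g)"
  by (rule additive_functor.fmap_plus[OF additive])

lemma \<Phi>_id: "X \<in> Obj E \<Longrightarrow> fmap \<Phi> (Id E X) = Id C (fobj \<Phi> X)"
  by (rule additive_functor.fmap_id[OF additive])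

lemma \<Phi>_zero: "\<lbrakk>X \<in> Obj E; Y \<in> Obj E\<rbrakk> \<Longrightarrow> fmap \<Phi> (zero_arr E X Y) = zero_arr C (fobj \<Phi> X) (fobj \<Phi> Y)"
  by (rule C.additive_functor_zero[OF additive E.zero_closed]) (simp_all add: E.plus_zero_left[OF E.zero_closed])

lemma comp_\<Phi>_comp:
  "\<lbrakk>t \<in> Hom C (fobj \<Phi> Z) T; f \<in> Hom E X Y; g \<in> Hom E Y Z\<rbrakk>
    \<Longrightarrow> t \<cdot>\<^bsub>C\<^esub> fmap \<Phi> (g \<cdot>\<^bsub>E\<^esub> f) = (t \<cdot>\<^bsub>C\<^esub> fmap \<Phi> g) \<cdot>\<^bsub>C\<^esub> fmap \<Phi> f"
  using C.comp_assoc[OF \<Phi>_Hom \<Phi>_Hom] by (simp add: \<Phi>_comp)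

lemma comp_\<Phi>_plus:
  "\<lbrakk>t \<in> Hom C (fobj \<Phi> Y) T; f \<in> Hom E X Y; g \<in> Hom E X Y\<rbrakk>
    \<Longrightarrow> t \<cdot>\<^bsub>C\<^esub> fmap \<Phi> (plus_arr E f g) = plus_arr C (t \<cdot>\<^bsub>C\<^esub> fmap \<Phi> f) (t \<cdot>\<^bsub>C\<^esub> fmap \<Phi> g)"
  using C.comp_plus_right[OF \<Phi>_Hom \<Phi>_Hom] by (simp add: \<Phi>_plus)

text \<open>For an element \<open>y\<close> of \<open>F(Y)\<close>, the arrows \<open>u\<close> with \<open>F(u)(y) = 0\<close> form the kernel of the arrow
  \<open>\<Upsilon>(Y) \<rightarrow> F\<close> corresponding to \<open>y\<close>. A triple \<open>(Y, y, c)\<close> presents \<open>F\<close> if \<open>y\<close> generates \<open>F\<close> and \<open>c\<close> is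
  universal among the arrows out of \<open>\<Phi>(Y)\<close> annihilating \<open>\<Phi>(u)\<close> for all these \<open>u\<close>; if \<open>F\<close> is the cokernel
  of \<open>\<Upsilon>(f)\<close>, this says that \<open>c\<close> is a cokernel of \<open>\<Phi>(f)\<close>, but it does not refer to \<open>f\<close>.\<close>

definition kills :: "('o, 'u) module \<Rightarrow> 'o \<Rightarrow> 'u \<Rightarrow> 'n \<Rightarrow> 'p \<Rightarrow> bool" where
  "kills F Y y t T \<longleftrightarrow> t \<in> Hom C (fobj \<Phi> Y) T \<and>
     (\<forall>Z u. u \<in> Hom E Z Y \<longrightarrow> act F u y = \<one>\<^bsub>fobj F Z\<^esub> \<longrightarrow> t \<cdot>\<^bsub>C\<^esub> fmap \<Phi> u = zero_arr C (fobj \<Phi> Z) T)"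

fun presents :: "('o, 'u) module \<Rightarrow> 'o \<times> 'u \<times> 'n \<Rightarrow> bool" where
  "presents F (Y, y, c) \<longleftrightarrow> is_module E F \<and> Y \<in> Obj E \<and> y \<in> el F Y \<and>
     (\<forall>Z\<in>Obj E. \<forall>x\<in>el F Z. \<exists>u\<in>Hom E Z Y. act F u y = x) \<and>
     kills F Y y c (Cod C c) \<and>
     (\<forall>T t. kills F Y y t T \<longrightarrow> (\<exists>w\<in>Hom C (Cod C c) T. w \<cdot>\<^bsub>C\<^esub> c = t)) \<and>
     (\<forall>T. \<forall>w\<in>Hom C (Cod C c) T. \<forall>w'\<in>Hom C (Cod C c) T. w \<cdot>\<^bsub>C\<^esub> c = w' \<cdot>\<^bsub>C\<^esub> c \<longrightarrow> w = w')"

declare presents.simps [simp del]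

lemma killsD:
  assumes "kills F Y y t T"
  shows "t \<in> Hom C (fobj \<Phi> Y) T"
    "\<lbrakk>u \<in> Hom E Z Y; act F u y = \<one>\<^bsub>fobj F Z\<^esub>\<rbrakk> \<Longrightarrow> t \<cdot>\<^bsub>C\<^esub> fmap \<Phi> u = zero_arr C (fobj \<Phi> Z) T"
  using assms by (auto simp: kills_def)

lemma presentsD:
  assumes "presents F (Y, y, c)"
  shows "is_module E F" "Y \<in> Obj E" "y \<in> el F Y"
    "\<lbrakk>Z \<in> Obj E; x \<in> el F Z\<rbrakk> \<Longrightarrow> \<exists>u\<in>Hom E Z Y. act F u y = x"
    "kills F Y y c (Cod C c)"
    "kills F Y y t T \<Longrightarrow> \<exists>w\<in>Hom C (Cod C c) T. w \<cdot>\<^bsub>C\<^esub> c = t"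
    "\<lbrakk>w \<in> Hom C (Cod C c) T; w' \<in> Hom C (Cod C c) T; w \<cdot>\<^bsub>C\<^esub> c = w' \<cdot>\<^bsub>C\<^esub> c\<rbrakk> \<Longrightarrow> w = w'"
    "c \<in> Hom C (fobj \<Phi> Y) (Cod C c)"
  using assms killsD(1) unfolding presents.simps by (elim conjE; blast)+

section \<open>Induced arrows between values, and independence of the presentation\<close>

abbreviation val :: "'o \<times> 'u \<times> 'n \<Rightarrow> 'p" where
  "val P \<equiv> Cod C (snd (snd P))"

text \<open>Here \<phi> ranges over all lifts of \<alpha> to the generators, so that any convenient
  lift may be used when the relation is given; \<open>inducedI\<close> establishes it from a single
  lift.\<close>

fun induced :: "('o, 'u) module_arrow \<Rightarrow> 'o \<times> 'u \<times> 'n \<Rightarrow> 'o \<times> 'u \<times> 'n \<Rightarrow> 'n \<Rightarrow> bool" where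
  "induced \<alpha> (Y, y, c) (Y', y', c') w \<longleftrightarrow> w \<in> Hom C (Cod C c) (Cod C c') \<and>
     (\<forall>\<phi>\<in>Hom E Y Y'. act (tgt \<alpha>) \<phi> y' = component \<alpha> Y y \<longrightarrow> w \<cdot>\<^bsub>C\<^esub> c = c' \<cdot>\<^bsub>C\<^esub> fmap \<Phi> \<phi>)"

lemma induced_Hom: "induced \<alpha> P Q w \<Longrightarrow> w \<in> Hom C (val P) (val Q)"
  by (cases P; cases Q) auto

text \<open>The difference of the two lifts annihilates the generator \<open>y'\<close>, so
  \<open>c'\<close> annihilates its image under \<Phi>. The difference is formed by adding an
  opposite \<open>n\<close> of \<psi> to both lifts and cancelling afterwards.\<close>

lemma lifts_agree:
  assumes F: "presents F (Y', y', c')" and \<phi>: "\<phi> \<in> Hom E Y Y'" and \<psi>: "\<psi> \<in> Hom E Y Y'"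
    and eq: "act F \<phi> y' = act F \<psi> y'"
  shows "c' \<cdot>\<^bsub>C\<^esub> fmap \<Phi> \<phi> = c' \<cdot>\<^bsub>C\<^esub> fmap \<Phi> \<psi>"
proof -
  note P = presentsD[OF F]
  obtain n where n: "n \<in> Hom E Y Y'" "plus_arr E \<psi> n = zero_arr E Y Y'" using E.neg_exists[OF \<psi>] .
  note o = E.HomD(4)[OF n(1)]
  have "act F (plus_arr E \<theta> n) y' = \<one>\<^bsub>fobj F Y\<^esub>" if "\<theta> \<in> {\<phi>, \<psi>}" for \<theta>
    using act_plus[OF P(1) \<phi> n(1) P(3)] act_plus[OF P(1) \<psi> n(1) P(3)] n(2) E.act_zero[OF P(1) o P(2,3)] eq that
    by auto
  then have "c' \<cdot>\<^bsub>C\<^esub> fmap \<Phi> (plus_arr E \<theta> n) = zero_arr C (fobj \<Phi> Y) (Cod C c')" if "\<theta> \<in> {\<phi>, \<psi>}" for \<theta>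
    using killsD(2)[OF P(5) E.plus_closed[OF _ n(1)]] that \<phi> \<psi> by auto
  then show ?thesis
    using comp_\<Phi>_plus[OF P(8) \<phi> n(1)] comp_\<Phi>_plus[OF P(8) \<psi> n(1)]
      C.plus_right_cancel[OF C.comp_closed[OF \<Phi>_Hom[OF \<phi>] P(8)] C.comp_closed[OF \<Phi>_Hom[OF \<psi>] P(8)]
        C.comp_closed[OF \<Phi>_Hom[OF n(1)] P(8)]]
    by simp
qed

lemma inducedI:
  assumes "presents (tgt \<alpha>) (Y', y', c')" and "\<phi> \<in> Hom E Y Y'" "act (tgt \<alpha>) \<phi> y' = component \<alpha> Y y"
    and "w \<in> Hom C (Cod C c) (Cod C c')" "w \<cdot>\<^bsub>C\<^esub> c = c' \<cdot>\<^bsub>C\<^esub> fmap \<Phi> \<phi>"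
  shows "induced \<alpha> (Y, y, c) (Y', y', c') w"
  unfolding induced.simps
proof (intro conjI ballI impI assms(4))
  fix \<psi> assume "\<psi> \<in> Hom E Y Y'" "act (tgt \<alpha>) \<psi> y' = component \<alpha> Y y"
  then show "w \<cdot>\<^bsub>C\<^esub> c = c' \<cdot>\<^bsub>C\<^esub> fmap \<Phi> \<psi>"
    using assms(5) lifts_agree[OF assms(1,2), of \<psi>] assms(3) by simp
qed

lemma lift_exists:
  assumes \<alpha>: "\<alpha> \<in> Arr (Mod_cat E)" and P: "presents (src \<alpha>) (Y, y, c)" and Q: "presents (tgt \<alpha>) (Y', y', c')"
  obtains \<phi> where "\<phi> \<in> Hom E Y Y'" "act (tgt \<alpha>) \<phi> y' = component \<alpha> Y y"
proof -
  from presentsD(4)[OF Q presentsD(2)[OF P] component_closed[OF \<alpha> presentsD(2,3)[OF P]]]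
  show ?thesis by (elim bexE) (rule that)
qed

text \<open>If \<open>u\<close> annihilates \<open>y\<close>, then \<open>\<phi> \<cdot> u\<close>
  annihilates \<open>y'\<close>, because \<phi> lifts \<alpha>. Hence
  \<open>c' \<cdot> \<Phi>(\<phi>)\<close> annihilates \<Phi> of every relation of \<open>y\<close>
  and factors through the universal arrow \<open>c\<close>.\<close>

lemma induced_exists:
  assumes \<alpha>: "\<alpha> \<in> Arr (Mod_cat E)" and P: "presents (src \<alpha>) P" and Q: "presents (tgt \<alpha>) Q"
  obtains w where "induced \<alpha> P Q w"
proof -
  obtain Y y c where Pe: "P = (Y, y, c)" by (cases P) auto
  obtain Y' y' c' where Qe: "Q = (Y', y', c')" by (cases Q) auto
  note P = P[unfolded Pe] and Q = Q[unfolded Qe]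
  note p = presentsD[OF P] and q = presentsD[OF Q]
  obtain \<phi> where \<phi>: "\<phi> \<in> Hom E Y Y'" "act (tgt \<alpha>) \<phi> y' = component \<alpha> Y y"
    using lift_exists[OF \<alpha> P Q] .
  have "kills (src \<alpha>) Y y (c' \<cdot>\<^bsub>C\<^esub> fmap \<Phi> \<phi>) (Cod C c')"
    unfolding kills_def
  proof (intro conjI allI impI)
    show "c' \<cdot>\<^bsub>C\<^esub> fmap \<Phi> \<phi> \<in> Hom C (fobj \<Phi> Y) (Cod C c')"
      by (rule C.comp_closed[OF \<Phi>_Hom[OF \<phi>(1)] q(8)])
    fix Z u assume u: "u \<in> Hom E Z Y" and 0: "act (src \<alpha>) u y = \<one>\<^bsub>fobj (src \<alpha>) Z\<^esub>"
    have "act (tgt \<alpha>) (\<phi> \<cdot>\<^bsub>E\<^esub> u) y' = \<one>\<^bsub>fobj (tgt \<alpha>) Z\<^esub>"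
      using act_comp[OF q(1) u \<phi>(1) q(3)] \<phi>(2) component_act[OF \<alpha> E.is_category_axioms u p(3)]
        0 component_one[OF \<alpha> E.HomD(4)[OF u]] by simp
    then show "c' \<cdot>\<^bsub>C\<^esub> fmap \<Phi> \<phi> \<cdot>\<^bsub>C\<^esub> fmap \<Phi> u = zero_arr C (fobj \<Phi> Z) (Cod C c')"
      using killsD(2)[OF q(5) E.comp_closed[OF u \<phi>(1)]] comp_\<Phi>_comp[OF q(8) u \<phi>(1)] by simp
  qed
  from p(6)[OF this] obtain w where "w \<in> Hom C (Cod C c) (Cod C c')" "w \<cdot>\<^bsub>C\<^esub> c = c' \<cdot>\<^bsub>C\<^esub> fmap \<Phi> \<phi>" by (elim bexE)
  from inducedI[OF Q \<phi> this] show ?thesis by (rule that[unfolded Pe Qe])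
qed

lemma induced_unique:
  assumes \<alpha>: "\<alpha> \<in> Arr (Mod_cat E)" and P: "presents (src \<alpha>) P" and Q: "presents (tgt \<alpha>) Q"
    and "induced \<alpha> P Q w" "induced \<alpha> P Q w'"
  shows "w = w'"
proof -
  obtain Y y c where Pe: "P = (Y, y, c)" by (cases P) auto
  obtain Y' y' c' where Qe: "Q = (Y', y', c')" by (cases Q) auto
  note P = P[unfolded Pe] and Q = Q[unfolded Qe]
  obtain \<phi> where "\<phi> \<in> Hom E Y Y'" "act (tgt \<alpha>) \<phi> y' = component \<alpha> Y y"
    using lift_exists[OF \<alpha> P Q] .
  then have "w \<in> Hom C (Cod C c) (Cod C c')" "w' \<in> Hom C (Cod C c) (Cod C c')" "w \<cdot>\<^bsub>C\<^esub> c = w' \<cdot>\<^bsub>C\<^esub> c"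
    using assms(4,5) by (simp_all add: Pe Qe)
  then show ?thesis by (rule presentsD(7)[OF P])
qed

text \<open>If \<phi> lifts \<alpha> and \<psi> lifts \<beta>, then
  \<open>\<psi> \<cdot> \<phi>\<close> lifts the composite. With the uniqueness of induced arrows
  this yields functoriality of the extension and naturality of comparisons.\<close>

lemma induced_comp:
  assumes \<alpha>: "\<alpha> \<in> Arr (Mod_cat E)" and \<beta>: "\<beta> \<in> Arr (Mod_cat E)" and st: "tgt \<alpha> = src \<beta>"
    and P: "presents (src \<alpha>) P" and Q: "presents (src \<beta>) Q" and R: "presents (tgt \<beta>) R"
    and v: "induced \<alpha> P Q v" and w: "induced \<beta> Q R w"
  shows "induced (Comp (Mod_cat E) \<beta> \<alpha>) P R (w \<cdot>\<^bsub>C\<^esub> v)"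
proof -
  obtain Y y c where Pe: "P = (Y, y, c)" by (cases P) auto
  obtain Y' y' c' where Qe: "Q = (Y', y', c')" by (cases Q) auto
  obtain Y'' y'' c'' where Re: "R = (Y'', y'', c'')" by (cases R) auto
  note P = P[unfolded Pe] and Q = Q[unfolded Qe] and R = R[unfolded Re]
  note p = presentsD[OF P] and q = presentsD[OF Q] and r = presentsD[OF R]
  obtain \<phi> where \<phi>: "\<phi> \<in> Hom E Y Y'" "act (tgt \<alpha>) \<phi> y' = component \<alpha> Y y"
    using lift_exists[OF \<alpha> P Q[folded st]] .
  obtain \<psi> where \<psi>: "\<psi> \<in> Hom E Y' Y''" "act (tgt \<beta>) \<psi> y'' = component \<beta> Y' y'"
    using lift_exists[OF \<beta> Q R] .
  have vh: "v \<in> Hom C (Cod C c) (Cod C c')" "v \<cdot>\<^bsub>C\<^esub> c = c' \<cdot>\<^bsub>C\<^esub> fmap \<Phi> \<phi>"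
    and wh: "w \<in> Hom C (Cod C c') (Cod C c'')" "w \<cdot>\<^bsub>C\<^esub> c' = c'' \<cdot>\<^bsub>C\<^esub> fmap \<Phi> \<psi>"
    using v w \<phi> \<psi> by (simp_all add: Pe Qe Re)
  have tc: "tgt (Comp (Mod_cat E) \<beta> \<alpha>) = tgt \<beta>" by (simp add: Mod_cat_simps(5))
  show ?thesis unfolding Pe Re
  proof (rule inducedI[OF _ E.comp_closed[OF \<phi>(1) \<psi>(1)] _ C.comp_closed[OF vh(1) wh(1)]])
    show "presents (tgt (Comp (Mod_cat E) \<beta> \<alpha>)) (Y'', y'', c'')" using R tc by simp
    show "act (tgt (Comp (Mod_cat E) \<beta> \<alpha>)) (\<psi> \<cdot>\<^bsub>E\<^esub> \<phi>) y'' = component (Comp (Mod_cat E) \<beta> \<alpha>) Y y"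
      using Comp_Mod_cat_closed(2)[OF E.is_category_axioms \<alpha> \<beta> st p(2,3)] act_comp[OF r(1) \<phi>(1) \<psi>(1) r(3)]
        \<psi>(2) component_act[OF \<beta> E.is_category_axioms \<phi>(1) q(3)] \<phi>(2) st tc by simp
    show "w \<cdot>\<^bsub>C\<^esub> v \<cdot>\<^bsub>C\<^esub> c = c'' \<cdot>\<^bsub>C\<^esub> fmap \<Phi> (\<psi> \<cdot>\<^bsub>E\<^esub> \<phi>)"
      using C.comp_assoc[OF p(8) vh(1) wh(1)] vh(2) wh(2) C.comp_assoc[OF \<Phi>_Hom[OF \<phi>(1)] q(8) wh(1)]
        comp_\<Phi>_comp[OF r(8) \<phi>(1) \<psi>(1)] by simp
  qed
qed

lemma induced_id:
  assumes P: "presents F P"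
  shows "induced (Id (Mod_cat E) F) P P (Id C (val P))"
proof -
  obtain Y y c where Pe: "P = (Y, y, c)" by (cases P) auto
  note P = P[unfolded Pe]
  note p = presentsD[OF P]
  have t: "tgt (Id (Mod_cat E) F) = F" by (simp add: Mod_cat_simps(4))
  have "induced (Id (Mod_cat E) F) (Y, y, c) (Y, y, c) (Id C (Cod C c))"
  proof (rule inducedI[OF _ E.id_closed[OF p(2)] _ C.id_closed[OF C.HomD(5)[OF p(8)]]])
    show "presents (tgt (Id (Mod_cat E) F)) (Y, y, c)" using P t by simp
    show "act (tgt (Id (Mod_cat E) F)) (Id E Y) y = component (Id (Mod_cat E) F) Y y"
      using act_id[OF p(1-3)] Id_Mod_cat_closed(2)[OF E.is_category_axioms p(1-3)] t by simp
    show "Id C (Cod C c) \<cdot>\<^bsub>C\<^esub> c = c \<cdot>\<^bsub>C\<^esub> fmap \<Phi> (Id E Y)"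
      using C.comp_id_left[OF p(8)] C.comp_id_right[OF p(8)] \<Phi>_id[OF p(2)] by simp
  qed
  then show ?thesis by (simp add: Pe)
qed

lemma induced_plus:
  assumes \<alpha>: "\<alpha> \<in> Arr (Mod_cat E)" and \<beta>: "\<beta> \<in> Arr (Mod_cat E)" and st: "src \<alpha> = src \<beta>" "tgt \<alpha> = tgt \<beta>"
    and P: "presents (src \<alpha>) P" and Q: "presents (tgt \<alpha>) Q"
    and v: "induced \<alpha> P Q v" and w: "induced \<beta> P Q w"
  shows "induced (plus_arr (Mod_cat E) \<alpha> \<beta>) P Q (plus_arr C v w)"
proof -
  obtain Y y c where Pe: "P = (Y, y, c)" by (cases P) auto
  obtain Y' y' c' where Qe: "Q = (Y', y', c')" by (cases Q) auto
  note P = P[unfolded Pe] and Q = Q[unfolded Qe]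
  note p = presentsD[OF P] and q = presentsD[OF Q]
  obtain \<phi> where \<phi>: "\<phi> \<in> Hom E Y Y'" "act (tgt \<alpha>) \<phi> y' = component \<alpha> Y y"
    using lift_exists[OF \<alpha> P Q] .
  obtain \<psi> where \<psi>: "\<psi> \<in> Hom E Y Y'" "act (tgt \<beta>) \<psi> y' = component \<beta> Y y"
    using lift_exists[OF \<beta> P[unfolded st] Q[unfolded st]] .
  have vh: "v \<in> Hom C (Cod C c) (Cod C c')" "v \<cdot>\<^bsub>C\<^esub> c = c' \<cdot>\<^bsub>C\<^esub> fmap \<Phi> \<phi>"
    and wh: "w \<in> Hom C (Cod C c) (Cod C c')" "w \<cdot>\<^bsub>C\<^esub> c = c' \<cdot>\<^bsub>C\<^esub> fmap \<Phi> \<psi>"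
    using v w \<phi> \<psi> by (simp_all add: Pe Qe)
  have tp: "tgt (plus_arr (Mod_cat E) \<alpha> \<beta>) = tgt \<alpha>" by (simp add: Mod_cat_simps(6))
  show ?thesis unfolding Pe Qe
  proof (rule inducedI[OF _ E.plus_closed[OF \<phi>(1) \<psi>(1)] _ C.plus_closed[OF vh(1) wh(1)]])
    show "presents (tgt (plus_arr (Mod_cat E) \<alpha> \<beta>)) (Y', y', c')" using Q tp by simp
    show "act (tgt (plus_arr (Mod_cat E) \<alpha> \<beta>)) (plus_arr E \<phi> \<psi>) y' = component (plus_arr (Mod_cat E) \<alpha> \<beta>) Y y"
      using plus_Mod_cat_closed(2)[OF E.is_category_axioms \<alpha> \<beta> st p(2,3)]
        act_plus[OF q(1) \<phi>(1) \<psi>(1) q(3)] \<phi>(2) \<psi>(2)[folded st(2)] tp by simp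
    show "plus_arr C v w \<cdot>\<^bsub>C\<^esub> c = c' \<cdot>\<^bsub>C\<^esub> fmap \<Phi> (plus_arr E \<phi> \<psi>)"
      using C.comp_plus_left[OF p(8) vh(1) wh(1)] vh(2) wh(2) comp_\<Phi>_plus[OF q(8) \<phi>(1) \<psi>(1)] by simp
  qed
qed

text \<open>Both composites of the two arrows induced by the identity of \<open>F\<close> are again
  induced by that identity, so uniqueness turns them into identities. This compares the horseshoe
  with the chosen presentations, and two extensions with each other.\<close>

lemma presents_iso:
  assumes P: "presents F P" and Q: "presents F Q"
  obtains s where "induced (Id (Mod_cat E) F) P Q s" "iso_arr C s"
proof -
  have F: "is_module E F" using P by (cases P) (simp add: presents.simps)
  note i = Id_Mod_cat_closed[OF E.is_category_axioms F]
  have st [simp]: "src (Id (Mod_cat E) F) = F" "tgt (Id (Mod_cat E) F) = F"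
    by (simp_all add: Mod_cat_simps(4))
  have ii: "Comp (Mod_cat E) (Id (Mod_cat E) F) (Id (Mod_cat E) F) = Id (Mod_cat E) F"
    using Comp_Id_Mod_cat(1)[OF E.is_category_axioms i(1)] by simp
  have PP: "presents (src (Id (Mod_cat E) F)) P" "presents (tgt (Id (Mod_cat E) F)) P"
    and QQ: "presents (src (Id (Mod_cat E) F)) Q" "presents (tgt (Id (Mod_cat E) F)) Q" using P Q by simp_all
  obtain s where s: "induced (Id (Mod_cat E) F) P Q s" using induced_exists[OF i(1) PP(1) QQ(2)] .
  obtain r where r: "induced (Id (Mod_cat E) F) Q P r" using induced_exists[OF i(1) QQ(1) PP(2)] .
  have "r \<cdot>\<^bsub>C\<^esub> s = Id C (val P)"
    using induced_comp[OF i(1) i(1) _ PP(1) QQ(1) PP(2) s r] induced_id[OF P]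
      induced_unique[OF i(1) PP] ii by simp
  moreover have "s \<cdot>\<^bsub>C\<^esub> r = Id C (val Q)"
    using induced_comp[OF i(1) i(1) _ QQ(1) PP(1) QQ(2) r s] induced_id[OF Q]
      induced_unique[OF i(1) QQ] ii by simp
  ultimately have "iso_arr C s" by (rule C.iso_arrI[OF induced_Hom[OF s] induced_Hom[OF r]])
  then show ?thesis using that s by blast
qed

text \<open>By the Yoneda lemma \<pi> sends \<open>u\<close> to the action of \<open>u\<close> on
  the image \<open>y\<close> of the identity. Surjectivity of \<pi> then says that \<open>y\<close>
  generates, and exactness at \<Upsilon>(Y) that the relations of \<open>y\<close> are the arrows
  factoring through \<open>f\<close>.\<close>

lemma right_exact_seq_yoneda:
  assumes f: "f \<in> Hom E X Y" and \<pi>: "right_exact_seq E (yoneda_arr E f) \<pi>"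
  defines "y \<equiv> component \<pi> Y (Id E Y)"
  shows "y \<in> el (tgt \<pi>) Y" "u \<in> Hom E Z Y \<Longrightarrow> component \<pi> Z u = act (tgt \<pi>) u y"
    "\<lbrakk>Z \<in> Obj E; x \<in> el (tgt \<pi>) Z\<rbrakk> \<Longrightarrow> \<exists>u\<in>Hom E Z Y. act (tgt \<pi>) u y = x"
    "u \<in> Hom E Z Y \<Longrightarrow> act (tgt \<pi>) u y = \<one>\<^bsub>fobj (tgt \<pi>) Z\<^esub> \<longleftrightarrow> (\<exists>v\<in>Hom E Z X. u = f \<cdot>\<^bsub>E\<^esub> v)"
    "is_module E (tgt \<pi>)"
proof -
  have \<pi>a: "\<pi> \<in> Arr (Mod_cat E)" and s: "src \<pi> = yoneda_obj E Y"
    using \<pi> E.HomD[OF f] by (auto simp: right_exact_seq_def)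
  note Y = E.HomD(5)[OF f]
  show "is_module E (tgt \<pi>)" using \<pi>a by (simp add: Arr_Mod_cat)
  show "y \<in> el (tgt \<pi>) Y" unfolding y_def
    by (rule component_closed[OF \<pi>a Y]) (simp add: s Y E.id_closed)
  show *: "component \<pi> Z u = act (tgt \<pi>) u y" if "u \<in> Hom E Z Y" for u Z
    unfolding y_def by (rule E.yoneda_lemma[OF \<pi>a s that])
  show "\<exists>u\<in>Hom E Z Y. act (tgt \<pi>) u y = x" if Z: "Z \<in> Obj E" and x: "x \<in> el (tgt \<pi>) Z"
  proof -
    have "component \<pi> Z ` el (src \<pi>) Z = el (tgt \<pi>) Z" using \<pi> Z by (simp add: right_exact_seq_def)
    then have "x \<in> component \<pi> Z ` Hom E Z Y" using x Z by (simp add: s)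
    then show ?thesis using * by auto
  qed
  show "act (tgt \<pi>) u y = \<one>\<^bsub>fobj (tgt \<pi>) Z\<^esub> \<longleftrightarrow> (\<exists>v\<in>Hom E Z X. u = f \<cdot>\<^bsub>E\<^esub> v)" if u: "u \<in> Hom E Z Y"
  proof -
    note Z = E.HomD(4)[OF u]
    have "component (yoneda_arr E f) Z ` el (src (yoneda_arr E f)) Z
        = kernel (fobj (src \<pi>) Z) (fobj (tgt \<pi>) Z) (component \<pi> Z)"
      using \<pi> Z by (simp add: right_exact_seq_def)
    then have "u \<in> component (yoneda_arr E f) Z ` Hom E Z X \<longleftrightarrow> component \<pi> Z u = \<one>\<^bsub>fobj (tgt \<pi>) Z\<^esub>"
      using u Z E.HomD(2)[OF f] by (simp add: kernel_def s)
    moreover have "component (yoneda_arr E f) Z ` Hom E Z X = (\<lambda>v. f \<cdot>\<^bsub>E\<^esub> v) ` Hom E Z X"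
      using E.component_yoneda_arr[of _ Z f] E.HomD(2)[OF f] by simp
    ultimately show ?thesis using *[OF u] by auto
  qed
qed

text \<open>Every relation of the generator factors through \<open>f\<close>, and \<open>f\<close>
  itself is a relation. So annihilating \<Phi> of all relations means annihilating \<Phi>(f), and
  the two universal properties coincide.\<close>

lemma presents_of_cokernel:
  assumes f: "f \<in> Hom E X Y" and \<pi>: "right_exact_seq E (yoneda_arr E f) \<pi>" and c: "is_cokernel C c (fmap \<Phi> f)"
  shows "presents (tgt \<pi>) (Y, component \<pi> Y (Id E Y), c)"
proof -
  note r = right_exact_seq_yoneda[OF f \<pi>] and f' = \<Phi>_Hom[OF f]
  note d = C.cokernelD[OF c, unfolded C.HomD(2,3)[OF f']]
  have 1: "kills (tgt \<pi>) Y (component \<pi> Y (Id E Y)) c (Cod C c)"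
    unfolding kills_def
  proof (intro conjI allI impI)
    fix Z u assume u: "u \<in> Hom E Z Y" and 0: "act (tgt \<pi>) u (component \<pi> Y (Id E Y)) = \<one>\<^bsub>fobj (tgt \<pi>) Z\<^esub>"
    then obtain v where v: "v \<in> Hom E Z X" "u = f \<cdot>\<^bsub>E\<^esub> v" using r(4) by blast
    show "c \<cdot>\<^bsub>C\<^esub> fmap \<Phi> u = zero_arr C (fobj \<Phi> Z) (Cod C c)"
      using comp_\<Phi>_comp[OF d(1) v(1) f] d(3) C.comp_zero_left[OF \<Phi>_Hom[OF v(1)] C.HomD(5)[OF d(1)]] v(2) by simp
  qed (rule d(1))
  have 2: "\<exists>w\<in>Hom C (Cod C c) T. w \<cdot>\<^bsub>C\<^esub> c = t" if t: "kills (tgt \<pi>) Y (component \<pi> Y (Id E Y)) t T" for t T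
  proof -
    have "act (tgt \<pi>) f (component \<pi> Y (Id E Y)) = \<one>\<^bsub>fobj (tgt \<pi>) X\<^esub>"
      using r(4)[OF f] E.comp_id_right[OF f] E.id_closed[OF E.HomD(4)[OF f]] by metis
    then have "t \<cdot>\<^bsub>C\<^esub> fmap \<Phi> f = zero_arr C (fobj \<Phi> X) T" by (rule killsD(2)[OF t f])
    then show ?thesis using C.cokernel_factor[OF c] killsD(1)[OF t] C.HomD(2,3)[OF f'] by simp
  qed
  show ?thesis
    unfolding presents.simps using r(1,3,5) 1 2 C.cokernel_epi[OF c] E.HomD(5)[OF f]
    by (intro conjI allI ballI impI) auto
qed

end

section \<open>The extension of a left exact functor\<close>

context functor_of_exact_categories
begin

text \<open>The data for the middle term of a short exact sequence are built on \<open>Y\<^sub>1 \<oplus> Y\<^sub>2\<close> as in the horseshoe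
  lemma. If \<open>h\<close> lifts the action of \<open>f\<^sub>2\<close> on a preimage of the generator of \<open>H\<close>, then \<open>c\<^sub>1 \<cdot> \<Phi>(h)\<close> factors
  as \<open>t \<cdot> q\<close> through the deflation part of \<open>\<Phi>(f\<^sub>2) = n \<cdot> q\<close>, and the value at the middle term is the
  pushout of the inflation \<open>n\<close> along \<open>t\<close>; its conflation is the required one.\<close>

lemma horseshoe:
  assumes ses: "short_exact_seq E \<alpha> \<beta>" and P1: "presents (src \<alpha>) (Y1, y1, c1)"
    and f2: "f2 \<in> Hom E X2 Y2" and \<pi>: "right_exact_seq E (yoneda_arr E f2) \<pi>" and tgt\<pi>: "tgt \<pi> = tgt \<beta>"
    and k: "k \<in> Hom E K X2" and f2k: "f2 \<cdot>\<^bsub>E\<^esub> k = zero_arr E K Y2"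
    and kq: "(fmap \<Phi> k, q) \<in> Confl C" and n: "inflation C n" and qn: "Cod C q = Dom C n"
    and nq: "fmap \<Phi> f2 = n \<cdot>\<^bsub>C\<^esub> q"
  obtains Q P2 i' c' where "presents (src \<beta>) Q" "presents (tgt \<beta>) P2"
    "induced \<alpha> (Y1, y1, c1) Q i'" "induced \<beta> Q P2 c'" "(i', c') \<in> Confl C"
proof -
  note catE = E.is_category_axioms
  have \<alpha>: "\<alpha> \<in> Arr (Mod_cat E)" and \<beta>: "\<beta> \<in> Arr (Mod_cat E)" and st: "tgt \<alpha> = src \<beta>"
    and \<alpha>inj: "\<And>Z. Z \<in> Obj E \<Longrightarrow> inj_on (component \<alpha> Z) (el (src \<alpha>) Z)"
    and \<alpha>im: "\<And>Z. Z \<in> Obj E \<Longrightarrow> component \<alpha> Z ` el (src \<alpha>) Z = kernel (fobj (src \<beta>) Z) (fobj (tgt \<beta>) Z) (component \<beta> Z)"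
    and \<beta>im: "\<And>Z. Z \<in> Obj E \<Longrightarrow> component \<beta> Z ` el (src \<beta>) Z = el (tgt \<beta>) Z"
    using ses by (auto simp: short_exact_seq_def right_exact_seq_def)
  let ?F = "src \<alpha>" and ?G = "src \<beta>" and ?H = "tgt \<beta>"
  define y2 where "y2 = component \<pi> Y2 (Id E Y2)"
  note H = right_exact_seq_yoneda[OF f2 \<pi>, folded y2_def, unfolded tgt\<pi>]
  have F: "is_module E ?F" and G: "is_module E ?G" using \<alpha> \<beta> by (simp_all add: Arr_Mod_cat)
  have \<alpha>eq: "x = x'" if "Z \<in> Obj E" "x \<in> el ?F Z" "x' \<in> el ?F Z" "component \<alpha> Z x = component \<alpha> Z x'" for Z x x'
    using \<alpha>inj[OF that(1)] that by (simp add: inj_on_def)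
  have \<alpha>G: "component \<alpha> Z x \<in> el ?G Z" if "Z \<in> Obj E" "x \<in> el ?F Z" for Z x
    using component_closed[OF \<alpha> that] st by simp
  have \<beta>\<alpha>: "component \<beta> Z (component \<alpha> Z x) = \<one>\<^bsub>fobj ?H Z\<^esub>" if "Z \<in> Obj E" "x \<in> el ?F Z" for Z x
  proof -
    have "component \<alpha> Z x \<in> kernel (fobj ?G Z) (fobj ?H Z) (component \<beta> Z)" using \<alpha>im[OF that(1)] that(2) by blast
    then show ?thesis by (simp add: kernel_def)
  qed
  have exact: "\<exists>x\<in>el ?F Z. z = component \<alpha> Z x"
    if Z: "Z \<in> Obj E" and z: "z \<in> el ?G Z" "component \<beta> Z z = \<one>\<^bsub>fobj ?H Z\<^esub>" for Z z
  proof -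
    have "z \<in> kernel (fobj ?G Z) (fobj ?H Z) (component \<beta> Z)" using z by (simp add: kernel_def)
    then show ?thesis using \<alpha>im[OF Z] by blast
  qed
  have \<alpha>act: "component \<alpha> Z (act ?F u x) = act ?G u (component \<alpha> W x)" if "u \<in> Hom E Z W" "x \<in> el ?F W" for u Z W x
    using component_act[OF \<alpha> catE that] st by simp
  note \<beta>act = component_act[OF \<beta> catE]
  note p1 = presentsD[OF P1]
  note oY1 = p1(2) and oX2 = E.HomD(4)[OF f2] and oY2 = E.HomD(5)[OF f2] and oK = E.HomD(4)[OF k]

  have "y2 \<in> component \<beta> Y2 ` el ?G Y2" unfolding \<beta>im[OF oY2] by (rule H(1))
  then obtain yt where yt: "yt \<in> el ?G Y2" "component \<beta> Y2 yt = y2" by auto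
  define z1 where "z1 = component \<alpha> Y1 y1"
  have z1: "z1 \<in> el ?G Y1" unfolding z1_def by (rule \<alpha>G[OF oY1 p1(3)])
  have f2yt: "act ?G f2 yt \<in> el ?G X2" by (rule act_closed[OF G f2 yt(1)])
  \<comment> \<open>As \<open>f2\<close> factors through itself, it annihilates \<open>y2\<close>.
    So the action of \<open>f2\<close> on the preimage \<open>yt\<close> lies in the kernel of
    \<beta> and comes from an element of the first term.\<close>
  have "\<exists>v\<in>Hom E X2 X2. f2 = f2 \<cdot>\<^bsub>E\<^esub> v"
    by (rule bexI[OF _ E.id_closed[OF oX2]]) (simp add: E.comp_id_right[OF f2])
  then have "component \<beta> X2 (act ?G f2 yt) = \<one>\<^bsub>fobj ?H X2\<^esub>"
    using \<beta>act[OF f2 yt(1)] yt(2) H(4)[OF f2] by simp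
  from exact[OF oX2 f2yt this] obtain x where x: "x \<in> el ?F X2" "act ?G f2 yt = component \<alpha> X2 x" by auto
  obtain h where h: "h \<in> Hom E X2 Y1" "act ?F h y1 = x" using p1(4)[OF oX2 x(1)] by auto
  have hz1: "act ?G h z1 = act ?G f2 yt"
    using \<alpha>act[OF h(1) p1(3)] h(2) x(2) by (simp add: z1_def)

  note dkq = C.conflD[OF kq]
  have qh: "q \<in> Hom C (fobj \<Phi> X2) (Dom C n)"
    using dkq(4,5) qn C.HomD(3)[OF \<Phi>_Hom[OF k]] by simp
  have nh: "n \<in> Hom C (Dom C n) (fobj \<Phi> Y2)"
  proof -
    have "n \<cdot>\<^bsub>C\<^esub> q \<in> Hom C (fobj \<Phi> X2) (Cod C n)" by (rule C.comp_closed[OF qh C.inflation_closed[OF n]])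
    then have "Cod C n = fobj \<Phi> Y2" using \<Phi>_Hom[OF f2] C.HomD(3) unfolding nq by metis
    then show ?thesis using C.inflation_closed[OF n] by simp
  qed
  have qdef: "deflation C q" using kq by (auto simp: deflation_def)

  have c1h: "c1 \<cdot>\<^bsub>C\<^esub> fmap \<Phi> h \<in> Hom C (fobj \<Phi> X2) (Cod C c1)" by (rule C.comp_closed[OF \<Phi>_Hom[OF h(1)] p1(8)])
  \<comment> \<open>As \<open>q\<close> is a cokernel of \<Phi>(k), the factorization of
    \<open>c1 \<cdot> \<Phi>(h)\<close> through \<open>q\<close> follows once
    \<open>h \<cdot> k\<close> is a relation of \<open>y1\<close>. This can be tested after the
    injective \<alpha>, where \<open>h \<cdot> k\<close> acts on \<open>z1\<close> as
    \<open>f2 \<cdot> k = 0\<close> acts on \<open>yt\<close>.\<close>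
  have "act ?F (h \<cdot>\<^bsub>E\<^esub> k) y1 = \<one>\<^bsub>fobj ?F K\<^esub>"
  proof (rule \<alpha>eq[OF oK])
    note hk = E.comp_closed[OF k h(1)]
    interpret F: comm_group "fobj ?F K" by (rule module_group[OF F oK])
    show "act ?F (h \<cdot>\<^bsub>E\<^esub> k) y1 \<in> el ?F K" by (rule act_closed[OF F hk p1(3)])
    show "\<one>\<^bsub>fobj ?F K\<^esub> \<in> el ?F K" by simp
    have "component \<alpha> K (act ?F (h \<cdot>\<^bsub>E\<^esub> k) y1) = act ?G k (act ?G h z1)"
      using \<alpha>act[OF hk p1(3)] act_comp[OF G k h(1) z1] by (simp add: z1_def)
    also have "\<dots> = act ?G (f2 \<cdot>\<^bsub>E\<^esub> k) yt" using act_comp[OF G k f2 yt(1)] hz1 by simp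
    also have "\<dots> = \<one>\<^bsub>fobj ?G K\<^esub>" using E.act_zero[OF G oK oY2 yt(1)] f2k by simp
    finally show "component \<alpha> K (act ?F (h \<cdot>\<^bsub>E\<^esub> k) y1) = component \<alpha> K \<one>\<^bsub>fobj ?F K\<^esub>"
      using component_one[OF \<alpha> oK] st by simp
  qed
  then have "c1 \<cdot>\<^bsub>C\<^esub> fmap \<Phi> (h \<cdot>\<^bsub>E\<^esub> k) = zero_arr C (fobj \<Phi> K) (Cod C c1)"
    by (rule killsD(2)[OF p1(5) E.comp_closed[OF k h(1)]])
  then have "c1 \<cdot>\<^bsub>C\<^esub> fmap \<Phi> h \<cdot>\<^bsub>C\<^esub> fmap \<Phi> k = zero_arr C (fobj \<Phi> K) (Cod C c1)"
    using comp_\<Phi>_comp[OF p1(8) k h(1)] by simp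
  then obtain t where t: "t \<in> Hom C (Dom C n) (Cod C c1)" "t \<cdot>\<^bsub>C\<^esub> q = c1 \<cdot>\<^bsub>C\<^esub> fmap \<Phi> h"
    using C.cokernel_factor[OF dkq(2)] c1h C.HomD(2,3)[OF \<Phi>_Hom[OF k]] qn by auto

  obtain c2 where nc2: "(n, c2) \<in> Confl C" using n by (auto simp: inflation_def)
  have "is_cokernel C c2 (fmap \<Phi> f2)" unfolding nq by (rule C.cokernel_comp_deflation[OF nc2 qdef qn])
  from presents_of_cokernel[OF f2 \<pi> this] have P2: "presents ?H (Y2, y2, c2)" by (simp add: y2_def tgt\<pi>)
  note p2 = presentsD[OF P2]
  have codn: "Cod C n = fobj \<Phi> Y2" by (rule C.HomD(3)[OF nh])
  obtain i' c' n' where i'c': "(i', c') \<in> Confl C" and i': "i' \<in> Hom C (Cod C c1) (Cod C i')"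
    and n': "n' \<in> Hom C (fobj \<Phi> Y2) (Cod C i')" and c': "c' \<in> Hom C (Cod C i') (Cod C c2)"
    and sq: "n' \<cdot>\<^bsub>C\<^esub> n = i' \<cdot>\<^bsub>C\<^esub> t" and c'n': "c' \<cdot>\<^bsub>C\<^esub> n' = c2" and c'i': "c' \<cdot>\<^bsub>C\<^esub> i' = zero_arr C (Cod C c1) (Cod C c2)"
    and po_ex: "\<forall>S. \<forall>a\<in>Hom C (fobj \<Phi> Y2) S. \<forall>b\<in>Hom C (Cod C c1) S. a \<cdot>\<^bsub>C\<^esub> n = b \<cdot>\<^bsub>C\<^esub> t \<longrightarrow>
      (\<exists>w\<in>Hom C (Cod C i') S. w \<cdot>\<^bsub>C\<^esub> n' = a \<and> w \<cdot>\<^bsub>C\<^esub> i' = b)"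
    and po_eq: "\<forall>S. \<forall>w\<in>Hom C (Cod C i') S. \<forall>w'\<in>Hom C (Cod C i') S.
      w \<cdot>\<^bsub>C\<^esub> n' = w' \<cdot>\<^bsub>C\<^esub> n' \<longrightarrow> w \<cdot>\<^bsub>C\<^esub> i' = w' \<cdot>\<^bsub>C\<^esub> i' \<longrightarrow> w = w'"
    using C.pushout_confl[OF nc2 t(1), unfolded codn] .
  let ?D = "Cod C i'"

  obtain B i1 i2 r1 r2 where bip: "biproduct E Y1 Y2 B i1 i2 r1 r2" using E.has_biproducts[OF oY1 oY2] by auto
  then have i1: "i1 \<in> Hom E Y1 B" and i2: "i2 \<in> Hom E Y2 B" and r1: "r1 \<in> Hom E B Y1" and r2: "r2 \<in> Hom E B Y2"
    and r1i1: "r1 \<cdot>\<^bsub>E\<^esub> i1 = Id E Y1" and r2i2: "r2 \<cdot>\<^bsub>E\<^esub> i2 = Id E Y2"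
    and r1i2: "r1 \<cdot>\<^bsub>E\<^esub> i2 = zero_arr E Y2 Y1" and r2i1: "r2 \<cdot>\<^bsub>E\<^esub> i1 = zero_arr E Y1 Y2"
    and sum: "plus_arr E (i1 \<cdot>\<^bsub>E\<^esub> r1) (i2 \<cdot>\<^bsub>E\<^esub> r2) = Id E B"
    by (simp_all add: biproduct_def)
  note oB = E.HomD(5)[OF i1]
  \<comment> \<open>On the two summands of \<open>B\<close> the generator \<open>y\<close> has the
    components \<open>z1\<close> and \<open>yt\<close>, and the arrow \<open>c\<close> has the
    components \<open>i' \<cdot> c1\<close> and \<open>n'\<close>.\<close>
  define y where "y = act ?G r1 z1 \<otimes>\<^bsub>fobj ?G B\<^esub> act ?G r2 yt"
  define c where "c = plus_arr C (i' \<cdot>\<^bsub>C\<^esub> c1 \<cdot>\<^bsub>C\<^esub> fmap \<Phi> r1) (n' \<cdot>\<^bsub>C\<^esub> fmap \<Phi> r2)"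
  note i'c1 = C.comp_closed[OF p1(8) i']
  have cs: "i' \<cdot>\<^bsub>C\<^esub> c1 \<cdot>\<^bsub>C\<^esub> fmap \<Phi> r1 \<in> Hom C (fobj \<Phi> B) ?D" "n' \<cdot>\<^bsub>C\<^esub> fmap \<Phi> r2 \<in> Hom C (fobj \<Phi> B) ?D"
    by (rule C.comp_closed[OF \<Phi>_Hom[OF r1] i'c1], rule C.comp_closed[OF \<Phi>_Hom[OF r2] n'])
  have ch: "c \<in> Hom C (fobj \<Phi> B) ?D" unfolding c_def by (rule C.plus_closed[OF cs])
  have codc: "Cod C c = ?D" by (rule C.HomD(3)[OF ch])
  have Ggrp: "comm_group (fobj ?G Z)" if "Z \<in> Obj E" for Z by (rule module_group[OF G that])
  have ys: "act ?G r1 z1 \<in> el ?G B" "act ?G r2 yt \<in> el ?G B"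
    by (rule act_closed[OF G r1 z1], rule act_closed[OF G r2 yt(1)])
  have y: "y \<in> el ?G B"
    unfolding y_def using Ggrp[OF oB] ys by (simp add: comm_groupE(1))
  have act_y: "act ?G u y = act ?G (r1 \<cdot>\<^bsub>E\<^esub> u) z1 \<otimes>\<^bsub>fobj ?G Z\<^esub> act ?G (r2 \<cdot>\<^bsub>E\<^esub> u) yt" if u: "u \<in> Hom E Z B" for u Z
    unfolding y_def using act_mult[OF G u ys] act_comp[OF G u r1 z1] act_comp[OF G u r2 yt(1)] by simp
  have c_\<Phi>: "c \<cdot>\<^bsub>C\<^esub> fmap \<Phi> u = plus_arr C (i' \<cdot>\<^bsub>C\<^esub> (c1 \<cdot>\<^bsub>C\<^esub> fmap \<Phi> (r1 \<cdot>\<^bsub>E\<^esub> u))) (n' \<cdot>\<^bsub>C\<^esub> fmap \<Phi> (r2 \<cdot>\<^bsub>E\<^esub> u))"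
    if u: "u \<in> Hom E Z B" for u Z
    unfolding c_def
    using C.comp_plus_left[OF \<Phi>_Hom[OF u] cs] comp_\<Phi>_comp[OF i'c1 u r1] comp_\<Phi>_comp[OF n' u r2]
      C.comp_assoc[OF \<Phi>_Hom[OF E.comp_closed[OF u r1]] p1(8) i'] by simp
  have ru: "r1 \<cdot>\<^bsub>E\<^esub> u \<in> Hom E Z Y1" "r2 \<cdot>\<^bsub>E\<^esub> u \<in> Hom E Z Y2" if "u \<in> Hom E Z B" for u Z
    using E.comp_closed[OF that r1] E.comp_closed[OF that r2] .
  have comb: "plus_arr E (i1 \<cdot>\<^bsub>E\<^esub> a) (i2 \<cdot>\<^bsub>E\<^esub> b) \<in> Hom E Z B"
    "r1 \<cdot>\<^bsub>E\<^esub> plus_arr E (i1 \<cdot>\<^bsub>E\<^esub> a) (i2 \<cdot>\<^bsub>E\<^esub> b) = a" "r2 \<cdot>\<^bsub>E\<^esub> plus_arr E (i1 \<cdot>\<^bsub>E\<^esub> a) (i2 \<cdot>\<^bsub>E\<^esub> b) = b"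
    if a: "a \<in> Hom E Z Y1" and b: "b \<in> Hom E Z Y2" for a b Z
  proof -
    note ia = E.comp_closed[OF a i1] and ib = E.comp_closed[OF b i2]
    show "plus_arr E (i1 \<cdot>\<^bsub>E\<^esub> a) (i2 \<cdot>\<^bsub>E\<^esub> b) \<in> Hom E Z B" by (rule E.plus_closed[OF ia ib])
    show "r1 \<cdot>\<^bsub>E\<^esub> plus_arr E (i1 \<cdot>\<^bsub>E\<^esub> a) (i2 \<cdot>\<^bsub>E\<^esub> b) = a"
      using E.comp_plus_right[OF ia ib r1] E.comp_assoc[OF a i1 r1] E.comp_assoc[OF b i2 r1] r1i1 r1i2
        E.comp_id_left[OF a] E.comp_zero_left[OF b oY1] E.plus_zero_right[OF a] by simp
    show "r2 \<cdot>\<^bsub>E\<^esub> plus_arr E (i1 \<cdot>\<^bsub>E\<^esub> a) (i2 \<cdot>\<^bsub>E\<^esub> b) = b"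
      using E.comp_plus_right[OF ia ib r2] E.comp_assoc[OF a i1 r2] E.comp_assoc[OF b i2 r2] r2i1 r2i2
        E.comp_id_left[OF b] E.comp_zero_left[OF a oY2] E.plus_zero_left[OF b] by simp
  qed
  have i1a: "act ?G (r1 \<cdot>\<^bsub>E\<^esub> (i1 \<cdot>\<^bsub>E\<^esub> a)) z1 \<otimes>\<^bsub>fobj ?G Z\<^esub> act ?G (r2 \<cdot>\<^bsub>E\<^esub> (i1 \<cdot>\<^bsub>E\<^esub> a)) yt = act ?G a z1"
    if a: "a \<in> Hom E Z Y1" for a Z
  proof -
    note Z = E.HomD(4)[OF a]
    interpret comm_group "fobj ?G Z" by (rule Ggrp[OF Z])
    show ?thesis
      using E.comp_assoc[OF a i1 r1] E.comp_assoc[OF a i1 r2] r1i1 r2i1 E.comp_id_left[OF a]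
        E.comp_zero_left[OF a oY2] E.act_zero[OF G Z oY2 yt(1)] act_closed[OF G a z1] by simp
  qed

  have Q: "presents ?G (B, y, c)"
    unfolding presents.simps codc
  proof (intro conjI G oB y ballI allI impI)
    fix Z x assume Z: "Z \<in> Obj E" and x: "x \<in> el ?G Z"
    interpret G: comm_group "fobj ?G Z" by (rule Ggrp[OF Z])
    interpret H: comm_group "fobj ?H Z" by (rule module_group[OF H(5) Z])
    interpret b: group_hom "fobj ?G Z" "fobj ?H Z" "component \<beta> Z"
      by unfold_locales (rule component_hom[OF \<beta> Z])
    obtain v where v: "v \<in> Hom E Z Y2" "act ?H v y2 = component \<beta> Z x"
      using H(3)[OF Z component_closed[OF \<beta> Z x]] by auto
    let ?v = "act ?G v yt"
    have vG: "?v \<in> el ?G Z" by (rule act_closed[OF G v(1) yt(1)])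
    have "component \<beta> Z ?v = component \<beta> Z x" using \<beta>act[OF v(1) yt(1)] yt(2) v(2) by simp
    \<comment> \<open>Subtracting a multiple of \<open>yt\<close> with the same image under \<beta>
      moves \<open>x\<close> into the image of \<alpha>, where multiples of \<open>z1\<close>
      suffice.\<close>
    then have "component \<beta> Z (x \<otimes>\<^bsub>fobj ?G Z\<^esub> inv\<^bsub>fobj ?G Z\<^esub> ?v) = \<one>\<^bsub>fobj ?H Z\<^esub>"
      using x vG by simp
    from exact[OF Z _ this] obtain w where w: "w \<in> el ?F Z" "x \<otimes>\<^bsub>fobj ?G Z\<^esub> inv\<^bsub>fobj ?G Z\<^esub> ?v = component \<alpha> Z w"
      using x vG by auto
    obtain a where a: "a \<in> Hom E Z Y1" "act ?F a y1 = w" using p1(4)[OF Z w(1)] by auto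
    have "act ?G a z1 = x \<otimes>\<^bsub>fobj ?G Z\<^esub> inv\<^bsub>fobj ?G Z\<^esub> ?v"
      using \<alpha>act[OF a(1) p1(3)] a(2) w(2) by (simp add: z1_def)
    then have "act ?G a z1 \<otimes>\<^bsub>fobj ?G Z\<^esub> ?v = x" using x vG by (simp add: G.m_assoc)
    then show "\<exists>u\<in>Hom E Z B. act ?G u y = x"
      using comb[OF a(1) v(1)] act_y[OF comb(1)[OF a(1) v(1)]] by auto
  next
    show "kills ?G B y c ?D" unfolding kills_def
    proof (intro conjI ch allI impI)
      fix Z u assume u: "u \<in> Hom E Z B" and 0: "act ?G u y = \<one>\<^bsub>fobj ?G Z\<^esub>"
      let ?a = "r1 \<cdot>\<^bsub>E\<^esub> u" and ?b = "r2 \<cdot>\<^bsub>E\<^esub> u"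
      note a = ru(1)[OF u] and b = ru(2)[OF u] and Z = E.HomD(4)[OF u]
      interpret G: comm_group "fobj ?G Z" by (rule Ggrp[OF Z])
      interpret H: comm_group "fobj ?H Z" by (rule module_group[OF H(5) Z])
      interpret F: comm_group "fobj ?F Z" by (rule module_group[OF F Z])
      have ab: "act ?G ?a z1 \<in> el ?G Z" "act ?G ?b yt \<in> el ?G Z"
        by (rule act_closed[OF G a z1], rule act_closed[OF G b yt(1)])
      have "component \<beta> Z (act ?G ?a z1) = \<one>\<^bsub>fobj ?H Z\<^esub>"
        using \<beta>\<alpha>[OF Z act_closed[OF F a p1(3)]] \<alpha>act[OF a p1(3)] by (simp add: z1_def)
      moreover have "component \<beta> Z (act ?G ?a z1 \<otimes>\<^bsub>fobj ?G Z\<^esub> act ?G ?b yt) = \<one>\<^bsub>fobj ?H Z\<^esub>"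
        using 0 act_y[OF u] component_one[OF \<beta> Z] by simp
      moreover have "component \<beta> Z (act ?G ?b yt) = act ?H ?b y2" using \<beta>act[OF b yt(1)] yt(2) by simp
      ultimately have "act ?H ?b y2 = \<one>\<^bsub>fobj ?H Z\<^esub>"
        using component_mult[OF \<beta> Z ab] act_closed[OF H(5) b H(1)] by simp
      then obtain v where v: "v \<in> Hom E Z X2" "?b = f2 \<cdot>\<^bsub>E\<^esub> v" using H(4)[OF b] by auto
      note hv = E.comp_closed[OF v(1) h(1)]
      \<comment> \<open>The relation of \<open>y\<close> has components \<open>?a\<close> and
        \<open>?b = f2 \<cdot> v\<close>, and \<open>?b\<close> acts on \<open>yt\<close> as
        \<open>h \<cdot> v\<close> acts on \<open>z1\<close>. So \<open>?a + h \<cdot> v\<close>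
        annihilates \<open>z1\<close> and, by injectivity of \<alpha>, also
        \<open>y1\<close>.\<close>
      let ?s = "plus_arr E ?a (h \<cdot>\<^bsub>E\<^esub> v)"
      have s: "?s \<in> Hom E Z Y1" by (rule E.plus_closed[OF a hv])
      have "act ?G ?b yt = act ?G (h \<cdot>\<^bsub>E\<^esub> v) z1"
        using act_comp[OF G v(1) f2 yt(1)] act_comp[OF G v(1) h(1) z1] hz1 v(2) by simp
      then have "act ?G ?s z1 = \<one>\<^bsub>fobj ?G Z\<^esub>"
        using act_plus[OF G a hv z1] 0 act_y[OF u] by simp
      then have "component \<alpha> Z (act ?F ?s y1) = component \<alpha> Z \<one>\<^bsub>fobj ?F Z\<^esub>"
        using \<alpha>act[OF s p1(3)] component_one[OF \<alpha> Z] st by (simp add: z1_def)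
      then have "act ?F ?s y1 = \<one>\<^bsub>fobj ?F Z\<^esub>"
        by (rule \<alpha>eq[OF Z act_closed[OF F s p1(3)] F.one_closed])
      then have c1s: "c1 \<cdot>\<^bsub>C\<^esub> fmap \<Phi> ?s = zero_arr C (fobj \<Phi> Z) (Cod C c1)" by (rule killsD(2)[OF p1(5) s])
      have \<Phi>v: "fmap \<Phi> v \<in> Hom C (fobj \<Phi> Z) (fobj \<Phi> X2)" by (rule \<Phi>_Hom[OF v(1)])
      \<comment> \<open>The second component is carried across the pushout square: \<open>n' \<cdot>
        n \<cdot> q = i' \<cdot> t \<cdot> q = i' \<cdot> c1 \<cdot> \<Phi>(h)\<close>. Both
        components then combine to \<open>i' \<cdot> c1 \<cdot> \<Phi>(?s)\<close>, which
        vanishes.\<close>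
      have "n' \<cdot>\<^bsub>C\<^esub> fmap \<Phi> ?b = n' \<cdot>\<^bsub>C\<^esub> n \<cdot>\<^bsub>C\<^esub> q \<cdot>\<^bsub>C\<^esub> fmap \<Phi> v"
        using comp_\<Phi>_comp[OF n' v(1) f2] C.comp_assoc[OF qh nh n'] nq v(2) by simp
      also have "\<dots> = i' \<cdot>\<^bsub>C\<^esub> (t \<cdot>\<^bsub>C\<^esub> q) \<cdot>\<^bsub>C\<^esub> fmap \<Phi> v"
        using C.comp_assoc[OF qh t(1) i'] sq by simp
      also have "\<dots> = i' \<cdot>\<^bsub>C\<^esub> (c1 \<cdot>\<^bsub>C\<^esub> fmap \<Phi> (h \<cdot>\<^bsub>E\<^esub> v))"
        using C.comp_assoc[OF \<Phi>v c1h i'] t(2) comp_\<Phi>_comp[OF p1(8) v(1) h(1)] by simp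
      finally have "c \<cdot>\<^bsub>C\<^esub> fmap \<Phi> u
          = plus_arr C (i' \<cdot>\<^bsub>C\<^esub> (c1 \<cdot>\<^bsub>C\<^esub> fmap \<Phi> ?a)) (i' \<cdot>\<^bsub>C\<^esub> (c1 \<cdot>\<^bsub>C\<^esub> fmap \<Phi> (h \<cdot>\<^bsub>E\<^esub> v)))"
        using c_\<Phi>[OF u] by simp
      also have "\<dots> = i' \<cdot>\<^bsub>C\<^esub> (c1 \<cdot>\<^bsub>C\<^esub> fmap \<Phi> ?s)"
        using C.comp_plus_right[OF C.comp_closed[OF \<Phi>_Hom[OF a] p1(8)] C.comp_closed[OF \<Phi>_Hom[OF hv] p1(8)] i']
          comp_\<Phi>_plus[OF p1(8) a hv] by simp
      also have "\<dots> = zero_arr C (fobj \<Phi> Z) ?D"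
        using c1s C.comp_zero_right[OF i' \<Phi>_Obj[OF Z]] by simp
      finally show "c \<cdot>\<^bsub>C\<^esub> fmap \<Phi> u = zero_arr C (fobj \<Phi> Z) ?D" .
    qed
  next
    fix T e assume e: "kills ?G B y e T"
    note eh = killsD(1)[OF e]
    let ?A = "e \<cdot>\<^bsub>C\<^esub> fmap \<Phi> i1" and ?B = "e \<cdot>\<^bsub>C\<^esub> fmap \<Phi> i2"
    have A: "?A \<in> Hom C (fobj \<Phi> Y1) T" and Bh: "?B \<in> Hom C (fobj \<Phi> Y2) T"
      by (rule C.comp_closed[OF \<Phi>_Hom[OF i1] eh], rule C.comp_closed[OF \<Phi>_Hom[OF i2] eh])
    note oT = C.HomD(5)[OF eh]
    have "kills ?F Y1 y1 ?A T" unfolding kills_def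
    proof (intro conjI A allI impI)
      fix Z u assume u: "u \<in> Hom E Z Y1" and 0: "act ?F u y1 = \<one>\<^bsub>fobj ?F Z\<^esub>"
      note iu = E.comp_closed[OF u i1] and Z = E.HomD(4)[OF u]
      have "act ?G (i1 \<cdot>\<^bsub>E\<^esub> u) y = \<one>\<^bsub>fobj ?G Z\<^esub>"
        using act_y[OF iu] i1a[OF u] \<alpha>act[OF u p1(3)] 0 component_one[OF \<alpha> Z] st by (simp add: z1_def)
      then show "?A \<cdot>\<^bsub>C\<^esub> fmap \<Phi> u = zero_arr C (fobj \<Phi> Z) T"
        using killsD(2)[OF e iu] comp_\<Phi>_comp[OF eh u i1] by simp
    qed
    from p1(6)[OF this] obtain a' where a': "a' \<in> Hom C (Cod C c1) T" "a' \<cdot>\<^bsub>C\<^esub> c1 = ?A" by (elim bexE)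
    \<comment> \<open>With \<open>m = -h\<close>, the arrow with components \<open>m\<close> and
      \<open>f2\<close> is a relation of \<open>y\<close>, since \<open>h\<close> acts on
      \<open>z1\<close> as \<open>f2\<close> acts on \<open>yt\<close>. An arrow \<open>e\<close>
      that kills all relations therefore has components with
      \<open>?B \<cdot> \<Phi>(f2) = ?A \<cdot> \<Phi>(h)\<close>.\<close>
    obtain m where m: "m \<in> Hom E X2 Y1" "plus_arr E h m = zero_arr E X2 Y1" using E.neg_exists[OF h(1)] .
    note u = comb[OF m(1) f2]
    interpret GX: comm_group "fobj ?G X2" by (rule Ggrp[OF oX2])
    have "act ?G (plus_arr E (i1 \<cdot>\<^bsub>E\<^esub> m) (i2 \<cdot>\<^bsub>E\<^esub> f2)) y = act ?G m z1 \<otimes>\<^bsub>fobj ?G X2\<^esub> act ?G h z1"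
      using act_y[OF u(1)] u(2,3) hz1 by simp
    also have "\<dots> = act ?G (plus_arr E h m) z1"
      using act_plus[OF G h(1) m(1) z1] act_closed[OF G h(1) z1] act_closed[OF G m(1) z1] by (simp add: GX.m_comm)
    also have "\<dots> = \<one>\<^bsub>fobj ?G X2\<^esub>" using m(2) E.act_zero[OF G oX2 oY1 z1] by simp
    finally have "e \<cdot>\<^bsub>C\<^esub> fmap \<Phi> (plus_arr E (i1 \<cdot>\<^bsub>E\<^esub> m) (i2 \<cdot>\<^bsub>E\<^esub> f2)) = zero_arr C (fobj \<Phi> X2) T"
      by (rule killsD(2)[OF e u(1)])
    then have 1: "plus_arr C (?A \<cdot>\<^bsub>C\<^esub> fmap \<Phi> m) (?B \<cdot>\<^bsub>C\<^esub> fmap \<Phi> f2) = zero_arr C (fobj \<Phi> X2) T"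
      using comp_\<Phi>_plus[OF eh E.comp_closed[OF m(1) i1] E.comp_closed[OF f2 i2]]
        comp_\<Phi>_comp[OF eh m(1) i1] comp_\<Phi>_comp[OF eh f2 i2] by simp
    have 2: "plus_arr C (?A \<cdot>\<^bsub>C\<^esub> fmap \<Phi> h) (?A \<cdot>\<^bsub>C\<^esub> fmap \<Phi> m) = zero_arr C (fobj \<Phi> X2) T"
      using comp_\<Phi>_plus[OF A h(1) m(1)] m(2) \<Phi>_zero[OF oX2 oY1] C.comp_zero_right[OF A \<Phi>_Obj[OF oX2]] by simp
    note Am = C.comp_closed[OF \<Phi>_Hom[OF m(1)] A] and Ah = C.comp_closed[OF \<Phi>_Hom[OF h(1)] A]
      and Bf = C.comp_closed[OF \<Phi>_Hom[OF f2] Bh]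
    have BA: "?B \<cdot>\<^bsub>C\<^esub> fmap \<Phi> f2 = ?A \<cdot>\<^bsub>C\<^esub> fmap \<Phi> h"
      by (rule C.plus_right_cancel[OF Bf Ah Am]) (simp add: C.plus_comm[OF Bf Am] 1 2)
    \<comment> \<open>The compatibility demanded by the pushout holds after composition with
      \<open>q\<close>, by the previous equation and the choice of \<open>t\<close>; the epic
      \<open>q\<close> is then cancelled.\<close>
    have "?B \<cdot>\<^bsub>C\<^esub> n = a' \<cdot>\<^bsub>C\<^esub> t"
    proof (rule C.deflation_epi[OF qdef])
      show "?B \<cdot>\<^bsub>C\<^esub> n \<in> Hom C (Cod C q) T" "a' \<cdot>\<^bsub>C\<^esub> t \<in> Hom C (Cod C q) T"
        unfolding qn by (rule C.comp_closed[OF nh Bh], rule C.comp_closed[OF t(1) a'(1)])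
      have "?B \<cdot>\<^bsub>C\<^esub> n \<cdot>\<^bsub>C\<^esub> q = ?A \<cdot>\<^bsub>C\<^esub> fmap \<Phi> h" using C.comp_assoc[OF qh nh Bh] BA nq by simp
      also have "\<dots> = a' \<cdot>\<^bsub>C\<^esub> (c1 \<cdot>\<^bsub>C\<^esub> fmap \<Phi> h)" using C.comp_assoc[OF \<Phi>_Hom[OF h(1)] p1(8) a'(1)] a'(2) by simp
      also have "\<dots> = a' \<cdot>\<^bsub>C\<^esub> t \<cdot>\<^bsub>C\<^esub> q" using C.comp_assoc[OF qh t(1) a'(1)] t(2) by simp
      finally show "?B \<cdot>\<^bsub>C\<^esub> n \<cdot>\<^bsub>C\<^esub> q = a' \<cdot>\<^bsub>C\<^esub> t \<cdot>\<^bsub>C\<^esub> q" .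
    qed
    from po_ex[rule_format, OF Bh a'(1) this] obtain w where w: "w \<in> Hom C ?D T" "w \<cdot>\<^bsub>C\<^esub> n' = ?B" "w \<cdot>\<^bsub>C\<^esub> i' = a'" by auto
    have "w \<cdot>\<^bsub>C\<^esub> (i' \<cdot>\<^bsub>C\<^esub> c1 \<cdot>\<^bsub>C\<^esub> fmap \<Phi> r1) = e \<cdot>\<^bsub>C\<^esub> fmap \<Phi> (i1 \<cdot>\<^bsub>E\<^esub> r1)"
      using C.comp_assoc[OF \<Phi>_Hom[OF r1] i'c1 w(1)] C.comp_assoc[OF p1(8) i' w(1)] w(3) a'(2)
        comp_\<Phi>_comp[OF eh r1 i1] by simp
    moreover have "w \<cdot>\<^bsub>C\<^esub> (n' \<cdot>\<^bsub>C\<^esub> fmap \<Phi> r2) = e \<cdot>\<^bsub>C\<^esub> fmap \<Phi> (i2 \<cdot>\<^bsub>E\<^esub> r2)"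
      using C.comp_assoc[OF \<Phi>_Hom[OF r2] n' w(1)] w(2) comp_\<Phi>_comp[OF eh r2 i2] by simp
    ultimately have "w \<cdot>\<^bsub>C\<^esub> c = e \<cdot>\<^bsub>C\<^esub> fmap \<Phi> (Id E B)"
      unfolding c_def using C.comp_plus_right[OF cs w(1)]
        comp_\<Phi>_plus[OF eh E.comp_closed[OF r1 i1] E.comp_closed[OF r2 i2]] sum by simp
    then have "w \<cdot>\<^bsub>C\<^esub> c = e" using \<Phi>_id[OF oB] C.comp_id_right[OF eh] by simp
    then show "\<exists>w\<in>Hom C ?D T. w \<cdot>\<^bsub>C\<^esub> c = e" using w(1) by auto
  next
    fix T w w' assume w: "w \<in> Hom C ?D T" and w': "w' \<in> Hom C ?D T" and eq: "w \<cdot>\<^bsub>C\<^esub> c = w' \<cdot>\<^bsub>C\<^esub> c"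
    \<comment> \<open>Restriction of \<open>c\<close> to the two summands gives
      \<open>i' \<cdot> c1\<close> and \<open>n'\<close>. Cancelling \<open>c1\<close> leaves
      agreement on both legs of the pushout.\<close>
    have ci: "c \<cdot>\<^bsub>C\<^esub> fmap \<Phi> i1 = i' \<cdot>\<^bsub>C\<^esub> c1"
      using c_\<Phi>[OF i1] r1i1 r2i1 \<Phi>_id[OF oY1] \<Phi>_zero[OF oY1 oY2] C.comp_id_right[OF p1(8)]
        C.comp_zero_right[OF n' \<Phi>_Obj[OF oY1]] C.plus_zero_right[OF i'c1] by simp
    have cn: "c \<cdot>\<^bsub>C\<^esub> fmap \<Phi> i2 = n'"
      using c_\<Phi>[OF i2] r1i2 r2i2 \<Phi>_id[OF oY2] \<Phi>_zero[OF oY2 oY1] C.comp_id_right[OF n']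
        C.comp_zero_right[OF p1(8) \<Phi>_Obj[OF oY2]] C.comp_zero_right[OF i' \<Phi>_Obj[OF oY2]] C.plus_zero_left[OF n'] by simp
    show "w = w'"
    proof (rule po_eq[rule_format, OF w w'])
      show "w \<cdot>\<^bsub>C\<^esub> n' = w' \<cdot>\<^bsub>C\<^esub> n'"
        using C.comp_assoc[OF \<Phi>_Hom[OF i2] ch w] C.comp_assoc[OF \<Phi>_Hom[OF i2] ch w'] cn eq by simp
      have "w \<cdot>\<^bsub>C\<^esub> i' \<cdot>\<^bsub>C\<^esub> c1 = w' \<cdot>\<^bsub>C\<^esub> i' \<cdot>\<^bsub>C\<^esub> c1"
        using C.comp_assoc[OF \<Phi>_Hom[OF i1] ch w] C.comp_assoc[OF \<Phi>_Hom[OF i1] ch w'] ci eq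
          C.comp_assoc[OF p1(8) i' w] C.comp_assoc[OF p1(8) i' w'] by simp
      then show "w \<cdot>\<^bsub>C\<^esub> i' = w' \<cdot>\<^bsub>C\<^esub> i'"
        by (rule p1(7)[OF C.comp_closed[OF i' w] C.comp_closed[OF i' w']])
    qed
  qed
  have I1: "induced \<alpha> (Y1, y1, c1) (B, y, c) i'"
  proof (rule inducedI[OF Q[folded st] i1])
    interpret comm_group "fobj ?G Y1" by (rule Ggrp[OF oY1])
    show "act (tgt \<alpha>) i1 y = component \<alpha> Y1 y1"
      using act_y[OF i1] r1i1 r2i1 act_id[OF G oY1 z1] E.act_zero[OF G oY1 oY2 yt(1)] z1 st by (simp add: z1_def)
    show "i' \<in> Hom C (Cod C c1) (Cod C c)" using i' codc by simp
    show "i' \<cdot>\<^bsub>C\<^esub> c1 = c \<cdot>\<^bsub>C\<^esub> fmap \<Phi> i1"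
      using c_\<Phi>[OF i1] r1i1 r2i1 \<Phi>_id[OF oY1] \<Phi>_zero[OF oY1 oY2] C.comp_id_right[OF p1(8)]
        C.comp_zero_right[OF n' \<Phi>_Obj[OF oY1]] C.plus_zero_right[OF i'c1] by simp
  qed
  have I2: "induced \<beta> (B, y, c) (Y2, y2, c2) c'"
  proof (rule inducedI[OF P2 r2])
    interpret H: comm_group "fobj ?H B" by (rule module_group[OF H(5) oB])
    have "component \<beta> B y = component \<beta> B (act ?G r1 z1) \<otimes>\<^bsub>fobj ?H B\<^esub> act ?H r2 y2"
      unfolding y_def using component_mult[OF \<beta> oB ys] \<beta>act[OF r2 yt(1)] yt(2) by simp
    also have "component \<beta> B (act ?G r1 z1) = \<one>\<^bsub>fobj ?H B\<^esub>"
      using \<beta>\<alpha>[OF oB act_closed[OF F r1 p1(3)]] \<alpha>act[OF r1 p1(3)] by (simp add: z1_def)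
    finally show "act ?H r2 y2 = component \<beta> B y" using act_closed[OF H(5) r2 H(1)] by simp
    show "c' \<in> Hom C (Cod C c) (Cod C c2)" using c' codc by simp
    have "c' \<cdot>\<^bsub>C\<^esub> (i' \<cdot>\<^bsub>C\<^esub> c1 \<cdot>\<^bsub>C\<^esub> fmap \<Phi> r1) = zero_arr C (fobj \<Phi> B) (Cod C c2)"
      using C.comp_assoc[OF \<Phi>_Hom[OF r1] i'c1 c'] C.comp_assoc[OF p1(8) i' c'] c'i'
        C.comp_zero_left[OF p1(8) C.HomD(5)[OF c']] C.comp_zero_left[OF \<Phi>_Hom[OF r1] C.HomD(5)[OF c']] by simp
    then show "c' \<cdot>\<^bsub>C\<^esub> c = c2 \<cdot>\<^bsub>C\<^esub> fmap \<Phi> r2"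
      unfolding c_def using C.comp_plus_right[OF cs c'] C.comp_assoc[OF \<Phi>_Hom[OF r2] n' c'] c'n'
        C.plus_zero_left[OF C.comp_closed[OF \<Phi>_Hom[OF r2] p2(8)]] by simp
  qed
  show ?thesis by (rule that[OF Q P2 I1 I2 i'c'])
qed

end

section \<open>Existence and uniqueness of the exact extension\<close>

context functor_of_exact_categories
begin

text \<open>Left exactness makes \<Phi>(p) an admissible arrow \<open>i \<cdot> q\<close> with
  kernel \<Phi>(k), although not necessarily a deflation. As \<open>i\<close> is monic, \<Phi>(k) is
  also a kernel of \<open>q\<close>, which gives the conflation. The leftover inflation
  \<open>i\<close> is absorbed into \<open>n = \<Phi>(m) \<cdot> i\<close>, an inflation because
  \<Phi>(m) is one.\<close>

lemma left_exact_factorization: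
  assumes left_exact: "left_exact_functor E C \<Phi>"
    and kp: "(k, p) \<in> Confl E" and m: "inflation E m" and pm: "Cod E p = Dom E m"
  obtains q n where "(fmap \<Phi> k, q) \<in> Confl C" "inflation C n" "Cod C q = Dom C n"
    "fmap \<Phi> (m \<cdot>\<^bsub>E\<^esub> p) = n \<cdot>\<^bsub>C\<^esub> q"
proof -
  note d = E.conflD[OF kp]
  have ph: "p \<in> Hom E (Dom E p) (Dom E m)" and mh: "m \<in> Hom E (Dom E m) (Cod E m)"
    using d(4) pm E.inflation_closed[OF m] by simp_all
  have "\<forall>(f, g)\<in>Confl E. admissible C (fmap \<Phi> g) \<and> inflation C (fmap \<Phi> f) \<and> is_kernel C (fmap \<Phi> f) (fmap \<Phi> g)"
    using left_exact by (simp add: left_exact_functor_def)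
  note le = bspec[OF this, simplified split_paired_all, unfolded prod.case]
  obtain q i where q: "deflation C q" and i: "inflation C i" and qi: "Cod C q = Dom C i" and \<Phi>p: "fmap \<Phi> p = i \<cdot>\<^bsub>C\<^esub> q"
    using le[OF kp] by (auto simp: admissible_def)
  have ker: "is_kernel C (fmap \<Phi> k) (fmap \<Phi> p)" using le[OF kp] by simp
  have \<Phi>m: "inflation C (fmap \<Phi> m)" using m le unfolding inflation_def by blast
  have qh: "q \<in> Hom C (fobj \<Phi> (Dom E p)) (Dom C i)" and ih: "i \<in> Hom C (Dom C i) (fobj \<Phi> (Dom E m))"
  proof -
    have "i \<cdot>\<^bsub>C\<^esub> q \<in> Hom C (Dom C q) (Cod C i)"
      using C.comp_closed[OF _ C.inflation_closed[OF i]] C.deflation_closed[OF q] qi by simp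
    then have "Dom C q = fobj \<Phi> (Dom E p)" "Cod C i = fobj \<Phi> (Dom E m)"
      using C.HomD(2,3)[OF \<Phi>_Hom[OF ph]] C.HomD(2,3) \<Phi>p by metis+
    then show "q \<in> Hom C (fobj \<Phi> (Dom E p)) (Dom C i)" "i \<in> Hom C (Dom C i) (fobj \<Phi> (Dom E m))"
      using C.inflation_closed[OF i] C.deflation_closed[OF q] qi by simp_all
  qed
  note kd = C.kernelD[OF ker]
  note \<Phi>p_DC = C.HomD(2,3)[OF \<Phi>_Hom[OF ph]]
  have ker0: "i \<cdot>\<^bsub>C\<^esub> q \<cdot>\<^bsub>C\<^esub> h = zero_arr C W (fobj \<Phi> (Dom E m)) \<longleftrightarrow> q \<cdot>\<^bsub>C\<^esub> h = zero_arr C W (Dom C i)"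
    if h: "h \<in> Hom C W (fobj \<Phi> (Dom E p))" for h W
  proof -
    note W = C.HomD(4)[OF h]
    have "i \<cdot>\<^bsub>C\<^esub> q \<cdot>\<^bsub>C\<^esub> h = zero_arr C W (fobj \<Phi> (Dom E m)) \<longleftrightarrow> i \<cdot>\<^bsub>C\<^esub> (q \<cdot>\<^bsub>C\<^esub> h) = i \<cdot>\<^bsub>C\<^esub> zero_arr C W (Dom C i)"
      using C.comp_assoc[OF h qh ih] C.comp_zero_right[OF ih W] by simp
    also have "\<dots> \<longleftrightarrow> q \<cdot>\<^bsub>C\<^esub> h = zero_arr C W (Dom C i)"
      using C.inflation_mono[OF i C.comp_closed[OF h qh] C.zero_closed[OF W C.HomD(4)[OF ih]]] by auto
    finally show ?thesis .
  qed
  have kh: "fmap \<Phi> k \<in> Hom C (Dom C (fmap \<Phi> k)) (fobj \<Phi> (Dom E p))" using kd(1) \<Phi>p_DC by simp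
  have "is_kernel C (fmap \<Phi> k) q" unfolding is_kernel_def
  proof (intro conjI ballI impI)
    note [simp] = C.HomD(2,3)[OF qh] C.HomD(3)[OF kh]
    show "fmap \<Phi> k \<in> Arr C" "q \<in> Arr C" "Cod C (fmap \<Phi> k) = Dom C q"
      using C.HomD(1)[OF kh] C.HomD(1)[OF qh] by simp_all
    show "q \<cdot>\<^bsub>C\<^esub> fmap \<Phi> k = zero_arr C (Dom C (fmap \<Phi> k)) (Cod C q)"
      using ker0[OF kh] kd(3) \<Phi>p_DC by (simp add: \<Phi>p)
    fix h assume "h \<in> Arr C" and *: "Cod C h = Dom C q \<and> q \<cdot>\<^bsub>C\<^esub> h = zero_arr C (Dom C h) (Cod C q)"
    then have h: "h \<in> Hom C (Dom C h) (fobj \<Phi> (Dom E p))" by (simp add: Hom_def)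
    have "fmap \<Phi> p \<cdot>\<^bsub>C\<^esub> h = zero_arr C (Dom C h) (Cod C (fmap \<Phi> p))"
      using ker0[OF h] * \<Phi>p_DC by (simp add: \<Phi>p)
    then show "\<exists>!u. u \<in> Hom C (Dom C h) (Dom C (fmap \<Phi> k)) \<and> fmap \<Phi> k \<cdot>\<^bsub>C\<^esub> u = h"
      using kd(4)[of h "Dom C h"] h \<Phi>p_DC by simp
  qed
  then have "(fmap \<Phi> k, q) \<in> Confl C" using q C.confl_of_kernel by (auto simp: deflation_def)
  moreover have "inflation C (fmap \<Phi> m \<cdot>\<^bsub>C\<^esub> i)"
    by (rule C.inflation_comp[OF i \<Phi>m]) (simp add: C.HomD(3)[OF ih] C.HomD(2)[OF \<Phi>_Hom[OF mh]])
  moreover have "Cod C q = Dom C (fmap \<Phi> m \<cdot>\<^bsub>C\<^esub> i)"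
    using qi C.HomD(2)[OF C.comp_closed[OF ih \<Phi>_Hom[OF mh]]] by simp
  moreover have "fmap \<Phi> (m \<cdot>\<^bsub>E\<^esub> p) = fmap \<Phi> m \<cdot>\<^bsub>C\<^esub> i \<cdot>\<^bsub>C\<^esub> q"
    using \<Phi>_comp[OF ph mh] \<Phi>p C.comp_assoc[OF qh ih \<Phi>_Hom[OF mh]] by simp
  ultimately show ?thesis by (rule that)
qed

text \<open>This gathers the data that \<open>horseshoe\<close> requires of the quotient
  term.\<close>

lemma adm_presentation:
  assumes "left_exact_functor E C \<Phi>" and "adm_presented E F"
  obtains f X Y \<pi> k K q n where "f \<in> Hom E X Y" "right_exact_seq E (yoneda_arr E f) \<pi>" "tgt \<pi> = F"
    "k \<in> Hom E K X" "f \<cdot>\<^bsub>E\<^esub> k = zero_arr E K Y" "(fmap \<Phi> k, q) \<in> Confl C" "inflation C n"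
    "Cod C q = Dom C n" "fmap \<Phi> f = n \<cdot>\<^bsub>C\<^esub> q"
proof -
  obtain f \<pi> where f: "admissible E f" and \<pi>: "tgt \<pi> = F" "right_exact_seq E (yoneda_arr E f) \<pi>"
    using assms(2) by (auto simp: adm_presented_def)
  obtain p m where "deflation E p" and m: "inflation E m" and pm: "Cod E p = Dom E m" and mp: "f = m \<cdot>\<^bsub>E\<^esub> p"
    using f by (auto simp: admissible_def)
  then obtain k where kp: "(k, p) \<in> Confl E" by (auto simp: deflation_def)
  note d = E.conflD[OF kp]
  have ph: "p \<in> Hom E (Dom E p) (Dom E m)" and mh: "m \<in> Hom E (Dom E m) (Cod E m)"
    and kh: "k \<in> Hom E (Dom E k) (Dom E p)"
    using d pm E.inflation_closed[OF m] by simp_all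
  obtain q n where qn: "(fmap \<Phi> k, q) \<in> Confl C" "inflation C n" "Cod C q = Dom C n" "fmap \<Phi> f = n \<cdot>\<^bsub>C\<^esub> q"
    using left_exact_factorization[OF assms(1) kp m pm] unfolding mp .
  have "f \<cdot>\<^bsub>E\<^esub> k = zero_arr E (Dom E k) (Cod E m)"
    using E.comp_assoc[OF kh ph mh] E.kernelD(3)[OF d(1)] pm E.comp_zero_right[OF mh E.HomD(4)[OF kh]]
    by (simp add: mp)
  with E.comp_closed[OF ph mh] show ?thesis using that[OF _ \<pi>(2,1) kh _ qn] unfolding mp by blast
qed

lemma presents_exists:
  assumes "left_exact_functor E C \<Phi>" "adm_presented E F"
  obtains P where "presents F P"
proof -
  obtain f X Y \<pi> k K q n where f: "f \<in> Hom E X Y" and \<pi>: "right_exact_seq E (yoneda_arr E f) \<pi>" "tgt \<pi> = F"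
    and q: "(fmap \<Phi> k, q) \<in> Confl C" and n: "inflation C n" and qn: "Cod C q = Dom C n" and nq: "fmap \<Phi> f = n \<cdot>\<^bsub>C\<^esub> q"
    using adm_presentation[OF assms] .
  obtain c where nc: "(n, c) \<in> Confl C" using n by (auto simp: inflation_def)
  have "deflation C q" using q by (auto simp: deflation_def)
  then have "is_cokernel C c (fmap \<Phi> f)" unfolding nq by (rule C.cokernel_comp_deflation[OF nc _ qn])
  from presents_of_cokernel[OF f \<pi>(1) this] show ?thesis using that \<pi>(2) by auto
qed

text \<open>Only a zero arrow annihilates the generator \<open>Id E X\<close>, and \<Phi> preserves
  zero arrows, so every arrow out of \<Phi>(X) kills its relations and the identity is universal.
  The value is thus \<Phi>(X) itself, not merely an isomorphic object.\<close>

lemma presents_yoneda_obj: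
  assumes X: "X \<in> Obj E"
  shows "presents (yoneda_obj E X) (X, Id E X, Id C (fobj \<Phi> X))"
proof -
  have i: "Id C (fobj \<Phi> X) \<in> Hom C (fobj \<Phi> X) (fobj \<Phi> X)" by (rule C.id_closed[OF \<Phi>_Obj[OF X]])
  have act: "act (yoneda_obj E X) u (Id E X) = u" if "u \<in> Hom E Z X" for u Z
    using E.act_yoneda_obj[OF that E.id_closed[OF X]] E.comp_id_left[OF that] by simp
  note [simp] = C.HomD(3)[OF i]
  show ?thesis
    unfolding presents.simps
  proof (intro conjI X E.is_module_yoneda_obj ballI allI impI)
    show "Id E X \<in> el (yoneda_obj E X) X" using X E.id_closed by simp
    show "\<exists>u\<in>Hom E Z X. act (yoneda_obj E X) u (Id E X) = x" if "Z \<in> Obj E" "x \<in> el (yoneda_obj E X) Z" for Z x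
      using act[of x Z] that by auto
    show "kills (yoneda_obj E X) X (Id E X) (Id C (fobj \<Phi> X)) (Cod C (Id C (fobj \<Phi> X)))"
      unfolding kills_def
    proof (intro conjI allI impI)
      fix Z u assume u: "u \<in> Hom E Z X" and "act (yoneda_obj E X) u (Id E X) = \<one>\<^bsub>fobj (yoneda_obj E X) Z\<^esub>"
      then have "u = zero_arr E Z X" using act[OF u] E.HomD(4)[OF u] by simp
      then show "Id C (fobj \<Phi> X) \<cdot>\<^bsub>C\<^esub> fmap \<Phi> u = zero_arr C (fobj \<Phi> Z) (Cod C (Id C (fobj \<Phi> X)))"
        using C.comp_id_left[OF \<Phi>_Hom[OF u]] \<Phi>_zero[OF E.HomD(4)[OF u] X] by simp
    qed (simp add: i)
    fix T t assume "kills (yoneda_obj E X) X (Id E X) t T"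
    note t = killsD(1)[OF this]
    show "\<exists>w\<in>Hom C (Cod C (Id C (fobj \<Phi> X))) T. w \<cdot>\<^bsub>C\<^esub> Id C (fobj \<Phi> X) = t"
      using t C.comp_id_right[OF t] by auto
  next
    fix T w w' assume w: "w \<in> Hom C (Cod C (Id C (fobj \<Phi> X))) T" and w': "w' \<in> Hom C (Cod C (Id C (fobj \<Phi> X))) T"
      and eq: "w \<cdot>\<^bsub>C\<^esub> Id C (fobj \<Phi> X) = w' \<cdot>\<^bsub>C\<^esub> Id C (fobj \<Phi> X)"
    show "w = w'" using C.comp_id_right[OF w] C.comp_id_right[OF w'] eq by simp
  qed
qed

text \<open>Once \<open>P\<close> selects presentations, the arrow picked here exists and is unique
  by \<open>induced_exists\<close> and \<open>induced_unique\<close>. \<open>P\<close> stays a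
  parameter because its values at representable modules decide whether the extension restricts to
  \<Phi> strictly.\<close>

definition extension :: "(('o, 'u) module \<Rightarrow> 'o \<times> 'u \<times> 'n) \<Rightarrow> (('o, 'u) module, ('o, 'u) module_arrow, 'p, 'n) cfunctor"
  where "extension P = \<lparr>fobj = (\<lambda>F\<in>Obj (mod_adm E). val (P F)),
    fmap = (\<lambda>\<alpha>\<in>Arr (mod_adm E). THE w. induced \<alpha> (P (src \<alpha>)) (P (tgt \<alpha>)) w)\<rparr>"

context
  fixes P :: "('o, 'u) module \<Rightarrow> 'o \<times> 'u \<times> 'n"
  assumes P: "\<And>F. adm_presented E F \<Longrightarrow> presents F (P F)"
begin

lemma fobj_extension: "adm_presented E F \<Longrightarrow> fobj (extension P) F = val (P F)"
  by (simp add: extension_def)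

lemma induced_extension:
  assumes \<alpha>: "\<alpha> \<in> Hom (mod_adm E) F G"
  shows "induced \<alpha> (P F) (P G) (fmap (extension P) \<alpha>)"
proof -
  have a: "\<alpha> \<in> Arr (Mod_cat E)" "src \<alpha> = F" "tgt \<alpha> = G" and p: "presents (src \<alpha>) (P F)" "presents (tgt \<alpha>) (P G)"
    and fm: "fmap (extension P) \<alpha> = (THE w. induced \<alpha> (P F) (P G) w)"
    using \<alpha> P by (auto simp: Hom_mod_adm extension_def Arr_mod_adm)
  obtain w where w: "induced \<alpha> (P F) (P G) w" using induced_exists[OF a(1) p] .
  show ?thesis unfolding fm using w by (rule theI) (rule induced_unique[OF a(1) p _ w])
qed

lemma extension_eqI:
  assumes \<alpha>: "\<alpha> \<in> Hom (mod_adm E) F G" and "induced \<alpha> (P F) (P G) w"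
  shows "fmap (extension P) \<alpha> = w"
proof -
  have "\<alpha> \<in> Arr (Mod_cat E)" and p: "presents (src \<alpha>) (P F)" "presents (tgt \<alpha>) (P G)"
    using \<alpha> P by (auto simp: Hom_mod_adm)
  then show ?thesis using induced_unique[OF _ p induced_extension[OF \<alpha>] assms(2)] by simp
qed

lemma additive_functor_extension: "additive_functor (mod_adm E) C (extension P)"
proof
  note catE = E.is_category_axioms
  show "fobj (extension P) \<in> extensional (Obj (mod_adm E))" "fmap (extension P) \<in> extensional (Arr (mod_adm E))"
    by (simp_all add: extension_def)
  show "fobj (extension P) F \<in> Obj C" if "F \<in> Obj (mod_adm E)" for F
  proof -
    have F: "adm_presented E F" using that by simp
    obtain Y y c where Pe: "P F = (Y, y, c)" by (cases "P F") auto
    show ?thesis using C.HomD(5)[OF presentsD(8)[OF P[OF F, unfolded Pe]]] by (simp add: fobj_extension[OF F] Pe)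
  qed
  show "fmap (extension P) \<alpha> \<in> Hom C (fobj (extension P) F) (fobj (extension P) G)"
    if \<alpha>: "\<alpha> \<in> Hom (mod_adm E) F G" for \<alpha> F G
    using induced_Hom[OF induced_extension[OF \<alpha>]] \<alpha> by (simp add: fobj_extension Hom_mod_adm)
  show "fmap (extension P) (Id (mod_adm E) F) = Id C (fobj (extension P) F)" if "F \<in> Obj (mod_adm E)" for F
  proof -
    have F: "adm_presented E F" using that by simp
    have i: "Id (mod_adm E) F \<in> Hom (mod_adm E) F F"
      using Id_Mod_cat_closed(1)[OF catE adm_presented_module[OF F]] F by (simp add: Hom_mod_adm Mod_cat_simps(4))
    show ?thesis
      using extension_eqI[OF i] induced_id[OF P[OF F]] by (simp add: fobj_extension[OF F])
  qed
  show "fmap (extension P) (\<beta> \<cdot>\<^bsub>mod_adm E\<^esub> \<alpha>) = fmap (extension P) \<beta> \<cdot>\<^bsub>C\<^esub> fmap (extension P) \<alpha>"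
    if \<alpha>: "\<alpha> \<in> Hom (mod_adm E) F G" and \<beta>: "\<beta> \<in> Hom (mod_adm E) G H" for \<alpha> \<beta> F G H
  proof -
    have a: "\<alpha> \<in> Arr (Mod_cat E)" "src \<alpha> = F" "tgt \<alpha> = G" "adm_presented E F"
      and b: "\<beta> \<in> Arr (Mod_cat E)" "src \<beta> = G" "tgt \<beta> = H" "adm_presented E G" "adm_presented E H"
      using \<alpha> \<beta> by (auto simp: Hom_mod_adm)
    have ab: "\<beta> \<cdot>\<^bsub>mod_adm E\<^esub> \<alpha> \<in> Hom (mod_adm E) F H"
      using Comp_Mod_cat_closed(1)[OF catE a(1) b(1)] a b by (simp add: Hom_mod_adm Mod_cat_simps(5))
    have "induced (Comp (Mod_cat E) \<beta> \<alpha>) (P F) (P H) (fmap (extension P) \<beta> \<cdot>\<^bsub>C\<^esub> fmap (extension P) \<alpha>)"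
      by (rule induced_comp[OF a(1) b(1) _ _ _ _ induced_extension[OF \<alpha>] induced_extension[OF \<beta>]])
        (use a b P in auto)
    then show ?thesis using extension_eqI[OF ab] by simp
  qed
  show "fmap (extension P) (plus_arr (mod_adm E) \<alpha> \<beta>) = plus_arr C (fmap (extension P) \<alpha>) (fmap (extension P) \<beta>)"
    if \<alpha>: "\<alpha> \<in> Hom (mod_adm E) F G" and \<beta>: "\<beta> \<in> Hom (mod_adm E) F G" for \<alpha> \<beta> F G
  proof -
    have a: "\<alpha> \<in> Arr (Mod_cat E)" "src \<alpha> = F" "tgt \<alpha> = G" "adm_presented E F" "adm_presented E G"
      and b: "\<beta> \<in> Arr (Mod_cat E)" "src \<beta> = F" "tgt \<beta> = G"
      using \<alpha> \<beta> by (auto simp: Hom_mod_adm)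
    have ab: "plus_arr (mod_adm E) \<alpha> \<beta> \<in> Hom (mod_adm E) F G"
      using plus_Mod_cat_closed(1)[OF catE a(1) b(1)] a b by (simp add: Hom_mod_adm Mod_cat_simps(6))
    have "induced (plus_arr (Mod_cat E) \<alpha> \<beta>) (P F) (P G) (plus_arr C (fmap (extension P) \<alpha>) (fmap (extension P) \<beta>))"
      by (rule induced_plus[OF a(1) b(1) _ _ _ _ induced_extension[OF \<alpha>] induced_extension[OF \<beta>]])
        (use a b P in auto)
    then show ?thesis using extension_eqI[OF ab] by simp
  qed
qed

text \<open>The horseshoe starts from the selected presentation of the first term but makes its own
  for the other two. The isomorphisms \<open>s\<close> and \<open>r\<close> over the identities
  carry its conflation to the one formed by the selected values.\<close>

lemma exact_functor_extension:
  assumes left_exact: "left_exact_functor E C \<Phi>"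
  shows "exact_functor (mod_adm E) C (extension P)"
  unfolding exact_functor_def
proof (intro conjI additive_functor_extension ballI, clarify)
  fix \<alpha> \<beta> assume "(\<alpha>, \<beta>) \<in> Confl (mod_adm E)"
  then have ses: "short_exact_seq E \<alpha> \<beta>" and adm: "adm_presented E (src \<alpha>)" "adm_presented E (src \<beta>)" "adm_presented E (tgt \<beta>)"
    and a: "\<alpha> \<in> Arr (Mod_cat E)" and b: "\<beta> \<in> Arr (Mod_cat E)" and st: "tgt \<alpha> = src \<beta>"
    by (auto simp: Confl_mod_adm short_exact_seq_def right_exact_seq_def)
  let ?F = "src \<alpha>" and ?G = "src \<beta>" and ?H = "tgt \<beta>"
  note catE = E.is_category_axioms
  have \<alpha>: "\<alpha> \<in> Hom (mod_adm E) ?F ?G" and \<beta>: "\<beta> \<in> Hom (mod_adm E) ?G ?H"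
    using a b adm st by (auto simp: Hom_mod_adm)
  obtain Y1 y1 c1 where PF: "P ?F = (Y1, y1, c1)" by (cases "P ?F") auto
  obtain f X Y \<pi> k K q n where H: "f \<in> Hom E X Y" "right_exact_seq E (yoneda_arr E f) \<pi>" "tgt \<pi> = ?H"
    "k \<in> Hom E K X" "f \<cdot>\<^bsub>E\<^esub> k = zero_arr E K Y" "(fmap \<Phi> k, q) \<in> Confl C" "inflation C n"
    "Cod C q = Dom C n" "fmap \<Phi> f = n \<cdot>\<^bsub>C\<^esub> q"
    using adm_presentation[OF left_exact adm(3)] .
  obtain Q P2 i' c' where Q: "presents ?G Q" and P2: "presents ?H P2"
    and i': "induced \<alpha> (P ?F) Q i'" and c': "induced \<beta> Q P2 c'" and confl: "(i', c') \<in> Confl C"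
    using horseshoe[OF ses P[OF adm(1), unfolded PF] H] unfolding PF .
  obtain s where s: "induced (Id (Mod_cat E) ?G) Q (P ?G) s" "iso_arr C s" using presents_iso[OF Q P[OF adm(2)]] .
  obtain r where r: "induced (Id (Mod_cat E) ?H) P2 (P ?H) r" "iso_arr C r" using presents_iso[OF P2 P[OF adm(3)]] .
  let ?\<alpha> = "fmap (extension P) \<alpha>" and ?\<beta> = "fmap (extension P) \<beta>"
  note ia = induced_extension[OF \<alpha>] and ib = induced_extension[OF \<beta>]
  have m: "is_module E ?G" "is_module E ?H" using b by (auto simp: Arr_Mod_cat)
  note IG = Id_Mod_cat_closed(1)[OF catE m(1)] and IH = Id_Mod_cat_closed(1)[OF catE m(2)]
  have idst [simp]: "src (Id (Mod_cat E) M) = M" "tgt (Id (Mod_cat E) M) = M" for M :: "('o, 'u) module"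
    by (simp_all add: Mod_cat_simps(4))
  \<comment> \<open>Both sides of each square are induced by the same arrow of modules with respect
    to the same presentations, hence they are equal.\<close>
  have "induced (Comp (Mod_cat E) (Id (Mod_cat E) ?G) \<alpha>) (P ?F) (P ?G) (s \<cdot>\<^bsub>C\<^esub> i')"
    by (rule induced_comp[OF a IG _ _ _ _ i' s(1)]) (use st P adm Q in auto)
  then have eq1: "?\<alpha> = s \<cdot>\<^bsub>C\<^esub> i'" using extension_eqI[OF \<alpha>] Comp_Id_Mod_cat(2)[OF catE a] st by simp
  have "induced (Comp (Mod_cat E) \<beta> (Id (Mod_cat E) ?G)) Q (P ?H) (?\<beta> \<cdot>\<^bsub>C\<^esub> s)"
    by (rule induced_comp[OF IG b _ _ _ _ s(1) ib]) (use st P adm Q in auto)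
  moreover have "induced (Comp (Mod_cat E) (Id (Mod_cat E) ?H) \<beta>) Q (P ?H) (r \<cdot>\<^bsub>C\<^esub> c')"
    by (rule induced_comp[OF b IH _ _ _ _ c' r(1)]) (use st P adm Q P2 in auto)
  ultimately have eq2: "?\<beta> \<cdot>\<^bsub>C\<^esub> s = r \<cdot>\<^bsub>C\<^esub> c'"
    using induced_unique[OF b Q P[OF adm(3)]] Comp_Id_Mod_cat[OF catE b] by simp
  note d = C.conflD[OF confl]
  note hs = induced_Hom[OF s(1)] and hr = induced_Hom[OF r(1)] and ha = induced_Hom[OF ia] and hb = induced_Hom[OF ib]
    and hi = induced_Hom[OF i'] and hc = induced_Hom[OF c']
  show "(?\<alpha>, ?\<beta>) \<in> Confl C"
  proof (rule C.confl_iso_closed[OF confl _ _ _ C.iso_arr_Id s(2) r(2)])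
    show "?\<alpha> \<in> Arr C" "?\<beta> \<in> Arr C" "Cod C ?\<alpha> = Dom C ?\<beta>"
      using C.HomD[OF ha] C.HomD[OF hb] by simp_all
    show "val (P ?F) \<in> Obj C" using C.HomD(4)[OF ha] .
    then show "Id C (val (P ?F)) \<in> Hom C (Dom C i') (Dom C ?\<alpha>)"
      using C.id_closed C.HomD(2)[OF hi] C.HomD(2)[OF ha] by simp
    show "s \<in> Hom C (Cod C i') (Cod C ?\<alpha>)" using hs C.HomD(3)[OF hi] C.HomD(3)[OF ha] by simp
    show "r \<in> Hom C (Cod C c') (Cod C ?\<beta>)" using hr C.HomD(3)[OF hc] C.HomD(3)[OF hb] by simp
    show "s \<cdot>\<^bsub>C\<^esub> i' = ?\<alpha> \<cdot>\<^bsub>C\<^esub> Id C (val (P ?F))" using eq1 C.comp_id_right[OF ha] by simp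
    show "r \<cdot>\<^bsub>C\<^esub> c' = ?\<beta> \<cdot>\<^bsub>C\<^esub> s" using eq2 by simp
  qed
qed

text \<open>With the identities as generators, \<open>f\<close> is itself a lift of \<Upsilon>(f),
  and both universal arrows are identities. So the induced arrow is \<Phi>(f).\<close>

lemma extension_yoneda:
  assumes rep: "\<And>X. X \<in> Obj E \<Longrightarrow> P (yoneda_obj E X) = (X, Id E X, Id C (fobj \<Phi> X))"
  shows "comp_functor E (extension P) (yoneda E) = \<Phi>"
proof -
  have "compose (Obj E) (fobj (extension P)) (fobj (yoneda E)) = fobj \<Phi>"
  proof (rule extensionalityI[OF compose_extensional additive_functor.fobj_extensional[OF additive]])
    fix X assume X: "X \<in> Obj E"
    then show "compose (Obj E) (fobj (extension P)) (fobj (yoneda E)) X = fobj \<Phi> X"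
      using fobj_extension[OF E.adm_presented_yoneda_obj[OF X]] rep[OF X] C.HomD(3)[OF C.id_closed[OF \<Phi>_Obj[OF X]]]
      by (simp add: compose_eq E.yoneda_simps)
  qed
  moreover have "compose (Arr E) (fmap (extension P)) (fmap (yoneda E)) = fmap \<Phi>"
  proof (rule extensionalityI[OF compose_extensional additive_functor.fmap_extensional[OF additive]])
    fix f assume "f \<in> Arr E"
    then have f: "f \<in> Hom E (Dom E f) (Cod E f)" by (rule Arr_Hom)
    let ?X = "Dom E f" and ?Y = "Cod E f"
    note X = E.HomD(4)[OF f] and Y = E.HomD(5)[OF f]
    note iX = C.id_closed[OF \<Phi>_Obj[OF X]] and iY = C.id_closed[OF \<Phi>_Obj[OF Y]]
    have "induced (yoneda_arr E f) (?X, Id E ?X, Id C (fobj \<Phi> ?X)) (?Y, Id E ?Y, Id C (fobj \<Phi> ?Y)) (fmap \<Phi> f)"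
    proof (rule inducedI[OF _ f])
      show "presents (tgt (yoneda_arr E f)) (?Y, Id E ?Y, Id C (fobj \<Phi> ?Y))"
        using presents_yoneda_obj[OF Y] by simp
      show "act (tgt (yoneda_arr E f)) f (Id E ?Y) = component (yoneda_arr E f) ?X (Id E ?X)"
        using E.act_yoneda_obj[OF f E.id_closed[OF Y]] E.comp_id_left[OF f] E.comp_id_right[OF f]
          E.component_yoneda_arr[OF E.id_closed[OF X]] by simp
      show "fmap \<Phi> f \<in> Hom C (Cod C (Id C (fobj \<Phi> ?X))) (Cod C (Id C (fobj \<Phi> ?Y)))"
        using \<Phi>_Hom[OF f] C.HomD(3)[OF iX] C.HomD(3)[OF iY] by simp
      show "fmap \<Phi> f \<cdot>\<^bsub>C\<^esub> Id C (fobj \<Phi> ?X) = Id C (fobj \<Phi> ?Y) \<cdot>\<^bsub>C\<^esub> fmap \<Phi> f"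
        using C.comp_id_left[OF \<Phi>_Hom[OF f]] C.comp_id_right[OF \<Phi>_Hom[OF f]] by simp
    qed
    then have "fmap (extension P) (yoneda_arr E f) = fmap \<Phi> f"
      using extension_eqI[OF E.yoneda_arr_mod_adm[OF f]] rep[OF X] rep[OF Y] by simp
    then show "compose (Arr E) (fmap (extension P)) (fmap (yoneda E)) f = fmap \<Phi> f"
      using \<open>f \<in> Arr E\<close> by (simp add: compose_eq E.yoneda_simps(2)[OF f])
  qed
  ultimately show ?thesis by (simp add: comp_functor_def)
qed

end

theorem exact_extension_exists:
  assumes "left_exact_functor E C \<Phi>"
  obtains \<Psi> where "exact_functor (mod_adm E) C \<Psi>" "comp_functor E \<Psi> (yoneda E) = \<Phi>"
proof -
  \<comment> \<open>The choice at representable modules makes the restriction along \<open>\<Upsilon>\<close> equal to \<open>\<Phi>\<close>, not just isomorphic.\<close>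
  define P where "P F = (if \<exists>X\<in>Obj E. F = yoneda_obj E X
      then let X = (THE X. X \<in> Obj E \<and> F = yoneda_obj E X) in (X, Id E X, Id C (fobj \<Phi> X))
      else (SOME P. presents F P))" for F
  have rep: "P (yoneda_obj E X) = (X, Id E X, Id C (fobj \<Phi> X))" if X: "X \<in> Obj E" for X
  proof -
    have "(THE X'. X' \<in> Obj E \<and> yoneda_obj E X = yoneda_obj E X') = X"
      using X E.yoneda_obj_inj by (intro the_equality) auto
    then show ?thesis using X unfolding P_def by (auto simp: Let_def)
  qed
  have "presents F (P F)" if F: "adm_presented E F" for F
  proof (cases "\<exists>X\<in>Obj E. F = yoneda_obj E X")
    case True
    then show ?thesis using rep presents_yoneda_obj by auto
  next
    case False
    obtain Q where "presents F Q" using presents_exists[OF assms F] .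
    then have "presents F (SOME P. presents F P)" by (rule someI)
    then show ?thesis using False unfolding P_def by simp
  qed
  then show ?thesis using that exact_functor_extension[OF _ assms] extension_yoneda[OF _ rep] by blast
qed

text \<open>Resolving a presentation \<open>\<Upsilon>(f)\<close> by the two conflations through its image shows that an exact functor
  extending \<open>\<Phi>\<close> sends its cokernel to a cokernel of \<open>\<Phi>(f)\<close>.\<close>

lemma exact_extension_presents:
  assumes exact: "exact_functor (mod_adm E) C \<Psi>" and ext: "comp_functor E \<Psi> (yoneda E) = \<Phi>"
    and f: "admissible E f" and \<pi>: "right_exact_seq E (yoneda_arr E f) \<pi>"
  shows "presents (tgt \<pi>) (Cod E f, component \<pi> (Cod E f) (Id E (Cod E f)), fmap \<Psi> \<pi>)"
proof -
  have ad: "additive_functor (mod_adm E) C \<Psi>" and ex: "\<And>\<alpha> \<beta>. (\<alpha>, \<beta>) \<in> Confl (mod_adm E) \<Longrightarrow> (fmap \<Psi> \<alpha>, fmap \<Psi> \<beta>) \<in> Confl C"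
    using exact by (auto simp: exact_functor_def)
  obtain p m where "deflation E p" and m: "inflation E m" and pm: "Cod E p = Dom E m" and mp: "f = m \<cdot>\<^bsub>E\<^esub> p"
    using f by (auto simp: admissible_def)
  then obtain k where kp: "(k, p) \<in> Confl E" by (auto simp: deflation_def)
  have "p \<in> Hom E (Dom E p) (Dom E m)" "m \<in> Hom E (Dom E m) (Cod E m)"
    using E.conflD(4)[OF kp] pm E.inflation_closed[OF m] by simp_all
  then have fh: "f \<in> Hom E (Dom E p) (Cod E m)" unfolding mp by (rule E.comp_closed)
  obtain \<epsilon> \<iota> where e: "(yoneda_arr E k, \<epsilon>) \<in> Confl (mod_adm E)" "(\<iota>, \<pi>) \<in> Confl (mod_adm E)"
    "Comp (Mod_cat E) \<iota> \<epsilon> = yoneda_arr E f" "src \<epsilon> = yoneda_obj E (Dom E p)" "tgt \<epsilon> = src \<iota>"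
    "\<epsilon> \<in> Arr (Mod_cat E)" "\<iota> \<in> Arr (Mod_cat E)"
    using E.admissible_image_conflations[OF kp m pm \<pi>[unfolded mp]] unfolding mp .
  have "adm_presented E (src \<epsilon>)" unfolding e(4) by (rule E.adm_presented_yoneda_obj[OF E.HomD(4)[OF fh]])
  then have he: "\<epsilon> \<in> Hom (mod_adm E) (src \<epsilon>) (src \<iota>)" and hi: "\<iota> \<in> Hom (mod_adm E) (src \<iota>) (tgt \<iota>)"
    using e by (auto simp: Hom_mod_adm Confl_mod_adm)
  have "fmap \<Psi> (yoneda_arr E f) = fmap \<Psi> \<iota> \<cdot>\<^bsub>C\<^esub> fmap \<Psi> \<epsilon>"
    using additive_functor.fmap_comp[OF ad he hi] e(3) by simp
  moreover have "fmap \<Psi> (yoneda_arr E f) = fmap \<Phi> f"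
    using ext[symmetric] E.HomD(1)[OF fh] by (simp add: comp_functor_def compose_eq E.yoneda_simps(2)[OF fh])
  moreover have "Cod C (fmap \<Psi> \<epsilon>) = Dom C (fmap \<Psi> \<iota>)"
    using C.HomD(3)[OF additive_functor.fmap_closed[OF ad he]] C.HomD(2)[OF additive_functor.fmap_closed[OF ad hi]] by simp
  moreover have "deflation C (fmap \<Psi> \<epsilon>)" using ex[OF e(1)] by (auto simp: deflation_def)
  ultimately have "is_cokernel C (fmap \<Psi> \<pi>) (fmap \<Phi> f)"
    using C.cokernel_comp_deflation[OF ex[OF e(2)]] by simp
  from presents_of_cokernel[OF fh \<pi> this] show ?thesis using E.HomD(3)[OF fh] by simp
qed

text \<open>A lift \<phi> of \<alpha> makes \<open>\<alpha> \<cdot> \<pi>\<close> and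
  \<open>\<pi>' \<cdot> \<Upsilon>(\<phi>)\<close> equal: both start at a representable module and
  agree on its identity element. Applying \<Psi>, which restricts to \<Phi>, gives the equation that
  defines induced arrows.\<close>

lemma exact_extension_induced:
  assumes exact: "exact_functor (mod_adm E) C \<Psi>" and ext: "comp_functor E \<Psi> (yoneda E) = \<Phi>"
    and \<alpha>: "\<alpha> \<in> Hom (mod_adm E) F G"
    and f: "admissible E f" and \<pi>: "right_exact_seq E (yoneda_arr E f) \<pi>" "tgt \<pi> = F"
    and f': "admissible E f'" and \<pi>': "right_exact_seq E (yoneda_arr E f') \<pi>'" "tgt \<pi>' = G"
  shows "induced \<alpha> (Cod E f, component \<pi> (Cod E f) (Id E (Cod E f)), fmap \<Psi> \<pi>)
    (Cod E f', component \<pi>' (Cod E f') (Id E (Cod E f')), fmap \<Psi> \<pi>') (fmap \<Psi> \<alpha>)"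
proof -
  note catE = E.is_category_axioms
  have ad: "additive_functor (mod_adm E) C \<Psi>" using exact by (simp add: exact_functor_def)
  let ?Y = "Cod E f" and ?Y' = "Cod E f'"
  have a: "\<alpha> \<in> Arr (Mod_cat E)" "src \<alpha> = F" "tgt \<alpha> = G" "adm_presented E F" "adm_presented E G"
    using \<alpha> by (auto simp: Hom_mod_adm)
  have p: "\<pi> \<in> Arr (Mod_cat E)" "src \<pi> = yoneda_obj E ?Y" and p': "\<pi>' \<in> Arr (Mod_cat E)" "src \<pi>' = yoneda_obj E ?Y'"
    using \<pi>(1) \<pi>'(1) by (auto simp: right_exact_seq_def)
  note P = exact_extension_presents[OF exact ext f \<pi>(1), unfolded \<pi>(2)]
    and P' = exact_extension_presents[OF exact ext f' \<pi>'(1), unfolded \<pi>'(2)]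
  note oY = presentsD(2)[OF P] and oY' = presentsD(2)[OF P']
  have hp: "\<pi> \<in> Hom (mod_adm E) (yoneda_obj E ?Y) F" and hp': "\<pi>' \<in> Hom (mod_adm E) (yoneda_obj E ?Y') G"
    using p p' \<pi>(2) \<pi>'(2) a E.adm_presented_yoneda_obj[OF oY] E.adm_presented_yoneda_obj[OF oY']
    by (auto simp: Hom_mod_adm)
  note ha = additive_functor.fmap_closed[OF ad \<alpha>] and h\<pi> = additive_functor.fmap_closed[OF ad hp]
    and h\<pi>' = additive_functor.fmap_closed[OF ad hp']
  show ?thesis
    unfolding induced.simps
  proof (intro conjI ballI impI)
    show "fmap \<Psi> \<alpha> \<in> Hom C (Cod C (fmap \<Psi> \<pi>)) (Cod C (fmap \<Psi> \<pi>'))"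
      using ha C.HomD(3)[OF h\<pi>] C.HomD(3)[OF h\<pi>'] by simp
    fix \<phi> assume \<phi>: "\<phi> \<in> Hom E ?Y ?Y'"
      and lift: "act (tgt \<alpha>) \<phi> (component \<pi>' ?Y' (Id E ?Y')) = component \<alpha> ?Y (component \<pi> ?Y (Id E ?Y))"
    note y\<phi> = E.yoneda_arr_mod_adm[OF \<phi>]
    have y\<phi>a: "yoneda_arr E \<phi> \<in> Arr (Mod_cat E)" "src (yoneda_arr E \<phi>) = yoneda_obj E ?Y" "tgt (yoneda_arr E \<phi>) = yoneda_obj E ?Y'"
      using y\<phi> by (auto simp: Hom_mod_adm)
    have m: "is_module E G" using a by (auto simp: Arr_Mod_cat)
    note c1 = Comp_Mod_cat_closed[OF catE p(1) a(1)] and c2 = Comp_Mod_cat_closed[OF catE y\<phi>a(1) p'(1)]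
    have "Comp (Mod_cat E) \<alpha> \<pi> = Comp (Mod_cat E) \<pi>' (yoneda_arr E \<phi>)"
    proof (rule module_arrow_eqI)
      show "Comp (Mod_cat E) \<alpha> \<pi> \<in> Arr (Mod_cat E)" "Comp (Mod_cat E) \<pi>' (yoneda_arr E \<phi>) \<in> Arr (Mod_cat E)"
        using c1(1) c2(1) \<pi>(2) a y\<phi>a p' by simp_all
      show "src (Comp (Mod_cat E) \<alpha> \<pi>) = src (Comp (Mod_cat E) \<pi>' (yoneda_arr E \<phi>))"
        "tgt (Comp (Mod_cat E) \<alpha> \<pi>) = tgt (Comp (Mod_cat E) \<pi>' (yoneda_arr E \<phi>))"
        using p p' y\<phi>a a \<pi>' by (simp_all add: Mod_cat_simps(5))
      fix Z u assume Z: "Z \<in> Obj E" and "u \<in> el (src (Comp (Mod_cat E) \<alpha> \<pi>)) Z"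
      then have u: "u \<in> Hom E Z ?Y" using p by (simp add: Mod_cat_simps(5))
      have uy: "u \<in> el (yoneda_obj E ?Y) Z" by (rule E.el_yoneda_obj[OF u])
      have pi: "component \<pi> ?Y (Id E ?Y) \<in> el F ?Y" "component \<pi>' ?Y' (Id E ?Y') \<in> el G ?Y'"
        using presentsD(3)[OF P] presentsD(3)[OF P'] .
      have "component (Comp (Mod_cat E) \<alpha> \<pi>) Z u = component \<alpha> Z (act F u (component \<pi> ?Y (Id E ?Y)))"
        using c1(2)[OF _ Z] uy p a \<pi>(2) E.yoneda_lemma[OF p u] by simp
      also have "\<dots> = act G u (act G \<phi> (component \<pi>' ?Y' (Id E ?Y')))"
        using component_act[OF a(1) catE u] a(2,3) pi(1) lift by simp
      also have "\<dots> = act G (\<phi> \<cdot>\<^bsub>E\<^esub> u) (component \<pi>' ?Y' (Id E ?Y'))"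
        using act_comp[OF m u \<phi> pi(2)] by simp
      also have "\<dots> = component \<pi>' Z (\<phi> \<cdot>\<^bsub>E\<^esub> u)"
        using E.yoneda_lemma[OF p' E.comp_closed[OF u \<phi>]] \<pi>'(2) by simp
      also have "\<dots> = component (Comp (Mod_cat E) \<pi>' (yoneda_arr E \<phi>)) Z u"
        using c2(2)[OF _ Z] uy y\<phi>a p' E.component_yoneda_arr[of u Z \<phi>] u E.HomD(2)[OF \<phi>] by simp
      finally show "component (Comp (Mod_cat E) \<alpha> \<pi>) Z u = component (Comp (Mod_cat E) \<pi>' (yoneda_arr E \<phi>)) Z u" .
    qed
    then have "fmap \<Psi> \<alpha> \<cdot>\<^bsub>C\<^esub> fmap \<Psi> \<pi> = fmap \<Psi> \<pi>' \<cdot>\<^bsub>C\<^esub> fmap \<Psi> (yoneda_arr E \<phi>)"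
      using additive_functor.fmap_comp[OF ad hp \<alpha>] additive_functor.fmap_comp[OF ad y\<phi> hp'] by simp
    moreover have "fmap \<Psi> (yoneda_arr E \<phi>) = fmap \<Phi> \<phi>"
      using ext[symmetric] E.HomD(1)[OF \<phi>] by (simp add: comp_functor_def compose_eq E.yoneda_simps(2)[OF \<phi>])
    ultimately show "fmap \<Psi> \<alpha> \<cdot>\<^bsub>C\<^esub> fmap \<Psi> \<pi> = fmap \<Psi> \<pi>' \<cdot>\<^bsub>C\<^esub> fmap \<Phi> \<phi>" by simp
  qed
qed

text \<open>At each module both extensions yield presentations, with the values of the functors as
  values; these are compared by the isomorphism over the identity. Both functors act on arrows by
  induced arrows, so naturality is an instance of the uniqueness of induced arrows.\<close>

theorem exact_extension_unique:
  assumes \<Psi>: "exact_functor (mod_adm E) C \<Psi>" "comp_functor E \<Psi> (yoneda E) = \<Phi>"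
    and \<Psi>': "exact_functor (mod_adm E) C \<Psi>'" "comp_functor E \<Psi>' (yoneda E) = \<Phi>"
  shows "isomorphic_functors (mod_adm E) C \<Psi>' \<Psi>"
proof -
  note catE = E.is_category_axioms
  have "\<exists>f \<pi>. admissible E f \<and> tgt \<pi> = F \<and> right_exact_seq E (yoneda_arr E f) \<pi>" if "adm_presented E F" for F
    using that by (simp add: adm_presented_def)
  then obtain f \<pi> where f: "\<And>F. adm_presented E F \<Longrightarrow> admissible E (f F)"
    and \<pi>: "\<And>F. adm_presented E F \<Longrightarrow> right_exact_seq E (yoneda_arr E (f F)) (\<pi> F)"
    and t\<pi>: "\<And>F. adm_presented E F \<Longrightarrow> tgt (\<pi> F) = F" by metis
  \<comment> \<open>The generator is chosen once for all extensions; only the universal arrow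
    depends on \<Theta>, and it ends at the value of \<Theta>.\<close>
  define P where "P \<Theta> F = (Cod E (f F), component (\<pi> F) (Cod E (f F)) (Id E (Cod E (f F))), fmap \<Theta> (\<pi> F))"
    for \<Theta> :: "(('o, 'u) module, ('o, 'u) module_arrow, 'p, 'n) cfunctor" and F
  have pres: "presents F (P \<Theta> F)"
    if "exact_functor (mod_adm E) C \<Theta>" "comp_functor E \<Theta> (yoneda E) = \<Phi>" "adm_presented E F" for \<Theta> F
    using exact_extension_presents[OF that(1,2) f[OF that(3)] \<pi>[OF that(3)]] t\<pi>[OF that(3)] by (simp add: P_def)
  have ind: "induced \<alpha> (P \<Theta> F) (P \<Theta> G) (fmap \<Theta> \<alpha>)"
    if \<Theta>: "exact_functor (mod_adm E) C \<Theta>" "comp_functor E \<Theta> (yoneda E) = \<Phi>" and \<alpha>: "\<alpha> \<in> Hom (mod_adm E) F G" for \<Theta> F G \<alpha>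
  proof -
    have F: "adm_presented E F" and G: "adm_presented E G" using \<alpha> by (auto simp: Hom_mod_adm)
    show ?thesis unfolding P_def
      by (rule exact_extension_induced[OF \<Theta> \<alpha> f[OF F] \<pi>[OF F] t\<pi>[OF F] f[OF G] \<pi>[OF G] t\<pi>[OF G]])
  qed
  have val: "val (P \<Theta> F) = fobj \<Theta> F"
    if \<Theta>: "exact_functor (mod_adm E) C \<Theta>" "comp_functor E \<Theta> (yoneda E) = \<Phi>" and F: "adm_presented E F" for \<Theta> F
  proof -
    have ad: "additive_functor (mod_adm E) C \<Theta>" using \<Theta> by (simp add: exact_functor_def)
    have "Cod E (f F) \<in> Obj E" using pres[OF \<Theta> F] presentsD(2) unfolding P_def by blast
    then have "\<pi> F \<in> Hom (mod_adm E) (yoneda_obj E (Cod E (f F))) F"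
      using \<pi>[OF F] t\<pi>[OF F] F E.adm_presented_yoneda_obj[of "Cod E (f F)"]
      by (simp add: Hom_mod_adm right_exact_seq_def)
    from C.HomD(3)[OF additive_functor.fmap_closed[OF ad this]] show ?thesis by (simp add: P_def)
  qed
  have "\<exists>s. induced (Id (Mod_cat E) F) (P \<Psi>' F) (P \<Psi> F) s \<and> iso_arr C s" if F: "adm_presented E F" for F
    using presents_iso[OF pres[OF \<Psi>' F] pres[OF \<Psi> F]] by blast
  then obtain s where s: "\<And>F. adm_presented E F \<Longrightarrow> induced (Id (Mod_cat E) F) (P \<Psi>' F) (P \<Psi> F) (s F)"
    and s_iso: "\<And>F. adm_presented E F \<Longrightarrow> iso_arr C (s F)" by metis
  define \<eta> where "\<eta> = restrict s (Obj (mod_adm E))"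
  have idst [simp]: "src (Id (Mod_cat E) M) = M" "tgt (Id (Mod_cat E) M) = M" for M :: "('o, 'u) module"
    by (simp_all add: Mod_cat_simps(4))
  have "nat_trans (mod_adm E) C \<Psi>' \<Psi> \<eta>"
    unfolding nat_trans_def
  proof (intro conjI ballI)
    show "\<eta> \<in> extensional (Obj (mod_adm E))" by (simp add: \<eta>_def)
    show "\<eta> F \<in> Hom C (fobj \<Psi>' F) (fobj \<Psi> F)" if "F \<in> Obj (mod_adm E)" for F
    proof -
      have F: "adm_presented E F" using that by simp
      show ?thesis using induced_Hom[OF s[OF F]] F val[OF \<Psi>' F] val[OF \<Psi> F] by (simp add: \<eta>_def)
    qed
    fix \<alpha> assume "\<alpha> \<in> Arr (mod_adm E)"
    then have a: "\<alpha> \<in> Arr (Mod_cat E)" and F: "adm_presented E (src \<alpha>)" and G: "adm_presented E (tgt \<alpha>)"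
      and \<alpha>: "\<alpha> \<in> Hom (mod_adm E) (src \<alpha>) (tgt \<alpha>)" by (auto simp: Arr_mod_adm Hom_mod_adm)
    note IF = Id_Mod_cat_closed(1)[OF catE adm_presented_module[OF F]]
      and IG = Id_Mod_cat_closed(1)[OF catE adm_presented_module[OF G]]
    note pF = pres[OF \<Psi> F] pres[OF \<Psi>' F] and pG = pres[OF \<Psi> G] pres[OF \<Psi>' G]
    \<comment> \<open>The two ways around the naturality square are both induced by \<alpha>, from
      the presentation of its source for \<Psi>' to that of its target for \<Psi>.\<close>
    have "induced (Comp (Mod_cat E) (Id (Mod_cat E) (tgt \<alpha>)) \<alpha>) (P \<Psi>' (src \<alpha>)) (P \<Psi> (tgt \<alpha>)) (s (tgt \<alpha>) \<cdot>\<^bsub>C\<^esub> fmap \<Psi>' \<alpha>)"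
      by (rule induced_comp[OF a IG _ _ _ _ ind[OF \<Psi>' \<alpha>] s[OF G]]) (simp_all add: pF pG)
    moreover have "induced (Comp (Mod_cat E) \<alpha> (Id (Mod_cat E) (src \<alpha>))) (P \<Psi>' (src \<alpha>)) (P \<Psi> (tgt \<alpha>)) (fmap \<Psi> \<alpha> \<cdot>\<^bsub>C\<^esub> s (src \<alpha>))"
      by (rule induced_comp[OF IF a _ _ _ _ s[OF F] ind[OF \<Psi> \<alpha>]]) (simp_all add: pF pG)
    ultimately have "s (tgt \<alpha>) \<cdot>\<^bsub>C\<^esub> fmap \<Psi>' \<alpha> = fmap \<Psi> \<alpha> \<cdot>\<^bsub>C\<^esub> s (src \<alpha>)"
      using induced_unique[OF a pF(2) pG(1)] Comp_Id_Mod_cat[OF catE a] by simp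
    then show "\<eta> (Cod (mod_adm E) \<alpha>) \<cdot>\<^bsub>C\<^esub> fmap \<Psi>' \<alpha> = fmap \<Psi> \<alpha> \<cdot>\<^bsub>C\<^esub> \<eta> (Dom (mod_adm E) \<alpha>)"
      using F G by (simp add: \<eta>_def)
  qed
  moreover have "iso_arr C (\<eta> F)" if "F \<in> Obj (mod_adm E)" for F using s_iso that by (simp add: \<eta>_def)
  ultimately show ?thesis unfolding isomorphic_functors_def by blast
qed

end

theorem theorem3p9:
  fixes E :: "('o, 'u) excat"
  assumes "exact_category E"
  shows "left_exact_functor E (mod_adm E) (yoneda E) \<and>
    (\<forall>(C :: ('p, 'n) excat) \<Phi>.
       exact_category C \<and> left_exact_functor E C \<Phi> \<longrightarrow>
       (\<exists>\<Psi>. exact_functor (mod_adm E) C \<Psi> \<and> comp_functor E \<Psi> (yoneda E) = \<Phi> \<and>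
          (\<forall>\<Psi>'. exact_functor (mod_adm E) C \<Psi>' \<and> comp_functor E \<Psi>' (yoneda E) = \<Phi> \<longrightarrow>
             isomorphic_functors (mod_adm E) C \<Psi>' \<Psi>)))"
proof (intro conjI allI impI)
  interpret E: exact_category E by fact
  show "left_exact_functor E (mod_adm E) (yoneda E)" by (rule E.left_exact_yoneda)
  fix C :: "('p, 'n) excat" and \<Phi>
  assume *: "exact_category C \<and> left_exact_functor E C \<Phi>"
  then interpret C: exact_category C by simp
  interpret functor_of_exact_categories E C \<Phi>
    using * by (intro functor_of_exact_categories.intro functor_of_exact_categories_axioms.intro)
      (simp_all add: left_exact_functor_def assms)
  obtain \<Psi> where \<Psi>: "exact_functor (mod_adm E) C \<Psi>" "comp_functor E \<Psi> (yoneda E) = \<Phi>"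
    using exact_extension_exists[OF conjunct2[OF *]] .
  show "\<exists>\<Psi>. exact_functor (mod_adm E) C \<Psi> \<and> comp_functor E \<Psi> (yoneda E) = \<Phi> \<and>
      (\<forall>\<Psi>'. exact_functor (mod_adm E) C \<Psi>' \<and> comp_functor E \<Psi>' (yoneda E) = \<Phi> \<longrightarrow>
         isomorphic_functors (mod_adm E) C \<Psi>' \<Psi>)"
    using \<Psi> exact_extension_unique[OF \<Psi>] by (intro exI[of _ \<Psi>] conjI allI impI) auto
qed

end
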